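(* For every fixed $\alpha\in[0,1)$, FLaMECaST with cost parameter $\alpha$ is NP-hard, even if restricted to group-equally-spaced circular instances with one intermediate layer.
   Context: FLaMECaST: an instance $I=(S,T,C,\alpha)$ consists of a finite set $S$ of sources and a finite set $T$ of sinks, each with a fixed position in $\mathbb{R}^2$, capacities $C=(c_0,\dots,c_{\lambda+1})$ with integers $c_0\ge\dots\ge c_{\lambda+1}\ge 1$ ($\lambda$ = number of intermediate layers), and a parameter $\alpha\in[0,1]$. A topology is a rooted forest (edges directed from child to parent) of height at most $\lambda+1$ whose leaves are exactly $S$ and whose roots lie in $T$ (other vertices are Steiner vertices); the layer of a vertex is its distance to its root; the load $\ell(v)$ of a vertex is the number of sources in its subtree and the load of edge $uv$ ($u$ child) is $\ell(u)$; it is valid if $\ell(v)\le c_i$ for every vertex $v$ in layer $i$. An embedding maps sources and sinks to their positions and Steiner vertices to arbitrary points; edge cost is $\|\mathrm{pos}(u)-\mathrm{pos}(v)\|\cdot\ell(uv)^\alpha$, and the goal is a valid layout (topology plus embedding) of minimum total cost. A circular instance has all sources on a circle and all sinks at its center; it is group-equally-spaced if the sources are partitioned into groups, sources of one group share a position, and the group positions are evenly distributed on the circle. *)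

theory Defs
  imports "HOL-Analysis.Analysis"
begin

section \<open>FLaMECaST\<close>

text \<open>Vertices are natural numbers, so that every instance leaves an unlimited supply of
  Steiner vertices. The list \<open>capacities I\<close> is \<open>[c\<^sub>0, \<dots>, c\<^bsub>\<lambda>+1\<^esub>]\<close>.\<close>

record flamecast =
  sources :: "nat set"
  sinks :: "nat set"
  position :: "nat \<Rightarrow> real \<times> real"
  capacities :: "nat list"
  exponent :: real

definition wf_flamecast :: "flamecast \<Rightarrow> bool" where
  "wf_flamecast I \<longleftrightarrow>
     finite (sources I) \<and> finite (sinks I) \<and> sources I \<inter> sinks I = {} \<and>
     2 \<le> length (capacities I) \<and> sorted_wrt (\<ge>) (capacities I) \<and> (\<forall>c\<in>set (capacities I). 1 \<le> c) \<and>
     0 \<le> exponent I \<and> exponent I \<le> 1"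

definition intermediate_layers :: "flamecast \<Rightarrow> nat" where
  "intermediate_layers I = length (capacities I) - 2"

text \<open>A rooted forest is a finite vertex set with a set of edges (child, parent).\<close>

definition rooted_forest :: "nat set \<Rightarrow> (nat \<times> nat) set \<Rightarrow> bool" where
  "rooted_forest V E \<longleftrightarrow> finite V \<and> E \<subseteq> V \<times> V \<and> single_valued E \<and> acyclic E"

definition leaves :: "nat set \<Rightarrow> (nat \<times> nat) set \<Rightarrow> nat set" where
  "leaves V E = {v \<in> V. \<nexists>u. (u, v) \<in> E}"

definition roots :: "nat set \<Rightarrow> (nat \<times> nat) set \<Rightarrow> nat set" where
  "roots V E = {v \<in> V. \<nexists>w. (v, w) \<in> E}"

definition layer :: "nat set \<Rightarrow> (nat \<times> nat) set \<Rightarrow> nat \<Rightarrow> nat" where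
  "layer V E v = (THE n. \<exists>r\<in>roots V E. (v, r) \<in> E ^^ n)"

definition load :: "flamecast \<Rightarrow> (nat \<times> nat) set \<Rightarrow> nat \<Rightarrow> nat" where
  "load I E v = card {s \<in> sources I. (s, v) \<in> E\<^sup>*}"

text \<open>The equation for the roots says that all roots are sinks and that, conversely, sinks occur
  only as roots: the vertices that are neither leaves nor roots are Steiner vertices. A sink need
  not be used. The height is at most \<open>\<lambda> + 1 = length (capacities I) - 1\<close>.\<close>

definition topology :: "flamecast \<Rightarrow> nat set \<Rightarrow> (nat \<times> nat) set \<Rightarrow> bool" where
  "topology I V E \<longleftrightarrow>
     rooted_forest V E \<and> leaves V E = sources I \<and> roots V E = V \<inter> sinks I \<and>
     (\<forall>v\<in>V. layer V E v \<le> intermediate_layers I + 1)"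

definition valid_topology :: "flamecast \<Rightarrow> nat set \<Rightarrow> (nat \<times> nat) set \<Rightarrow> bool" where
  "valid_topology I V E \<longleftrightarrow>
     topology I V E \<and> (\<forall>v\<in>V. load I E v \<le> capacities I ! layer V E v)"

definition embedding :: "flamecast \<Rightarrow> (nat \<Rightarrow> real \<times> real) \<Rightarrow> bool" where
  "embedding I p \<longleftrightarrow> (\<forall>v \<in> sources I \<union> sinks I. p v = position I v)"

definition valid_layout ::
    "flamecast \<Rightarrow> nat set \<Rightarrow> (nat \<times> nat) set \<Rightarrow> (nat \<Rightarrow> real \<times> real) \<Rightarrow> bool" where
  "valid_layout I V E p \<longleftrightarrow> valid_topology I V E \<and> embedding I p"

text \<open>In a topology every load is at least 1, so for exponent 0 every edge has weight 1.\<close>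

definition cost :: "flamecast \<Rightarrow> (nat \<times> nat) set \<Rightarrow> (nat \<Rightarrow> real \<times> real) \<Rightarrow> real" where
  "cost I E p = (\<Sum>(u, v)\<in>E. dist (p u) (p v) * real (load I E u) powr exponent I)"

definition circular :: "flamecast \<Rightarrow> real \<times> real \<Rightarrow> real \<Rightarrow> bool" where
  "circular I z r \<longleftrightarrow>
     0 < r \<and> (\<forall>s\<in>sources I. position I s \<in> sphere z r) \<and> (\<forall>t\<in>sinks I. position I t = z)"

definition circle_point :: "real \<times> real \<Rightarrow> real \<Rightarrow> real \<Rightarrow> real \<times> real" where
  "circle_point z r \<theta> = z + r *\<^sub>R (cos \<theta>, sin \<theta>)"

text \<open>The sources are partitioned into \<open>k\<close> nonempty groups \<open>0, \<dots>, k - 1\<close>.\<close>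

definition group_equally_spaced :: "flamecast \<Rightarrow> real \<times> real \<Rightarrow> real \<Rightarrow> bool" where
  "group_equally_spaced I z r \<longleftrightarrow>
     (\<exists>k \<theta> (grp :: nat \<Rightarrow> nat). grp ` sources I = {..<k} \<and>
        (\<forall>s\<in>sources I. position I s = circle_point z r (\<theta> + 2 * pi * real (grp s) / real k)))"

definition group_equally_spaced_circular :: "flamecast \<Rightarrow> bool" where
  "group_equally_spaced_circular I \<longleftrightarrow> (\<exists>z r. circular I z r \<and> group_equally_spaced I z r)"


section \<open>Finite descriptions of instances and cost bounds\<close>

text \<open>Evenly spaced points on a circle have irrational coordinates in general. A finite
  description therefore fixes a rational reference point and lists, for every single source and
  sink, rational polar coordinates (radius, angle in full turns) around that point. Since each
  source is listed, the length of a description grows linearly with the number of sources.\<close>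

record description =
  reference :: "rat \<times> rat"
  source_coords :: "(rat \<times> rat) list"
  sink_coords :: "(rat \<times> rat) list"
  capacity_list :: "nat list"

definition polar_point :: "rat \<times> rat \<Rightarrow> rat \<times> rat \<Rightarrow> real \<times> real" where
  "polar_point z c = circle_point (real_of_rat (fst z), real_of_rat (snd z))
     (real_of_rat (fst c)) (2 * pi * real_of_rat (snd c))"

definition instance_of :: "real \<Rightarrow> description \<Rightarrow> flamecast" where
  "instance_of \<alpha> d =
     (let m = length (source_coords d); n = length (sink_coords d) in
      \<lparr>sources = {..<m}, sinks = {m..<m + n},
       position = (\<lambda>v. polar_point (reference d) ((source_coords d @ sink_coords d) ! v)),
       capacities = capacity_list d, exponent = \<alpha>\<rparr>)"

text \<open>A cost bound is a rational combination of \<open>\<alpha>\<close>-th powers of natural numbers, which is the form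
  in which costs arise; the rational bound \<open>q\<close> is \<open>[(q, 1)]\<close>. The exponent is an arbitrary, possibly
  uncomputable, fixed real, so in general no Turing machine produces good rational approximations
  of \<open>n powr \<alpha>\<close> for all \<open>n\<close>.\<close>

type_synonym bound = "(rat \<times> nat) list"

definition bound_value :: "real \<Rightarrow> bound \<Rightarrow> real" where
  "bound_value \<alpha> B = (\<Sum>(q, n)\<leftarrow>B. real_of_rat q * real n powr \<alpha>)"

definition FLaMECaST :: "real \<Rightarrow> (description \<times> bound) set" where
  "FLaMECaST \<alpha> = {(d, B). wf_flamecast (instance_of \<alpha> d) \<and>
     (\<exists>V E p. valid_layout (instance_of \<alpha> d) V E p \<and> cost (instance_of \<alpha> d) E p \<le> bound_value \<alpha> B)}"


section \<open>Binary encoding\<close>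

fun bits :: "nat \<Rightarrow> bool list" where
  "bits n = (if n = 0 then [] else odd n # bits (n div 2))"

declare bits.simps [simp del]

text \<open>Each symbol is preceded by a continuation bit.\<close>

definition delimit :: "bool list \<Rightarrow> bool list" where
  "delimit w = concat (map (\<lambda>b. [True, b]) w) @ [False]"

definition encode_nat :: "nat \<Rightarrow> bool list" where
  "encode_nat n = delimit (bits n)"

definition encode_int :: "int \<Rightarrow> bool list" where
  "encode_int k = (k < 0) # encode_nat (nat \<bar>k\<bar>)"

definition encode_prod :: "('a \<Rightarrow> bool list) \<Rightarrow> ('b \<Rightarrow> bool list) \<Rightarrow> 'a \<times> 'b \<Rightarrow> bool list" where
  "encode_prod f g x = f (fst x) @ g (snd x)"

definition encode_rat :: "rat \<Rightarrow> bool list" where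
  "encode_rat q = encode_prod encode_int encode_int (quotient_of q)"

definition encode_list :: "('a \<Rightarrow> bool list) \<Rightarrow> 'a list \<Rightarrow> bool list" where
  "encode_list f xs = encode_nat (length xs) @ concat (map f xs)"

definition encode_description :: "description \<Rightarrow> bool list" where
  "encode_description d =
     encode_prod encode_rat encode_rat (reference d) @
     encode_list (encode_prod encode_rat encode_rat) (source_coords d) @
     encode_list (encode_prod encode_rat encode_rat) (sink_coords d) @
     encode_list encode_nat (capacity_list d)"

definition encode_query :: "description \<times> bound \<Rightarrow> bool list" where
  "encode_query = encode_prod encode_description (encode_list (encode_prod encode_rat encode_nat))"

definition prefix_code :: "('a \<Rightarrow> bool list) \<Rightarrow> bool" where
  "prefix_code f \<longleftrightarrow> (\<forall>x y u v. f x @ u = f y @ v \<longrightarrow> x = y \<and> u = v)"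

lemma bits_0: "bits 0 = []"
  by (simp add: bits.simps[of 0])

lemma bits_pos: "n \<noteq> 0 \<Longrightarrow> bits n = odd n # bits (n div 2)"
  by (simp add: bits.simps[of n])

lemma bits_inj: "bits m = bits n \<Longrightarrow> m = n"
proof (induction m arbitrary: n rule: less_induct)
  case (less m)
  show ?case
  proof (cases "m = 0 \<or> n = 0")
    case True
    then show ?thesis using less.prems
      by (cases "m = 0"; cases "n = 0") (simp_all add: bits_0 bits_pos)
  next
    case False
    then have *: "odd m # bits (m div 2) = odd n # bits (n div 2)"
      using less.prems bits_pos[of m] bits_pos[of n] by argo
    then have "odd m = odd n" "bits (m div 2) = bits (n div 2)"
      by blast+
    with False less.IH[of "m div 2" "n div 2"] have "m div 2 = n div 2" by simp
    with \<open>odd m = odd n\<close> show ?thesis by presburger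
  qed
qed

lemma prefix_code_delimit: "prefix_code delimit"
proof -
  have "delimit x @ u = delimit y @ v \<Longrightarrow> x = y \<and> u = v" for x y u v
  proof (induction x arbitrary: y)
    case Nil
    then show ?case by (cases y) (auto simp: delimit_def)
  next
    case (Cons a x)
    then show ?case by (cases y) (auto simp: delimit_def)
  qed
  then show ?thesis unfolding prefix_code_def by blast
qed

lemma prefix_code_nat: "prefix_code encode_nat"
  using prefix_code_delimit bits_inj unfolding prefix_code_def encode_nat_def by blast

lemma prefix_code_int: "prefix_code encode_int"
proof -
  have "x = y \<and> u = v" if "encode_int x @ u = encode_int y @ v" for x y u v
  proof -
    from that have "(x < 0) = (y < 0)" "encode_nat (nat \<bar>x\<bar>) @ u = encode_nat (nat \<bar>y\<bar>) @ v"
      by (auto simp: encode_int_def)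
    moreover from this have "nat \<bar>x\<bar> = nat \<bar>y\<bar>" "u = v"
      using prefix_code_nat unfolding prefix_code_def by blast+
    ultimately show ?thesis by auto
  qed
  then show ?thesis unfolding prefix_code_def by blast
qed

lemma prefix_code_prod:
  assumes "prefix_code f" "prefix_code g"
  shows "prefix_code (encode_prod f g)"
proof -
  have "x = y \<and> u = v" if "encode_prod f g x @ u = encode_prod f g y @ v" for x y u v
  proof -
    from that have "f (fst x) @ (g (snd x) @ u) = f (fst y) @ (g (snd y) @ v)"
      by (simp add: encode_prod_def)
    then have "fst x = fst y" "g (snd x) @ u = g (snd y) @ v"
      using assms(1) unfolding prefix_code_def by blast+
    moreover from this(2) have "snd x = snd y" "u = v"
      using assms(2) unfolding prefix_code_def by blast+
    ultimately show ?thesis by (simp add: prod_eq_iff)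
  qed
  then show ?thesis unfolding prefix_code_def by blast
qed

lemma prefix_code_rat: "prefix_code encode_rat"
  using prefix_code_prod[OF prefix_code_int prefix_code_int] quotient_of_inject
  unfolding prefix_code_def encode_rat_def by blast

lemma prefix_code_list:
  assumes "prefix_code f"
  shows "prefix_code (encode_list f)"
proof -
  have *: "length xs = length ys \<Longrightarrow> concat (map f xs) @ u = concat (map f ys) @ v \<Longrightarrow> xs = ys \<and> u = v"
    for xs ys u v
  proof (induction xs ys rule: list_induct2)
    case (Cons x xs y ys)
    then have "f x @ (concat (map f xs) @ u) = f y @ (concat (map f ys) @ v)" by simp
    then have "x = y" "concat (map f xs) @ u = concat (map f ys) @ v"
      using assms unfolding prefix_code_def by blast+
    with Cons.IH show ?case by simp
  qed simp
  have "xs = ys \<and> u = v" if "encode_list f xs @ u = encode_list f ys @ v" for xs ys u v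
  proof -
    from that have "length xs = length ys" "concat (map f xs) @ u = concat (map f ys) @ v"
      using prefix_code_nat unfolding prefix_code_def encode_list_def append_assoc by blast+
    with * show ?thesis by blast
  qed
  then show ?thesis unfolding prefix_code_def by blast
qed

lemma prefix_code_description: "prefix_code encode_description"
proof -
  let ?c = "encode_prod encode_rat encode_rat"
  let ?e = "encode_prod ?c (encode_prod (encode_list ?c)
              (encode_prod (encode_list ?c) (encode_list encode_nat)))"
  let ?t = "\<lambda>d. (reference d, source_coords d, sink_coords d, capacity_list d)"
  have "prefix_code ?e"
    by (intro prefix_code_prod prefix_code_list prefix_code_rat prefix_code_nat)
  moreover have "encode_description d = ?e (?t d)" for d
    by (simp add: encode_description_def encode_prod_def)
  moreover have "?t d = ?t d' \<Longrightarrow> d = d'" for d d' :: description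
    by simp
  ultimately show ?thesis unfolding prefix_code_def by metis
qed

lemma inj_encode_query: "inj encode_query"
proof -
  have "prefix_code encode_query" unfolding encode_query_def
    by (intro prefix_code_prod prefix_code_list prefix_code_description prefix_code_rat prefix_code_nat)
  then show ?thesis unfolding prefix_code_def inj_def by blast
qed


section \<open>Turing machines and NP-hardness\<close>

text \<open>A deterministic machine with one two-way infinite tape is a finite partial map from (state,
  scanned symbol) to (new state, written symbol, move); it halts when the map is undefined.
  State 0 is initial, symbol 0 is the blank, symbols 1 and 2 stand for the bits.\<close>

datatype move = Move_Left | Move_None | Move_Right

type_synonym machine = "nat \<times> nat \<rightharpoonup> nat \<times> nat \<times> move"

type_synonym config = "nat \<times> int \<times> (int \<Rightarrow> nat)"

fun shift :: "move \<Rightarrow> int" where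
  "shift Move_Left = -1"
| "shift Move_None = 0"
| "shift Move_Right = 1"

fun step :: "machine \<Rightarrow> config \<Rightarrow> config option" where
  "step M (q, h, t) =
     (case M (q, t h) of None \<Rightarrow> None | Some (q', a, m) \<Rightarrow> Some (q', h + shift m, t(h := a)))"

definition tape_of :: "bool list \<Rightarrow> int \<Rightarrow> nat" where
  "tape_of w i = (if 0 \<le> i \<and> nat i < length w then if w ! nat i then 2 else 1 else 0)"

inductive runs :: "machine \<Rightarrow> config \<Rightarrow> nat \<Rightarrow> config \<Rightarrow> bool" for M where
  halt: "step M c = None \<Longrightarrow> runs M c 0 c"
| step: "step M c = Some c' \<Longrightarrow> runs M c' n c'' \<Longrightarrow> runs M c (Suc n) c''"

definition computes_within :: "machine \<Rightarrow> nat \<Rightarrow> bool list \<Rightarrow> bool list \<Rightarrow> bool" where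
  "computes_within M b x y \<longleftrightarrow> (\<exists>n\<le>b. \<exists>q h. runs M (0, 0, tape_of x) n (q, h, tape_of y))"

definition polytime :: "(bool list \<Rightarrow> bool list) \<Rightarrow> bool" where
  "polytime f \<longleftrightarrow>
     (\<exists>M c k. finite (dom M) \<and> (\<forall>x. computes_within M (c * length x ^ k + c) x (f x)))"

definition in_P :: "bool list set \<Rightarrow> bool" where
  "in_P L \<longleftrightarrow> polytime (\<lambda>x. [x \<in> L])"

definition in_NP :: "bool list set \<Rightarrow> bool" where
  "in_NP L \<longleftrightarrow> (\<exists>R c k. in_P R \<and>
     (\<forall>x. x \<in> L \<longleftrightarrow> (\<exists>y. length y \<le> c * length x ^ k + c \<and> delimit x @ y \<in> R)))"

text \<open>NP-hardness of the decision problem with yes-set \<open>Y\<close>, restricted to the instances in \<open>D\<close>, under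
  polynomial-time many-one reductions. The reduction may only produce instances in \<open>D\<close>.\<close>

definition NP_hard_on :: "('a \<Rightarrow> bool list) \<Rightarrow> 'a set \<Rightarrow> 'a set \<Rightarrow> bool" where
  "NP_hard_on enc D Y \<longleftrightarrow>
     (\<forall>L. in_NP L \<longrightarrow>
        (\<exists>f. polytime (\<lambda>x. enc (f x)) \<and> (\<forall>x. f x \<in> D) \<and> (\<forall>x. x \<in> L \<longleftrightarrow> f x \<in> Y)))"

end

theory Submission imports Defs "HOL-Library.Nat_Bijection" begin

text \<open>Sinks of capacity \<open>c\<close> at the centre of the circle are bins, and a group of \<open>a\<close> sources is an item of
  size \<open>a\<close>. If a group is so large that \<open>a powr (1 - \<alpha>)\<close> exceeds the number of groups, then sharing a Steiner
  vertex with another group costs more than it saves, so a layout attains the lower bound, the sum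
  of all \<open>a powr \<alpha>\<close>, iff every group has a Steiner vertex of its own; such layouts are packings of the
  groups into the sinks. Hence bin packing with sizes in unary reduces to the problem.

  A computation of a verifier is a tiling of a helical torus whose tiles are the windows of three
  adjacent tape cells: the labels of one row determine those of the next by a local rule. Tilings
  reduce to bin packing by items whose sizes have a constant number of digits in a base that is
  polynomial in the number of cells.

  All numbers that occur are polynomially bounded, so the reduction runs on a machine with unary
  counters, which are marks on a single tape.\<close>

section \<open>Cyclic tilings as bin packing\<close>

text \<open>Sources are listed one by one, so bin packing has to be hard for sizes of polynomial
  value. The obstacle is that the \<open>G - 1\<close> tiles not chosen at a cell have bins too,
  which must be filled without imposing a constraint. For each cell and port there are
  \<open>\<Gamma>\<close> live items, one per colour, and \<open>G\<close> dead items, one per tile,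
  shared by \<open>G\<close> tile bins and \<open>\<Gamma>\<close> link bins. The chosen tile takes
  the live item of its colour; its dead item fills the gap in the link bin of that colour. A link
  bin joins the two ends of an adjacency and is live at both or dead at both, so the same colour is
  missing at both ends.

  For a given number of cells the items depend on the input only through the flag that singles out
  one \<open>Choice\<close> per cell. Hence the total size always equals the total capacity:
  packings have no slack, digit sums are exact, and the number of sources is known in closed form.

  The exponent may be uncomputable. It enters the reduction only through a natural number
  \<open>P\<close> with \<open>1 \<le> P * (1 - \<alpha>)\<close>, and the cost bound is written
  symbolically.\<close>

definition packable :: "nat \<Rightarrow> (nat \<Rightarrow> nat) \<Rightarrow> nat \<Rightarrow> nat \<Rightarrow> bool" where
  "packable k a m c \<longleftrightarrow>
     (\<exists>b. (\<forall>g<k. b g < m) \<and> (\<forall>j<m. (\<Sum>g | g < k \<and> b g = j. a g) \<le> c))"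

section \<open>Digit representations and exact sums\<close>

lemma digits_unique:
  fixes a b :: "nat \<Rightarrow> nat"
  assumes "(\<Sum>i<n. a i * B ^ i) = (\<Sum>i<n. b i * B ^ i)" "\<And>i. i < n \<Longrightarrow> a i < B" "\<And>i. i < n \<Longrightarrow> b i < B"
  shows "\<forall>i<n. a i = b i"
  using assms
proof (induction n arbitrary: a b)
  case (Suc n)
  have split: "(\<Sum>i<Suc n. f i * B ^ i) = f 0 + B * (\<Sum>i<n. f (Suc i) * B ^ i)" for f :: "nat \<Rightarrow> nat"
    by (simp add: sum.lessThan_Suc_shift sum_distrib_left mult.left_commute del: sum.lessThan_Suc)
  have eq: "a 0 + B * (\<Sum>i<n. a (Suc i) * B ^ i) = b 0 + B * (\<Sum>i<n. b (Suc i) * B ^ i)"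
    using Suc.prems(1) unfolding split .
  have "a 0 < B" "b 0 < B" using Suc.prems by auto
  then have 0: "a 0 = b 0"
    using arg_cong[OF eq, of "\<lambda>n. n mod B"] by simp
  then have "(\<Sum>i<n. a (Suc i) * B ^ i) = (\<Sum>i<n. b (Suc i) * B ^ i)"
    using eq \<open>a 0 < B\<close> by auto
  then have "\<forall>i<n. a (Suc i) = b (Suc i)" using Suc.prems by (intro Suc.IH) auto
  then show ?case using 0 by (auto simp: less_Suc_eq_0_disj)
qed simp

lemma sum_digits_less:
  fixes a :: "nat \<Rightarrow> nat"
  assumes "\<And>i. i < n \<Longrightarrow> a i < B"
  shows "(\<Sum>i<n. a i * B ^ i) < B ^ n"
  using assms
proof (induction n)
  case (Suc n)
  have "(\<Sum>i<Suc n. a i * B ^ i) < B ^ n + a n * B ^ n" using Suc by simp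
  also have "\<dots> = (a n + 1) * B ^ n" by simp
  also have "\<dots> \<le> B * B ^ n" using Suc.prems[of n] by (intro mult_right_mono) auto
  finally show ?case by simp
qed simp

lemma sum_exact:
  fixes f :: "'a \<Rightarrow> nat"
  assumes "finite J" "\<And>j. j \<in> J \<Longrightarrow> f j \<le> c" "(\<Sum>j\<in>J. f j) = card J * c" "j \<in> J"
  shows "f j = c"
proof (rule ccontr)
  assume "f j \<noteq> c"
  then have "f j < c" using assms(2,4) by (simp add: le_neq_implies_less)
  then have "(\<Sum>j\<in>J. f j) < (\<Sum>j\<in>J. c)" using assms by (intro sum_strict_mono_ex1) auto
  then show False using assms(3) by simp
qed

text \<open>The intended bins are \<open>Tile \<tau>\<close> with a \<open>Choice\<close> and an item for each of the four ports, and \<open>Link d c\<close>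
  with a \<open>Switch\<close> and an item for each of the two ports of direction \<open>d\<close>. The port items of a bin are
  all \<open>Live\<close> or all \<open>Dead\<close>; the tile selected at a cell is the one whose bin is live.\<close>

datatype kind = Tile nat | Choice nat | Live nat nat | Dead nat nat | Link nat nat | Switch nat nat

text \<open>There are \<open>N\<close> cells in rows of length \<open>w\<close> and \<open>G\<close>
  tiles; \<open>\<Gamma>\<close> is a common bound for classes and colours. Ports
  \<open>2 * d\<close> and \<open>2 * d + 1\<close> are the outgoing and the incoming side in
  direction \<open>d\<close>. A tile as in \<open>trivial_tile\<close> covers the whole torus on its
  own, which is how the total size of the items is found.\<close>

locale tile_system =
  fixes G \<Gamma> N w :: nat and cl :: "nat \<Rightarrow> nat" and col :: "nat \<Rightarrow> nat \<Rightarrow> nat"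
  assumes N_pos: "0 < N"
    and cl_less: "\<tau> < G \<Longrightarrow> cl \<tau> < \<Gamma>" and col_less: "\<tau> < G \<Longrightarrow> col p \<tau> < \<Gamma>"
    and trivial_tile: "\<exists>\<tau><G. col 0 \<tau> = col 1 \<tau> \<and> col 2 \<tau> = col 3 \<tau>"
begin

definition next_cell :: "nat \<Rightarrow> nat \<Rightarrow> nat" where
  "next_cell d v = (v + (if d = 0 then 1 else w)) mod N"

text \<open>\<open>\<rho> v\<close> stands for the class demanded at \<open>v\<close>. It is given
  as a tile so that \<open>Choice (\<rho> v)\<close> is an item, the one that makes its bin
  live.\<close>

definition solves :: "(nat \<Rightarrow> nat) \<Rightarrow> (nat \<Rightarrow> nat) \<Rightarrow> bool" where
  "solves \<rho> z \<longleftrightarrow> (\<forall>v<N. z v < G \<and> cl (z v) = cl (\<rho> v) \<and>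
     (\<forall>d<2. col (2 * d) (z v) = col (2 * d + 1) (z (next_cell d v))))"

text \<open>Sizes have 16 digits in a base that is too large for carries among the at most six items of a
  bin: the indices of cell and class or colour (digits 0 to 4), which the head of a bin complements
  to \<open>Mx\<close>, flags that force all ports of a bin to be live or all to be dead (5 to 8), roles of which a
  bin contains each exactly once (9 to 14), and the number of filled roles (15).\<close>

definition "Mx = N * \<Gamma> + 1"
text \<open>Indices start at 1 and stay below \<open>Mx\<close>, so an item that has no part in a
  digit, with value 0, cannot pass for one with an index.\<close>

definition "idx v c = v * \<Gamma> + c + 1"
definition "base = 6 * Mx + 7"

primrec i_choice :: "nat \<Rightarrow> kind \<Rightarrow> nat" where
  "i_choice v (Tile \<tau>) = Mx - idx v (cl \<tau>)"
| "i_choice v (Choice \<tau>) = idx v (cl \<tau>)"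
| "i_choice v (Live p c) = 0"
| "i_choice v (Dead p \<tau>) = 0"
| "i_choice v (Link d c) = Mx"
| "i_choice v (Switch d c) = 0"

primrec i_port :: "nat \<Rightarrow> nat \<Rightarrow> kind \<Rightarrow> nat" where
  "i_port p v (Tile \<tau>) = Mx - idx v (col p \<tau>)"
| "i_port p v (Choice \<tau>) = 0"
| "i_port p v (Live q c) = (if q = p then idx v c else 0)"
| "i_port p v (Dead q \<tau>) = (if q = p then idx v (col p \<tau>) else 0)"
| "i_port p v (Link d c) =
     (if p div 2 \<noteq> d then Mx else if even p then Mx - idx v c else Mx - idx (next_cell d v) c)"
| "i_port p v (Switch d c) = 0"

text \<open>The flags of a port have to add up to 1 in each bin. In a tile bin,
  \<open>Choice (\<rho> v)\<close> gives 0 to all ports, which leaves the 1 to live items, and any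
  other \<open>Choice\<close> gives 1 and forces dead ones. In a link bin of direction
  \<open>d\<close>, \<open>Switch d 0\<close> forces dead items and the other switches leave room
  for live ones only; colour 0 is an arbitrary pick that provides one such item per cell and
  direction. A \<open>Link\<close> settles the ports of the other direction by itself.\<close>

primrec flag :: "(nat \<Rightarrow> nat) \<Rightarrow> nat \<Rightarrow> nat \<Rightarrow> kind \<Rightarrow> nat" where
  "flag \<rho> p v (Tile \<tau>) = 0"
| "flag \<rho> p v (Choice \<tau>) = (if \<tau> = \<rho> v then 0 else 1)"
| "flag \<rho> p v (Live q c) = (if q = p then 1 else 0)"
| "flag \<rho> p v (Dead q \<tau>) = 0"
| "flag \<rho> p v (Link d c) = (if p div 2 = d then 0 else 1)"
| "flag \<rho> p v (Switch d c) = (if p div 2 = d \<and> c = 0 then 1 else 0)"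

primrec r_head :: "kind \<Rightarrow> nat" where
  "r_head (Tile \<tau>) = 1"
| "r_head (Choice \<tau>) = 0"
| "r_head (Live q c) = 0"
| "r_head (Dead q \<tau>) = 0"
| "r_head (Link d c) = 1"
| "r_head (Switch d c) = 0"

primrec r_choice :: "kind \<Rightarrow> nat" where
  "r_choice (Tile \<tau>) = 0"
| "r_choice (Choice \<tau>) = 1"
| "r_choice (Live q c) = 0"
| "r_choice (Dead q \<tau>) = 0"
| "r_choice (Link d c) = 0"
| "r_choice (Switch d c) = 1"

text \<open>A \<open>Link\<close> occupies the two ports of the other direction, so that its bin
  holds four items; together with the head this makes three of the six \<open>slots\<close>.\<close>

primrec r_port :: "nat \<Rightarrow> kind \<Rightarrow> nat" where
  "r_port p (Tile \<tau>) = 0"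
| "r_port p (Choice \<tau>) = 0"
| "r_port p (Live q c) = (if q = p then 1 else 0)"
| "r_port p (Dead q \<tau>) = (if q = p then 1 else 0)"
| "r_port p (Link d c) = (if p div 2 = d then 0 else 1)"
| "r_port p (Switch d c) = 0"

primrec slots :: "kind \<Rightarrow> nat" where
  "slots (Tile \<tau>) = 1"
| "slots (Choice \<tau>) = 1"
| "slots (Live q c) = 1"
| "slots (Dead q \<tau>) = 1"
| "slots (Link d c) = 3"
| "slots (Switch d c) = 1"

definition digit :: "(nat \<Rightarrow> nat) \<Rightarrow> nat \<Rightarrow> nat \<times> kind \<Rightarrow> nat" where
  "digit \<rho> i = (\<lambda>(v, \<kappa>).
     if i = 0 then i_choice v \<kappa>
     else if i < 5 then i_port (i - 1) v \<kappa>
     else if i < 9 then flag \<rho> (i - 5) v \<kappa>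
     else if i = 9 then r_head \<kappa>
     else if i = 10 then r_choice \<kappa>
     else if i < 15 then r_port (i - 11) \<kappa>
     else slots \<kappa>)"

definition target :: "nat \<Rightarrow> nat" where
  "target i = (if i < 5 then Mx else if i < 15 then 1 else 6)"

definition item_size :: "(nat \<Rightarrow> nat) \<Rightarrow> nat \<times> kind \<Rightarrow> nat" where
  "item_size \<rho> x = (\<Sum>i<16. digit \<rho> i x * base ^ i)"

definition bin_size :: nat where
  "bin_size = (\<Sum>i<16. target i * base ^ i)"

definition kinds :: "kind list" where
  "kinds = map Tile [0..<G] @ map Choice [0..<G] @
     concat (map (\<lambda>p. map (Live p) [0..<\<Gamma>] @ map (Dead p) [0..<G]) [0..<4]) @
     concat (map (\<lambda>d. map (Link d) [0..<\<Gamma>] @ map (Switch d) [0..<\<Gamma>]) [0..<2])"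

definition items :: "(nat \<times> kind) set" where "items = {..<N} \<times> set kinds"

definition heads :: "(nat \<times> kind) set" where
  "heads = {..<N} \<times> (Tile ` {..<G} \<union> (\<lambda>(d, c). Link d c) ` ({..<2} \<times> {..<\<Gamma>}))"

lemma set_kinds:
  "set kinds = Tile ` {..<G} \<union> Choice ` {..<G} \<union> (\<lambda>(p, c). Live p c) ` ({..<4} \<times> {..<\<Gamma>}) \<union>
     (\<lambda>(p, \<tau>). Dead p \<tau>) ` ({..<4} \<times> {..<G}) \<union> (\<lambda>(d, c). Link d c) ` ({..<2} \<times> {..<\<Gamma>}) \<union>
     (\<lambda>(d, c). Switch d c) ` ({..<2} \<times> {..<\<Gamma>})"
  unfolding kinds_def by (auto simp: image_iff Bex_def)

lemma in_kinds [simp]: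
  "Tile \<tau> \<in> set kinds \<longleftrightarrow> \<tau> < G" "Choice \<tau> \<in> set kinds \<longleftrightarrow> \<tau> < G"
  "Live p c \<in> set kinds \<longleftrightarrow> p < 4 \<and> c < \<Gamma>" "Dead p \<tau> \<in> set kinds \<longleftrightarrow> p < 4 \<and> \<tau> < G"
  "Link d c \<in> set kinds \<longleftrightarrow> d < 2 \<and> c < \<Gamma>" "Switch d c \<in> set kinds \<longleftrightarrow> d < 2 \<and> c < \<Gamma>"
  by (auto simp: set_kinds)

lemma distinct_kinds: "distinct kinds"
proof -
  have "[0..<4] = [0, 1, 2, 3::nat]" "[0..<2] = [0, 1::nat]" by (simp_all add: upt_rec)
  then show ?thesis unfolding kinds_def by (auto simp: distinct_map inj_on_def)
qed

lemma finite_items: "finite items"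
  by (simp add: items_def)

lemma card_heads: "card heads = N * (G + 2 * \<Gamma>)"
proof -
  have "card (Tile ` {..<G} \<union> (\<lambda>(d, c). Link d c) ` ({..<2} \<times> {..<\<Gamma>})) = G + 2 * \<Gamma>"
    by (subst card_Un_disjoint) (auto simp: card_image inj_on_def)
  then show ?thesis by (simp add: heads_def card_cartesian_product)
qed

lemma idx_bounds: "v < N \<Longrightarrow> c < \<Gamma> \<Longrightarrow> 1 \<le> idx v c \<and> idx v c < Mx"
proof -
  assume "v < N" "c < \<Gamma>"
  then have "v * \<Gamma> + c < v * \<Gamma> + \<Gamma>" by simp
  also have "\<dots> = Suc v * \<Gamma>" by simp
  also have "\<dots> \<le> N * \<Gamma>" using \<open>v < N\<close> by (intro mult_right_mono) auto
  finally show ?thesis by (simp add: idx_def Mx_def)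
qed

lemma idx_inj:
  assumes "c < \<Gamma>" "c' < \<Gamma>" "idx v c = idx v' c'"
  shows "v = v' \<and> c = c'"
proof -
  have eq: "v * \<Gamma> + c = v' * \<Gamma> + c'" using assms(3) by (simp add: idx_def)
  have "v = v'" using arg_cong[OF eq, of "\<lambda>n. n div \<Gamma>"] assms by simp
  then show ?thesis using eq by simp
qed

lemma next_cell_less [simp]: "next_cell d v < N"
  using N_pos by (simp add: next_cell_def)

lemma next_cell_inj:
  assumes "v < N" "v' < N" "next_cell d v = next_cell d v'"
  shows "v = v'"
proof -
  define s where "s = (if d = 0 then 1 else w)"
  have "(int v + int s) mod int N = (int v' + int s) mod int N"
    using assms(3) unfolding next_cell_def s_def[symmetric] by (metis of_nat_add of_nat_mod)
  then have "int v mod int N = int v' mod int N"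
    by (metis add_diff_cancel_right' mod_diff_left_eq)
  then show ?thesis using assms by simp
qed

lemma slots_pos: "1 \<le> slots \<kappa>"
  by (cases \<kappa>) auto

lemma digit_le:
  assumes "(v, \<kappa>) \<in> items" "i < 15"
  shows "digit \<rho> i (v, \<kappa>) \<le> Mx"
proof -
  have M: "1 \<le> Mx" by (simp add: Mx_def)
  have v: "v < N" using assms by (simp add: items_def)
  have "i_choice v \<kappa> \<le> Mx" "i_port p v \<kappa> \<le> Mx" for p
    using assms(1) idx_bounds[OF v] cl_less col_less
    by (cases \<kappa>; force simp: items_def intro: less_imp_le)+
  moreover have "flag \<rho> p v \<kappa> \<le> 1" "r_head \<kappa> \<le> 1" "r_choice \<kappa> \<le> 1" "r_port p \<kappa> \<le> 1" for p
    by (cases \<kappa>; simp)+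
  ultimately show ?thesis using M assms(2) by (auto simp: digit_def intro: order_trans)
qed

lemma target_less: "target i < base"
  by (auto simp: target_def base_def Mx_def)

lemma item_sizes:
  assumes "finite A"
  shows "(\<Sum>x\<in>A. item_size \<rho> x) = (\<Sum>i<16. (\<Sum>x\<in>A. digit \<rho> i x) * base ^ i)"
  unfolding item_size_def by (subst sum.swap) (simp add: sum_distrib_right)

text \<open>The leading digit does the work: \<open>bin_size < 7 * base ^ 15\<close> limits the
  slots to 6, and each item fills at least one, so a bin has at most six items. Then every digit sum
  is below \<open>base\<close>, no carry occurs, and the digits of the sum are the sums of the
  digits.\<close>

lemma bin_digits:
  assumes "A \<subseteq> items" "(\<Sum>x\<in>A. item_size \<rho> x) = bin_size" "i < 16"
  shows "(\<Sum>x\<in>A. digit \<rho> i x) = target i"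
proof -
  have fin: "finite A" using assms(1) finite_items finite_subset by blast
  let ?s = "\<lambda>i. \<Sum>x\<in>A. digit \<rho> i x"
  have eq: "(\<Sum>i<16. ?s i * base ^ i) = (\<Sum>i<16. target i * base ^ i)"
    using assms(2) unfolding item_sizes[OF fin] bin_size_def .
  have sixteen: "{..<16} = insert 15 {..<15::nat}" by auto
  have "?s 15 * base ^ 15 \<le> (\<Sum>i<16. ?s i * base ^ i)"
    by (rule member_le_sum[of 15 "{..<16}" "\<lambda>i. ?s i * base ^ i"]) auto
  also have "\<dots> = target 15 * base ^ 15 + (\<Sum>i<15. target i * base ^ i)"
    unfolding eq unfolding sixteen by simp
  also have "\<dots> < target 15 * base ^ 15 + base ^ 15"
    using sum_digits_less[of 15 target base] target_less by simp
  also have "\<dots> = 7 * base ^ 15" by (simp add: target_def)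
  finally have top: "?s 15 \<le> 6" by auto
  have "card A \<le> ?s 15"
    using sum_mono[of A "\<lambda>_. 1" "digit \<rho> 15"] slots_pos by (auto simp: digit_def)
  with top have card: "card A \<le> 6" by linarith
  have "?s i < base" if "i < 16" for i
  proof (cases "i = 15")
    case True
    then show ?thesis using top by (simp add: base_def)
  next
    case False
    have "?s i \<le> (\<Sum>x\<in>A. Mx)"
      using assms(1) False that digit_le by (intro sum_mono) (auto simp: subset_iff)
    also have "\<dots> \<le> 6 * Mx" using card by simp
    finally show ?thesis by (simp add: base_def)
  qed
  then show ?thesis using digits_unique[OF eq] target_less assms(3) by blast
qed

subsection \<open>From a packing to a tiling\<close>

definition exact_bin :: "(nat \<Rightarrow> nat) \<Rightarrow> (nat \<times> kind) set \<Rightarrow> bool" where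
  "exact_bin \<rho> A \<longleftrightarrow> A \<subseteq> items \<and> (\<forall>i<16. (\<Sum>x\<in>A. digit \<rho> i x) = target i)"

lemma exact_bin_sums:
  assumes "exact_bin \<rho> A"
  shows "(\<Sum>(v, \<kappa>)\<in>A. i_choice v \<kappa>) = Mx"
    and "p < 4 \<Longrightarrow> (\<Sum>(v, \<kappa>)\<in>A. i_port p v \<kappa>) = Mx"
    and "p < 4 \<Longrightarrow> (\<Sum>(v, \<kappa>)\<in>A. flag \<rho> p v \<kappa>) = 1"
    and "(\<Sum>(v, \<kappa>)\<in>A. r_head \<kappa>) = 1" and "(\<Sum>(v, \<kappa>)\<in>A. r_choice \<kappa>) = 1"
    and "p < 4 \<Longrightarrow> (\<Sum>(v, \<kappa>)\<in>A. r_port p \<kappa>) = 1"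
proof -
  have *: "(\<Sum>x\<in>A. digit \<rho> i x) = target i" if "i < 16" for i
    using assms that by (simp add: exact_bin_def)
  show "(\<Sum>(v, \<kappa>)\<in>A. i_choice v \<kappa>) = Mx"
    using *[of 0] by (simp add: digit_def target_def)
  show "(\<Sum>(v, \<kappa>)\<in>A. r_head \<kappa>) = 1" "(\<Sum>(v, \<kappa>)\<in>A. r_choice \<kappa>) = 1"
    using *[of 9] *[of 10] by (simp_all add: digit_def target_def)
  show "p < 4 \<Longrightarrow> (\<Sum>(v, \<kappa>)\<in>A. i_port p v \<kappa>) = Mx"
    using *[of "p + 1"] by (simp add: digit_def target_def)
  show "p < 4 \<Longrightarrow> (\<Sum>(v, \<kappa>)\<in>A. flag \<rho> p v \<kappa>) = 1"
    using *[of "p + 5"] by (simp add: digit_def target_def)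
  show "p < 4 \<Longrightarrow> (\<Sum>(v, \<kappa>)\<in>A. r_port p \<kappa>) = 1"
    using *[of "p + 11"] by (simp add: digit_def target_def)
qed

lemma exact_bin_finite: "exact_bin \<rho> A \<Longrightarrow> finite A"
  unfolding exact_bin_def using finite_items finite_subset by blast

lemma sum_two:
  fixes f :: "'a \<Rightarrow> nat"
  assumes "finite A" "x \<in> A" "y \<in> A" "x \<noteq> y" "\<And>z. z \<in> A \<Longrightarrow> z \<noteq> x \<Longrightarrow> z \<noteq> y \<Longrightarrow> f z = 0"
  shows "sum f A = f x + f y"
proof -
  have "sum f A = sum f {x, y}" using assms by (intro sum.mono_neutral_right) auto
  then show ?thesis using assms(4) by simp
qed

lemma sum_oneE:
  fixes f :: "'a \<Rightarrow> nat"
  assumes "finite A" "sum f A = 1"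
  obtains x where "x \<in> A" "f x = 1" "\<forall>y\<in>A. x \<noteq> y \<longrightarrow> f y = 0"
  using assms sum_eq_1_iff[of A f] by blast

text \<open>Digit 0 pairs the head with a partner. A tile lacks the index of its cell and class,
  which only a \<open>Choice\<close> of the same cell and class supplies; a \<open>Link\<close>
  already contributes \<open>Mx\<close>, which leaves 0 and hence a \<open>Switch\<close>. The cell,
  direction and colour of the switch stay open; what matters later is that its flags agree at the
  two ports of a direction.\<close>

lemma exact_bin_choice:
  assumes "exact_bin \<rho> A"
  obtains v \<kappa> v' \<kappa>' where "(v, \<kappa>) \<in> A" "(v', \<kappa>') \<in> A" "r_head \<kappa> = 1" "r_choice \<kappa>' = 1"
    "\<forall>y\<in>A. r_head (snd y) = 1 \<longrightarrow> y = (v, \<kappa>)" "\<forall>y\<in>A. r_choice (snd y) = 1 \<longrightarrow> y = (v', \<kappa>')"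
    "(\<exists>\<tau> \<tau>'. \<kappa> = Tile \<tau> \<and> \<kappa>' = Choice \<tau>' \<and> v = v' \<and> cl \<tau> = cl \<tau>') \<or>
     (\<exists>d c d' c'. \<kappa> = Link d c \<and> \<kappa>' = Switch d' c')"
proof -
  note fin = exact_bin_finite[OF assms] and s = exact_bin_sums[OF assms]
  obtain x where x: "x \<in> A" "r_head (snd x) = 1" "\<forall>y\<in>A. x \<noteq> y \<longrightarrow> r_head (snd y) = 0"
    by (rule sum_oneE[OF fin s(4)[unfolded case_prod_unfold]])
  obtain y where y: "y \<in> A" "r_choice (snd y) = 1" "\<forall>z\<in>A. y \<noteq> z \<longrightarrow> r_choice (snd z) = 0"
    by (rule sum_oneE[OF fin s(5)[unfolded case_prod_unfold]])
  have ne: "x \<noteq> y" using x(2) y(2) by (cases "snd x") auto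
  have "(\<Sum>(v, \<kappa>)\<in>A. i_choice v \<kappa>) = (case x of (v, \<kappa>) \<Rightarrow> i_choice v \<kappa>) + (case y of (v, \<kappa>) \<Rightarrow> i_choice v \<kappa>)"
  proof (rule sum_two[OF fin x(1) y(1) ne])
    fix z assume z: "z \<in> A" "z \<noteq> x" "z \<noteq> y"
    then have "r_head (snd z) = 0" "r_choice (snd z) = 0" using x(3) y(3) by auto
    then show "(case z of (v, \<kappa>) \<Rightarrow> i_choice v \<kappa>) = 0" by (cases z; cases "snd z") auto
  qed
  then have sum: "i_choice (fst x) (snd x) + i_choice (fst y) (snd y) = Mx"
    using s(1) by (simp add: case_prod_unfold)
  have it: "x \<in> items" "y \<in> items" using assms x y by (auto simp: exact_bin_def)
  have main: "(\<exists>\<tau> \<tau>'. snd x = Tile \<tau> \<and> snd y = Choice \<tau>' \<and> fst x = fst y \<and> cl \<tau> = cl \<tau>') \<or>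
     (\<exists>d c d' c'. snd x = Link d c \<and> snd y = Switch d' c')"
  proof (cases "snd x")
    case (Tile \<tau>)
    then have \<tau>: "\<tau> < G" "fst x < N" using it by (auto simp: items_def)
    note b = idx_bounds[OF \<tau>(2) cl_less[OF \<tau>(1)]]
    then have "i_choice (fst y) (snd y) = idx (fst x) (cl \<tau>)" using sum unfolding Tile i_choice.simps by linarith
    moreover from this obtain \<tau>' where \<tau>': "snd y = Choice \<tau>'" using y(2) b by (cases "snd y") auto
    moreover have "\<tau>' < G" using it(2) \<tau>' by (auto simp: items_def)
    ultimately show ?thesis using Tile idx_inj[OF cl_less cl_less, of \<tau>' \<tau> "fst y" "fst x"] \<tau> by auto
  next
    case (Link d c)
    then have 0: "i_choice (fst y) (snd y) = 0" using sum by simp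
    then show ?thesis using Link y(2) by (cases "snd y") (auto simp: idx_def)
  qed (use x(2) in auto)
  have uniq: "\<forall>z\<in>A. r_head (snd z) = 1 \<longrightarrow> z = x" "\<forall>z\<in>A. r_choice (snd z) = 1 \<longrightarrow> z = y"
    using x(3) y(3) by fastforce+
  show ?thesis
    by (rule that[of "fst x" "snd x" "fst y" "snd y"])
       (simp_all only: prod.collapse x(1,2) y(1,2) main, (rule uniq)+)
qed

text \<open>In the digit of port \<open>p\<close> the index of the live item has to complete the
  entry of the head to \<open>Mx\<close>. A link of the other direction has \<open>Mx\<close> there
  already and no room for a positive index. The far end of a link, at its odd port, is the next
  cell, hence the case distinction on \<open>even p\<close>.\<close>

lemma exact_bin_port:
  assumes "exact_bin \<rho> A" "(v, \<kappa>) \<in> A" "r_head \<kappa> = 1" "(v', \<kappa>') \<in> A" "\<kappa>' = Live p c"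
  shows "(\<exists>\<tau>. \<kappa> = Tile \<tau> \<and> v = v' \<and> col p \<tau> = c) \<or>
    (\<kappa> = Link (p div 2) c \<and> v' = (if even p then v else next_cell (p div 2) v))"
proof -
  note fin = exact_bin_finite[OF assms(1)] and s = exact_bin_sums[OF assms(1)]
  have it: "(v, \<kappa>) \<in> items" "(v', \<kappa>') \<in> items" using assms by (auto simp: exact_bin_def)
  then have b: "v < N" "v' < N" "p < 4" "c < \<Gamma>" using assms(5) by (auto simp: items_def)
  obtain x where x: "x \<in> A" "r_port p (snd x) = 1" "\<forall>y\<in>A. x \<noteq> y \<longrightarrow> r_port p (snd y) = 0"
    by (rule sum_oneE[OF fin s(6)[OF b(3), unfolded case_prod_unfold]])
  obtain h where h: "h \<in> A" "r_head (snd h) = 1" "\<forall>y\<in>A. h \<noteq> y \<longrightarrow> r_head (snd y) = 0"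
    by (rule sum_oneE[OF fin s(4)[unfolded case_prod_unfold]])
  have xe: "x = (v', \<kappa>')" and he: "h = (v, \<kappa>)"
    using x(3) h(3) assms by force+
  have ne: "h \<noteq> x" using h(2) assms(5) by (auto simp: xe)
  have "(\<Sum>(v, \<kappa>)\<in>A. i_port p v \<kappa>) = (case h of (v, \<kappa>) \<Rightarrow> i_port p v \<kappa>) + (case x of (v, \<kappa>) \<Rightarrow> i_port p v \<kappa>)"
  proof (rule sum_two[OF fin h(1) x(1) ne])
    fix z assume z: "z \<in> A" "z \<noteq> h" "z \<noteq> x"
    then have "r_head (snd z) = 0" "r_port p (snd z) = 0" using x(3) h(3) by auto
    then show "(case z of (v, \<kappa>) \<Rightarrow> i_port p v \<kappa>) = 0" by (cases z; cases "snd z") auto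
  qed
  then have sum: "i_port p v \<kappa> + idx v' c = Mx"
    using s(2)[OF b(3)] assms(5) xe he by simp
  show ?thesis
  proof (cases \<kappa>)
    case (Tile \<tau>)
    then have \<tau>: "\<tau> < G" using it by (auto simp: items_def)
    have "idx v (col p \<tau>) = idx v' c" using sum idx_bounds[OF b(1) col_less[OF \<tau>], of p]
      unfolding Tile i_port.simps by linarith
    from idx_inj[OF col_less[OF \<tau>] b(4) this] show ?thesis using Tile by simp
  next
    case (Link d c')
    then have "c' < \<Gamma>" using it by (auto simp: items_def)
    have "idx v' c \<noteq> 0" by (simp add: idx_def)
    then have d: "p div 2 = d" using sum Link by (auto split: if_splits)
    let ?u = "if even p then v else next_cell d v"
    have "?u < N" using b by simp
    have "i_port p v \<kappa> = Mx - idx ?u c'" using Link d by simp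
    then have "idx ?u c' = idx v' c" using sum idx_bounds[OF \<open>?u < N\<close> \<open>c' < \<Gamma>\<close>] by linarith
    from idx_inj[OF \<open>c' < \<Gamma>\<close> b(4) this] show ?thesis using Link d by auto
  qed (use assms(3) in auto)
qed

text \<open>Some item of the bin has flag 1 at port \<open>p\<close>. It is not the head, since a
  tile or a link of this direction has flag 0, and not the choice item, by assumption; of the
  remaining kinds only \<open>Live p\<close> has a nonzero flag there.\<close>

lemma exact_bin_live:
  assumes "exact_bin \<rho> A" "p < 4" "(v, \<kappa>) \<in> A" "r_head \<kappa> = 1" "(\<exists>\<tau>. \<kappa> = Tile \<tau>) \<or> (\<exists>c. \<kappa> = Link (p div 2) c)"
    "(v', \<kappa>') \<in> A" "r_choice \<kappa>' = 1" "flag \<rho> p v' \<kappa>' = 0"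
  shows "\<exists>u c. (u, Live p c) \<in> A"
proof -
  note fin = exact_bin_finite[OF assms(1)] and s = exact_bin_sums[OF assms(1)]
  obtain x where x: "x \<in> A" "flag \<rho> p (fst x) (snd x) = 1" "\<forall>y\<in>A. x \<noteq> y \<longrightarrow> flag \<rho> p (fst y) (snd y) = 0"
    by (rule sum_oneE[OF fin s(3)[OF assms(2), unfolded case_prod_unfold]])
  obtain h where h: "h \<in> A" "r_head (snd h) = 1" "\<forall>y\<in>A. h \<noteq> y \<longrightarrow> r_head (snd y) = 0"
    by (rule sum_oneE[OF fin s(4)[unfolded case_prod_unfold]])
  obtain y where y: "y \<in> A" "r_choice (snd y) = 1" "\<forall>z\<in>A. y \<noteq> z \<longrightarrow> r_choice (snd z) = 0"
    by (rule sum_oneE[OF fin s(5)[unfolded case_prod_unfold]])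
  have he: "h = (v, \<kappa>)" and ye: "y = (v', \<kappa>')" using h(3) y(3) assms by force+
  have "x \<noteq> h" using assms(5) x(2) by (auto simp: he)
  moreover have "x \<noteq> y" using assms(8) x(2) by (auto simp: ye)
  ultimately have "r_head (snd x) = 0" "r_choice (snd x) = 0" using h(3) y(3) x(1) by auto
  then obtain c where "snd x = Live p c" using x(2) by (cases "snd x") (auto split: if_splits)
  then show ?thesis using x(1) by (metis prod.collapse)
qed

text \<open>A bin is a fibre of \<open>f\<close>. The tile chosen at \<open>v\<close> is the head of
  the bin of \<open>Choice (\<rho> v)\<close>, whose ports are all live. Colours agree along an
  adjacency because the live item at the far end is either in the bin chosen there or in a link bin
  that would also claim the live item of the near end.\<close>

lemma packing_solves:
  assumes bins: "\<And>x. x \<in> items \<Longrightarrow> exact_bin \<rho> {y \<in> items. f y = f x}" and \<rho>: "\<And>v. v < N \<Longrightarrow> \<rho> v < G"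
  shows "\<exists>z. solves \<rho> z"
proof -
  define bin where "bin x = {y \<in> items. f y = f x}" for x
  have bin: "exact_bin \<rho> (bin x)" "x \<in> bin x" if "x \<in> items" for x
    using bins that by (auto simp: bin_def)
  have bin_eq: "bin x = bin y" if "x \<in> items" "x \<in> bin y" for x y
    using that by (auto simp: bin_def)
  have chosen: "\<exists>\<tau>. \<tau> < G \<and> (v, Tile \<tau>) \<in> bin (v, Choice (\<rho> v)) \<and> cl \<tau> = cl (\<rho> v) \<and>
      (\<forall>p<4. (v, Live p (col p \<tau>)) \<in> bin (v, Choice (\<rho> v)))" if v: "v < N" for v
  proof -
    let ?x = "(v, Choice (\<rho> v))"
    have x: "?x \<in> items" using v \<rho>[OF v] by (simp add: items_def)
    note B = bin[OF x]
    obtain u \<kappa> u' \<kappa>' where k: "(u, \<kappa>) \<in> bin ?x" "(u', \<kappa>') \<in> bin ?x" "r_head \<kappa> = 1" "r_choice \<kappa>' = 1"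
      "\<forall>y\<in>bin ?x. r_head (snd y) = 1 \<longrightarrow> y = (u, \<kappa>)" "\<forall>y\<in>bin ?x. r_choice (snd y) = 1 \<longrightarrow> y = (u', \<kappa>')"
      "(\<exists>\<tau> \<tau>'. \<kappa> = Tile \<tau> \<and> \<kappa>' = Choice \<tau>' \<and> u = u' \<and> cl \<tau> = cl \<tau>') \<or>
       (\<exists>d c d' c'. \<kappa> = Link d c \<and> \<kappa>' = Switch d' c')"
      by (rule exact_bin_choice[OF B(1)])
    have "?x = (u', \<kappa>')" using k(6) B(2) by auto
    then obtain \<tau> where \<tau>: "\<kappa> = Tile \<tau>" "u = v" "cl \<tau> = cl (\<rho> v)" using k(7) by auto
    have "\<tau> < G" using B(1) k(1) \<tau> by (auto simp: exact_bin_def items_def)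
    moreover have "(v, Live p (col p \<tau>)) \<in> bin ?x" if p4: "p < 4" for p
    proof -
      obtain w c where wc: "(w, Live p c) \<in> bin ?x"
        using exact_bin_live[OF B(1) p4 k(1) k(3) _ B(2)] \<tau>(1) by auto
      then show ?thesis using exact_bin_port[OF B(1) k(1) k(3) wc refl] \<tau> by auto
    qed
    ultimately show ?thesis using k(1) \<tau> by auto
  qed
  then obtain z where z: "\<And>v. v < N \<Longrightarrow> z v < G" "\<And>v. v < N \<Longrightarrow> (v, Tile (z v)) \<in> bin (v, Choice (\<rho> v))"
      "\<And>v. v < N \<Longrightarrow> cl (z v) = cl (\<rho> v)" "\<And>v p. v < N \<Longrightarrow> p < 4 \<Longrightarrow> (v, Live p (col p (z v))) \<in> bin (v, Choice (\<rho> v))"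
    by metis
  have "col (2 * d) (z v) = col (2 * d + 1) (z (next_cell d v))" if v: "v < N" and d: "d < 2" for v d
  proof -
    let ?p = "2 * d" and ?q = "2 * d + 1"
    define c where "c = col ?p (z v)"
    define v1 where "v1 = next_cell d v"
    have pq: "?p < 4" "?q < 4" using d by auto
    have c: "c < \<Gamma>" using z(1)[OF v] col_less by (simp add: c_def)
    have v1: "v1 < N" by (simp add: v1_def)
    \<comment> \<open>The live item for the colour of \<open>z v\<close> at the incoming port of the
      next cell: the argument depends on which bin it is in.\<close>
    let ?y = "(v1, Live ?q c)"
    have y: "?y \<in> items" using pq c v1 by (simp add: items_def)
    note B = bin[OF y]
    obtain u \<kappa> u' \<kappa>' where k: "(u, \<kappa>) \<in> bin ?y" "(u', \<kappa>') \<in> bin ?y" "r_head \<kappa> = 1" "r_choice \<kappa>' = 1"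
      "\<forall>y\<in>bin ?y. r_head (snd y) = 1 \<longrightarrow> y = (u, \<kappa>)" "\<forall>y\<in>bin ?y. r_choice (snd y) = 1 \<longrightarrow> y = (u', \<kappa>')"
      "(\<exists>\<tau> \<tau>'. \<kappa> = Tile \<tau> \<and> \<kappa>' = Choice \<tau>' \<and> u = u' \<and> cl \<tau> = cl \<tau>') \<or>
       (\<exists>d c d' c'. \<kappa> = Link d c \<and> \<kappa>' = Switch d' c')"
      by (rule exact_bin_choice[OF B(1)])
    \<comment> \<open>The live item \<open>?y\<close> already uses up the flag of its port.\<close>
    have flag: "flag \<rho> ?q u' \<kappa>' = 0"
    proof -
      have "(\<Sum>x\<in>bin ?y. flag \<rho> ?q (fst x) (snd x)) = 1"
        using exact_bin_sums(3)[OF B(1) pq(2)] by (simp add: case_prod_unfold)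
      then obtain x where x: "\<forall>y\<in>bin ?y. x \<noteq> y \<longrightarrow> flag \<rho> ?q (fst y) (snd y) = 0"
        by (rule sum_oneE[OF exact_bin_finite[OF B(1)]]) blast
      then have "x = ?y" using B(2) by (force)
      moreover have "(u', \<kappa>') \<noteq> ?y" using k(4) by auto
      ultimately show ?thesis using x k(2) by fastforce
    qed
    from exact_bin_port[OF B(1) k(1) k(3) B(2) refl]
    consider (tile) \<tau> where "\<kappa> = Tile \<tau>" "u = v1" "col ?q \<tau> = c"
      | (link) "\<kappa> = Link d c" "v1 = next_cell d u" by auto
    then show ?thesis
    proof cases
      case tile
      then obtain \<tau>' where \<tau>': "\<kappa>' = Choice \<tau>'" "u' = v1" using k(7) by auto
      then have "\<tau>' = \<rho> v1" using flag by (auto split: if_splits)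
      then have in_bin: "(v1, Choice (\<rho> v1)) \<in> bin ?y" using k(2) \<tau>' by simp
      have "(v1, Choice (\<rho> v1)) \<in> items" using v1 \<rho> by (simp add: items_def)
      then have "bin (v1, Choice (\<rho> v1)) = bin ?y" using bin_eq in_bin by blast
      then have "(v1, Tile (z v1)) = (u, \<kappa>)" using k(5) z(2)[OF v1] by auto
      then show ?thesis using tile by (simp add: c_def v1_def)
    next
      case link
      have "u < N" using B(1) k(1) by (auto simp: exact_bin_def items_def)
      then have u: "u = v" using link(2) next_cell_inj[OF \<open>u < N\<close> v, of d] by (simp add: v1_def)
      obtain d' c' where s: "\<kappa>' = Switch d' c'" using k(7) link by auto
      then have "flag \<rho> ?p u' \<kappa>' = 0" using flag by (auto split: if_splits)
      then obtain w e where we: "(w, Live ?p e) \<in> bin ?y"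
        using exact_bin_live[OF B(1) pq(1) k(1) k(3) _ k(2) k(4)] link(1) by auto
      then have "w = v" "e = c" using exact_bin_port[OF B(1) k(1) k(3) we refl] link(1) u by auto
      then have "(v, Live ?p (col ?p (z v))) \<in> bin ?y" using we by (simp add: c_def)
      moreover have "(v, Live ?p (col ?p (z v))) \<in> bin (v, Choice (\<rho> v))" by (rule z(4)[OF v pq(1)])
      ultimately have "bin ?y = bin (v, Choice (\<rho> v))" by (auto simp: bin_def)
      \<comment> \<open>A bin has only one head, but \<open>\<kappa>\<close> is a link; the case is
        impossible.\<close>
      then have "(v, Tile (z v)) = (u, \<kappa>)" using k(5) z(2)[OF v] by auto
      then show ?thesis using link by simp
    qed
  qed
  then show ?thesis using z(1,3) unfolding solves_def by blast
qed


subsection \<open>From a tiling to a packing\<close>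

definition prev_cell :: "nat \<Rightarrow> nat \<Rightarrow> nat" where
  "prev_cell d = inv_into {..<N} (next_cell d)"

lemma prev_cell:
  assumes "v < N"
  shows "prev_cell d v < N" "next_cell d (prev_cell d v) = v" "prev_cell d (next_cell d v) = v"
proof -
  have inj: "inj_on (next_cell d) {..<N}" using next_cell_inj by (auto simp: inj_on_def)
  then have "next_cell d ` {..<N} = {..<N}" by (intro endo_inj_surj) auto
  then have "v \<in> next_cell d ` {..<N}" using assms by simp
  from inv_into_into[OF this] f_inv_into_f[OF this]
  show "prev_cell d v < N" "next_cell d (prev_cell d v) = v" by (auto simp: prev_cell_def)
  show "prev_cell d (next_cell d v) = v"
    unfolding prev_cell_def using inv_into_f_f[OF inj] assms by simp
qed

text \<open>By default each \<open>Choice\<close> and \<open>Dead\<close> item goes with its own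
  tile, each \<open>Live\<close> and \<open>Switch\<close> item with the link of its colour. The
  solution calls for three exchanges: \<open>Choice (\<rho> v)\<close> with
  \<open>Choice (z v)\<close>, which have the same class; the live items of the chosen tile with its
  dead ones, port by port; and \<open>Switch d 0\<close> with the switch of the chosen colour.
  Incoming ports belong to the link of the preceding cell.\<close>

primrec bin_of :: "(nat \<Rightarrow> nat) \<Rightarrow> (nat \<Rightarrow> nat) \<Rightarrow> nat \<Rightarrow> kind \<Rightarrow> nat \<times> kind" where
  "bin_of \<rho> z v (Tile \<tau>) = (v, Tile \<tau>)"
| "bin_of \<rho> z v (Choice \<tau>) = (v, Tile (if \<tau> = \<rho> v then z v else if \<tau> = z v then \<rho> v else \<tau>))"
| "bin_of \<rho> z v (Live p c) = (if c = col p (z v) then (v, Tile (z v))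
     else (if even p then v else prev_cell (p div 2) v, Link (p div 2) c))"
| "bin_of \<rho> z v (Dead p \<tau>) =
     (if \<tau> = z v then (if even p then v else prev_cell (p div 2) v, Link (p div 2) (col p \<tau>))
      else (v, Tile \<tau>))"
| "bin_of \<rho> z v (Link d c) = (v, Link d c)"
| "bin_of \<rho> z v (Switch d c) =
     (v, Link d (if c = 0 then col (2 * d) (z v) else if c = col (2 * d) (z v) then 0 else c))"

text \<open>The fibre of \<open>bin_of\<close> over a head, as an explicit list on which digit sums
  can be evaluated.\<close>

definition tile_bin :: "(nat \<Rightarrow> nat) \<Rightarrow> (nat \<Rightarrow> nat) \<Rightarrow> nat \<Rightarrow> nat \<Rightarrow> (nat \<times> kind) list" where
  "tile_bin \<rho> z v \<tau> =
     [(v, Tile \<tau>), (v, Choice (if \<tau> = z v then \<rho> v else if \<tau> = \<rho> v then z v else \<tau>))] @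
     map (\<lambda>p. (v, if \<tau> = z v then Live p (col p \<tau>) else Dead p \<tau>)) [0, 1, 2, 3]"

definition link_bin :: "(nat \<Rightarrow> nat) \<Rightarrow> nat \<Rightarrow> nat \<Rightarrow> nat \<Rightarrow> (nat \<times> kind) list" where
  "link_bin z v d c = (let e = col (2 * d) (z v); v' = next_cell d v in
     [(v, Link d c), (v, Switch d (if c = e then 0 else if c = 0 then e else c)),
      (v, if c = e then Dead (2 * d) (z v) else Live (2 * d) c),
      (v', if c = e then Dead (2 * d + 1) (z v') else Live (2 * d + 1) c)])"

lemma tile_bin:
  assumes z: "solves \<rho> z" and \<rho>: "\<And>v. v < N \<Longrightarrow> \<rho> v < G" and v: "v < N" "\<tau> < G"
  shows "{(u, \<kappa>) \<in> items. bin_of \<rho> z u \<kappa> = (v, Tile \<tau>)} = set (tile_bin \<rho> z v \<tau>)"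
proof -
  have zG: "z v < G" using z v by (simp add: solves_def)
  have colz: "col p (z v) < \<Gamma>" for p using col_less[OF zG] .
  have four: "p \<in> {0, 1, 2, 3}" if "p < 4" for p :: nat using that by auto
  have "(u, \<kappa>) \<in> set (tile_bin \<rho> z v \<tau>)" if "(u, \<kappa>) \<in> items" "bin_of \<rho> z u \<kappa> = (v, Tile \<tau>)" for u \<kappa>
    using that four
    by (cases \<kappa>) (auto simp: tile_bin_def items_def split: if_splits)
  moreover have "(u, \<kappa>) \<in> items \<and> bin_of \<rho> z u \<kappa> = (v, Tile \<tau>)" if "(u, \<kappa>) \<in> set (tile_bin \<rho> z v \<tau>)" for u \<kappa>
    using that v zG colz \<rho>[OF v(1)]
    by (auto simp: tile_bin_def items_def split: if_splits)
  ultimately show ?thesis by auto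
qed

text \<open>Here the matching of colours is used: the tile at \<open>next_cell d v\<close> claims
  the same colour at its incoming port as the tile at \<open>v\<close> at its outgoing one, so both
  ports of a link bin are dead for the same colour \<open>c\<close>.\<close>

lemma link_bin:
  assumes z: "solves \<rho> z" and v: "v < N" "d < 2" "c < \<Gamma>"
  shows "{(u, \<kappa>) \<in> items. bin_of \<rho> z u \<kappa> = (v, Link d c)} = set (link_bin z v d c)"
proof -
  let ?e = "col (2 * d) (z v)" and ?v = "next_cell d v"
  have zG: "z v < G" "z ?v < G" using z v by (simp_all add: solves_def)
  have e: "col (Suc (2 * d)) (z ?v) = ?e" using z v by (simp add: solves_def)
  have colz: "?e < \<Gamma>" using col_less[OF zG(1)] .
  have dp: "2 * d < 4" "Suc (2 * d) < 4" using v by auto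
  have par: "p = 2 * (p div 2) \<and> even p \<or> p = Suc (2 * (p div 2)) \<and> odd p" for p :: nat by presburger
  have "(u, \<kappa>) \<in> set (link_bin z v d c)" if "(u, \<kappa>) \<in> items" "bin_of \<rho> z u \<kappa> = (v, Link d c)" for u \<kappa>
  proof (cases \<kappa>)
    case (Live p c')
    have "c' = c" "c \<noteq> col p (z u)" and "p div 2 = d" "(if even p then u else prev_cell d u) = v"
      using that(2) unfolding Live by (auto split: if_splits)
    moreover have "u < N" using that(1) by (simp add: items_def)
    ultimately have "u = v \<and> p = 2 * d \<or> u = ?v \<and> p = Suc (2 * d)"
      using par[of p] prev_cell(2)[of u d] by (cases "even p") auto
    then show ?thesis using \<open>c' = c\<close> \<open>c \<noteq> col p (z u)\<close> e unfolding Live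
      by (elim disjE) (simp_all add: link_bin_def Let_def)
  next
    case (Dead p \<tau>)
    have "\<tau> = z u" "c = col p (z u)" and "p div 2 = d" "(if even p then u else prev_cell d u) = v"
      using that(2) unfolding Dead by (auto split: if_splits)
    moreover have "u < N" using that(1) by (simp add: items_def)
    ultimately have "u = v \<and> p = 2 * d \<or> u = ?v \<and> p = Suc (2 * d)"
      using par[of p] prev_cell(2)[of u d] by (cases "even p") auto
    then show ?thesis using \<open>\<tau> = z u\<close> \<open>c = col p (z u)\<close> e unfolding Dead
      by (elim disjE) (simp_all add: link_bin_def Let_def)
  qed (use that in \<open>auto simp: link_bin_def Let_def split: if_splits\<close>)
  moreover have "(u, \<kappa>) \<in> items \<and> bin_of \<rho> z u \<kappa> = (v, Link d c)" if "(u, \<kappa>) \<in> set (link_bin z v d c)" for u \<kappa>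
    using that v zG colz dp e prev_cell[OF v(1)]
    by (auto simp: link_bin_def Let_def items_def split: if_splits)
  ultimately show ?thesis by auto
qed

lemma all_digits:
  assumes "(\<Sum>(v, \<kappa>)\<leftarrow>xs. i_choice v \<kappa>) = Mx"
    and "\<And>p. p < 4 \<Longrightarrow> (\<Sum>(v, \<kappa>)\<leftarrow>xs. i_port p v \<kappa>) = Mx"
    and "\<And>p. p < 4 \<Longrightarrow> (\<Sum>(v, \<kappa>)\<leftarrow>xs. flag \<rho> p v \<kappa>) = 1"
    and "(\<Sum>(v, \<kappa>)\<leftarrow>xs. r_head \<kappa>) = 1" and "(\<Sum>(v, \<kappa>)\<leftarrow>xs. r_choice \<kappa>) = 1"
    and "\<And>p. p < 4 \<Longrightarrow> (\<Sum>(v, \<kappa>)\<leftarrow>xs. r_port p \<kappa>) = 1"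
    and "(\<Sum>(v, \<kappa>)\<leftarrow>xs. slots \<kappa>) = 6" and "distinct xs"
  shows "(\<Sum>x\<in>set xs. item_size \<rho> x) = bin_size"
proof -
  have "(\<Sum>x\<in>set xs. digit \<rho> i x) = target i" if "i < 16" for i
  proof -
    have "(\<Sum>x\<in>set xs. digit \<rho> i x) = sum_list (map (digit \<rho> i) xs)"
      using assms(8) by (simp add: sum_list_distinct_conv_sum_set)
    also have "\<dots> = target i"
    proof -
      have "i = 0 \<or> 1 \<le> i \<and> i < 5 \<or> 5 \<le> i \<and> i < 9 \<or> i = 9 \<or> i = 10 \<or> 11 \<le> i \<and> i < 15 \<or> i = 15"
        using that by arith
      then consider "i = 0" | "1 \<le> i" "i < 5" | "5 \<le> i" "i < 9" | "i = 9" | "i = 10" | "11 \<le> i" "i < 15" | "i = 15"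
        by blast
      then show ?thesis
      proof cases
        case 2
        then show ?thesis using assms(2)[of "i - 1"] by (simp add: digit_def target_def)
      next
        case 3
        then show ?thesis using assms(3)[of "i - 5"] by (simp add: digit_def target_def)
      next
        case 6
        then show ?thesis using assms(6)[of "i - 11"] by (simp add: digit_def target_def)
      qed (use assms in \<open>simp_all add: digit_def target_def\<close>)
    qed
    finally show ?thesis .
  qed
  then show ?thesis by (simp add: item_sizes bin_size_def)
qed

lemma tile_bin_size:
  assumes z: "solves \<rho> z" and v: "v < N" "\<tau> < G"
  shows "(\<Sum>x\<in>set (tile_bin \<rho> z v \<tau>). item_size \<rho> x) = bin_size"
proof -
  have zG: "z v < G" "cl (z v) = cl (\<rho> v)" using z v by (simp_all add: solves_def)
  have b: "idx v (cl \<tau>) \<le> Mx" "idx v (col p \<tau>) \<le> Mx" for p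
    using idx_bounds[OF v(1) cl_less[OF v(2)]] idx_bounds[OF v(1) col_less[OF v(2)]] by (auto intro: less_imp_le)
  have four: "p = 0 \<or> p = 1 \<or> p = 2 \<or> p = 3" if "p < 4" for p :: nat using that by auto
  show ?thesis
  proof (cases "\<tau> = z v")
    case True
    show ?thesis
      by (rule all_digits) (use True zG b in \<open>auto simp: tile_bin_def dest!: four\<close>)
  next
    case False
    show ?thesis
      by (rule all_digits) (use False zG b in \<open>auto simp: tile_bin_def dest!: four\<close>)
  qed
qed

lemma link_bin_size:
  assumes z: "solves \<rho> z" and v: "v < N" "d < 2" "c < \<Gamma>"
  shows "(\<Sum>x\<in>set (link_bin z v d c). item_size \<rho> x) = bin_size"
proof -
  let ?e = "col (2 * d) (z v)" and ?v = "next_cell d v"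
  have e: "col (Suc (2 * d)) (z ?v) = ?e" using z v by (simp add: solves_def)
  have b: "idx v c \<le> Mx" "idx ?v c \<le> Mx"
    using idx_bounds[OF v(1,3)] idx_bounds[OF next_cell_less v(3)] by (auto intro: less_imp_le)
  have four: "p = 0 \<or> p = 1 \<or> p = 2 \<or> p = 3" if "p < 4" for p :: nat using that by auto
  have d: "d = 0 \<or> d = 1" using v by auto
  show ?thesis
  proof (cases "c = ?e")
    case True
    show ?thesis
      by (rule all_digits) (use True d e b in \<open>auto simp: link_bin_def Let_def dest!: four\<close>)
  next
    case False
    show ?thesis
      by (rule all_digits) (use False d e b in \<open>auto simp: link_bin_def Let_def dest!: four\<close>)
  qed
qed

lemma solves_packing:
  assumes z: "solves \<rho> z" and \<rho>: "\<And>v. v < N \<Longrightarrow> \<rho> v < G"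
  shows "(\<lambda>(v, \<kappa>). bin_of \<rho> z v \<kappa>) ` items \<subseteq> heads"
    and "h \<in> heads \<Longrightarrow> (\<Sum>x | x \<in> items \<and> (case x of (v, \<kappa>) \<Rightarrow> bin_of \<rho> z v \<kappa>) = h. item_size \<rho> x) = bin_size"
proof -
  have zG: "z v < G" if "v < N" for v using z that by (simp add: solves_def)
  show "(\<lambda>(v, \<kappa>). bin_of \<rho> z v \<kappa>) ` items \<subseteq> heads"
  proof (rule image_subsetI)
    fix x assume "x \<in> items"
    then obtain v \<kappa> where x: "x = (v, \<kappa>)" and vk: "(v, \<kappa>) \<in> items" by (cases x) auto
    then have v: "v < N" by (simp add: items_def)
    have "0 < \<Gamma>" using cl_less[OF zG[OF v]] by simp
    then have "fst (bin_of \<rho> z v \<kappa>) < N \<and> (case snd (bin_of \<rho> z v \<kappa>) of Tile \<tau> \<Rightarrow> \<tau> < G | Link d c \<Rightarrow> d < 2 \<and> c < \<Gamma> | _ \<Rightarrow> False)"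
      using vk v zG[OF v] \<rho>[OF v] prev_cell[OF v] col_less
      by (cases \<kappa>) (auto simp: items_def)
    then show "(case x of (v, \<kappa>) \<Rightarrow> bin_of \<rho> z v \<kappa>) \<in> heads"
      unfolding x by (cases "bin_of \<rho> z v \<kappa>") (auto simp: heads_def split: kind.splits)
  qed
  assume h: "h \<in> heads"
  have eq: "{x. x \<in> items \<and> (case x of (v, \<kappa>) \<Rightarrow> bin_of \<rho> z v \<kappa>) = h} = {(u, \<kappa>) \<in> items. bin_of \<rho> z u \<kappa> = h}"
    by auto
  from h consider v \<tau> where "h = (v, Tile \<tau>)" "v < N" "\<tau> < G"
    | v d c where "h = (v, Link d c)" "v < N" "d < 2" "c < \<Gamma>"
    by (auto simp: heads_def)
  then show "(\<Sum>x | x \<in> items \<and> (case x of (v, \<kappa>) \<Rightarrow> bin_of \<rho> z v \<kappa>) = h. item_size \<rho> x) = bin_size"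
  proof cases
    case 1
    then show ?thesis unfolding eq using tile_bin[OF z \<rho> 1(2,3)] tile_bin_size[OF z 1(2,3)] by simp
  next
    case 2
    then show ?thesis unfolding eq using link_bin[OF z 2(2,3,4)] link_bin_size[OF z 2(2,3,4)] by simp
  qed
qed


section \<open>Total item size and numbering of the items\<close>

lemma sum_flags:
  assumes "\<And>v. v < N \<Longrightarrow> \<rho> v < G" "\<And>v. v < N \<Longrightarrow> \<rho>' v < G"
  shows "(\<Sum>(v, \<kappa>)\<in>items. flag \<rho> p v \<kappa>) = (\<Sum>(v, \<kappa>)\<in>items. flag \<rho>' p v \<kappa>)"
proof -
  let ?C = "Choice ` {..<G}"
  have sub: "?C \<subseteq> set kinds" by auto
  have choice: "(\<Sum>\<kappa>\<in>?C. flag \<rho> p v \<kappa>) = G - 1" if "\<rho> v < G" for \<rho> v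
  proof -
    have "(\<Sum>\<kappa>\<in>?C. flag \<rho> p v \<kappa>) = (\<Sum>\<tau><G. if \<tau> \<noteq> \<rho> v then 1 else 0)"
      by (simp add: sum.reindex inj_on_def) (rule sum.cong, auto)
    also have "\<dots> = card {\<tau> \<in> {..<G}. \<tau> \<noteq> \<rho> v}" by (simp add: sum.If_cases Int_def)
    also have "{\<tau> \<in> {..<G}. \<tau> \<noteq> \<rho> v} = {..<G} - {\<rho> v}" by auto
    finally show ?thesis using that by simp
  qed
  have rest: "(\<Sum>\<kappa>\<in>set kinds - ?C. flag \<rho> p v \<kappa>) = (\<Sum>\<kappa>\<in>set kinds - ?C. flag \<rho>' p v \<kappa>)" for v
  proof (rule sum.cong[OF refl])
    fix \<kappa> assume "\<kappa> \<in> set kinds - ?C"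
    then show "flag \<rho> p v \<kappa> = flag \<rho>' p v \<kappa>" by (cases \<kappa>) auto
  qed
  have "(\<Sum>\<kappa>\<in>set kinds. flag \<rho> p v \<kappa>) = (\<Sum>\<kappa>\<in>set kinds. flag \<rho>' p v \<kappa>)" if "v < N" for v
    using assms[OF that] choice rest
    by (simp add: sum.subset_diff[OF sub])
  then show ?thesis unfolding items_def by (simp flip: sum.cartesian_product)
qed

text \<open>The total does not depend on \<open>\<rho>\<close>: flags are the only digits that
  involve it, and each cell has exactly one \<open>Choice\<close> with flag 0 whatever tile
  \<open>\<rho>\<close> names. If \<open>\<rho>\<close> is constantly the trivial tile, the constant
  tiling is a solution and its packing fills all bins, so the total is known without adding up
  digits.\<close>

lemma sum_item_size:
  assumes \<rho>: "\<And>v. v < N \<Longrightarrow> \<rho> v < G"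
  shows "(\<Sum>x\<in>items. item_size \<rho> x) = card heads * bin_size"
proof -
  obtain \<tau> where \<tau>: "\<tau> < G" "col 0 \<tau> = col 1 \<tau>" "col 2 \<tau> = col 3 \<tau>" using trivial_tile by blast
  let ?\<rho> = "\<lambda>_::nat. \<tau>"
  have z: "solves ?\<rho> ?\<rho>"
    using \<tau> by (auto simp: solves_def less_Suc_eq numeral_2_eq_2 numeral_3_eq_3)
  have "(\<Sum>x\<in>items. digit \<rho> i x) = (\<Sum>x\<in>items. digit ?\<rho> i x)" for i
  proof (cases "5 \<le> i \<and> i < 9")
    case True
    then show ?thesis using sum_flags[of \<rho> ?\<rho> "i - 5"] \<rho> \<tau>(1) by (simp add: digit_def)
  next
    case False
    then show ?thesis by (intro sum.cong) (auto simp: digit_def)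
  qed
  then have "(\<Sum>x\<in>items. item_size \<rho> x) = (\<Sum>x\<in>items. item_size ?\<rho> x)"
    by (simp add: item_sizes finite_items)
  also have "\<dots> = (\<Sum>h\<in>heads. \<Sum>x | x \<in> items \<and> (case x of (v, \<kappa>) \<Rightarrow> bin_of ?\<rho> ?\<rho> v \<kappa>) = h. item_size ?\<rho> x)"
    by (rule sum.group[symmetric]) (use finite_items solves_packing(1)[OF z] \<tau>(1) in \<open>auto simp: heads_def\<close>)
  also have "\<dots> = card heads * bin_size"
    using solves_packing(2)[OF z] \<tau>(1) by simp
  finally show ?thesis .
qed

definition item :: "nat \<Rightarrow> nat \<times> kind" where
  "item g = (g div length kinds, kinds ! (g mod length kinds))"

lemma kinds_nonempty: "0 < length kinds"
  using trivial_tile by (auto simp: kinds_def)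

lemma bij_item: "bij_betw item {..<N * length kinds} items"
proof (rule bij_betw_byWitness[where f' = "\<lambda>(v, \<kappa>). v * length kinds + (THE i. i < length kinds \<and> kinds ! i = \<kappa>)"])
  have pos: "(THE i. i < length kinds \<and> kinds ! i = kinds ! j) = j" if "j < length kinds" for j
    using that distinct_kinds by (auto simp: nth_eq_iff_index_eq)
  show "\<forall>g\<in>{..<N * length kinds}. (case item g of (v, \<kappa>) \<Rightarrow> v * length kinds + (THE i. i < length kinds \<and> kinds ! i = \<kappa>)) = g"
    using kinds_nonempty by (simp add: item_def pos)
  show "\<forall>x\<in>items. item (case x of (v, \<kappa>) \<Rightarrow> v * length kinds + (THE i. i < length kinds \<and> kinds ! i = \<kappa>)) = x"
  proof
    fix x assume "x \<in> items"
    then obtain v j where x: "x = (v, kinds ! j)" "j < length kinds" "v < N" by (auto simp: items_def in_set_conv_nth)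
    then show "item (case x of (v, \<kappa>) \<Rightarrow> v * length kinds + (THE i. i < length kinds \<and> kinds ! i = \<kappa>)) = x"
      using kinds_nonempty by (simp add: item_def pos)
  qed
  show "item ` {..<N * length kinds} \<subseteq> items"
    using kinds_nonempty by (auto simp: item_def items_def less_mult_imp_div_less)
  show "(\<lambda>(v, \<kappa>). v * length kinds + (THE i. i < length kinds \<and> kinds ! i = \<kappa>)) ` items \<subseteq> {..<N * length kinds}"
  proof
    fix g assume "g \<in> (\<lambda>(v, \<kappa>). v * length kinds + (THE i. i < length kinds \<and> kinds ! i = \<kappa>)) ` items"
    then obtain v j where "g = v * length kinds + j" "j < length kinds" "v < N"
      by (auto simp: items_def in_set_conv_nth pos)
    moreover from \<open>v < N\<close> have "Suc v * length kinds \<le> N * length kinds"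
      by (intro mult_le_mono1) simp
    ultimately show "g \<in> {..<N * length kinds}" by simp
  qed
qed

lemma item_range: "g < N * length kinds \<Longrightarrow> item g \<in> items"
  using bij_item by (auto simp: bij_betw_def)

lemma sum_items:
  assumes "\<And>v. v < N \<Longrightarrow> \<rho> v < G"
  shows "(\<Sum>g<N * length kinds. item_size \<rho> (item g)) = N * (G + 2 * \<Gamma>) * bin_size"
  using sum_item_size[OF assms] sum.reindex_bij_betw[OF bij_item, of "item_size \<rho>"]
  by (simp add: card_heads)

lemma bins_reindex:
  "(\<Sum>g | g < N * length kinds \<and> P (item g). item_size \<rho> (item g)) = (\<Sum>x | x \<in> items \<and> P x. item_size \<rho> x)"
proof (rule sum.reindex_bij_betw[OF bij_betw_subset[OF bij_item], of _ _ "item_size \<rho>"])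
  show "item ` {g. g < N * length kinds \<and> P (item g)} = {x. x \<in> items \<and> P x}"
  proof
    show "item ` {g. g < N * length kinds \<and> P (item g)} \<subseteq> {x. x \<in> items \<and> P x}"
      using item_range by auto
    show "{x. x \<in> items \<and> P x} \<subseteq> item ` {g. g < N * length kinds \<and> P (item g)}"
    proof
      fix x assume x: "x \<in> {x. x \<in> items \<and> P x}"
      then have "x \<in> item ` {..<N * length kinds}" using bij_item by (simp add: bij_betw_def)
      then show "x \<in> item ` {g. g < N * length kinds \<and> P (item g)}" using x by auto
    qed
  qed
qed auto

text \<open>As the sizes add up to the total capacity, every bin of a packing is full and its digits
  are exact. The common factor \<open>s\<close> cancels; it is there to make the groups as large as
  the geometry demands.\<close>

theorem packable_iff_solvable:
  assumes \<rho>: "\<And>v. v < N \<Longrightarrow> \<rho> v < G" and "0 < s"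
  shows "packable (N * length kinds) (\<lambda>g. s * item_size \<rho> (item g)) (N * (G + 2 * \<Gamma>)) (s * bin_size) \<longleftrightarrow>
    (\<exists>z. solves \<rho> z)"
proof
  let ?k = "N * length kinds" and ?m = "N * (G + 2 * \<Gamma>)"
  assume "packable ?k (\<lambda>g. s * item_size \<rho> (item g)) ?m (s * bin_size)"
  then obtain b where b: "\<And>g. g < ?k \<Longrightarrow> b g < ?m"
    "\<And>j. j < ?m \<Longrightarrow> (\<Sum>g | g < ?k \<and> b g = j. s * item_size \<rho> (item g)) \<le> s * bin_size"
    unfolding packable_def by blast
  have le: "(\<Sum>g | g < ?k \<and> b g = j. item_size \<rho> (item g)) \<le> bin_size" if "j < ?m" for j
    using b(2)[OF that] \<open>0 < s\<close> by (simp flip: sum_distrib_left)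
  have "(\<Sum>j<?m. \<Sum>g | g < ?k \<and> b g = j. item_size \<rho> (item g)) = (\<Sum>g<?k. item_size \<rho> (item g))"
    using sum.group[of "{..<?k}" "{..<?m}" b "\<lambda>g. item_size \<rho> (item g)"] b(1)
    by (simp add: image_subset_iff)
  then have full: "(\<Sum>g | g < ?k \<and> b g = j. item_size \<rho> (item g)) = bin_size" if "j < ?m" for j
    using sum_exact[of "{..<?m}" "\<lambda>j. \<Sum>g | g < ?k \<and> b g = j. item_size \<rho> (item g)" bin_size j]
      sum_items[OF \<rho>] le that by simp
  define f where "f = b \<circ> inv_into {..<?k} item"
  have f: "f (item g) = b g" if "g < ?k" for g
    using that bij_item by (simp add: f_def bij_betw_def inv_into_f_f)
  show "\<exists>z. solves \<rho> z"
  proof (rule packing_solves[OF _ \<rho>])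
    fix x assume "x \<in> items"
    then obtain g where g: "x = item g" "g < ?k" using bij_item by (auto simp: bij_betw_def)
    have "(\<Sum>y | y \<in> items \<and> f y = f x. item_size \<rho> y) = (\<Sum>g' | g' < ?k \<and> f (item g') = f x. item_size \<rho> (item g'))"
      by (rule bins_reindex[symmetric])
    also have "{g'. g' < ?k \<and> f (item g') = f x} = {g'. g' < ?k \<and> b g' = b g}" using f g by auto
    finally have "(\<Sum>y | y \<in> items \<and> f y = f x. item_size \<rho> y) = bin_size" using full[OF b(1)[OF g(2)]] by simp
    then show "exact_bin \<rho> {y \<in> items. f y = f x}"
      unfolding exact_bin_def using bin_digits[of "{y \<in> items. f y = f x}" \<rho>] by auto
  qed
next
  let ?k = "N * length kinds" and ?m = "N * (G + 2 * \<Gamma>)"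
  assume "\<exists>z. solves \<rho> z"
  then obtain z where z: "solves \<rho> z" by blast
  note p = solves_packing[OF z \<rho>]
  have "finite heads" by (simp add: heads_def)
  then obtain e where e: "bij_betw e heads {..<?m}"
    using ex_bij_betw_finite_nat[of heads] by (auto simp: card_heads atLeast0LessThan)
  let ?f = "\<lambda>x. case x of (v, \<kappa>) \<Rightarrow> bin_of \<rho> z v \<kappa>"
  let ?b = "\<lambda>g. e (?f (item g))"
  have h: "?f (item g) \<in> heads" if "g < ?k" for g using p(1) item_range[OF that] by blast
  have "?b g < ?m" if "g < ?k" for g using e h[OF that] by (auto simp: bij_betw_def)
  moreover have "(\<Sum>g | g < ?k \<and> ?b g = j. s * item_size \<rho> (item g)) \<le> s * bin_size" if "j < ?m" for j
  proof -
    have "j \<in> e ` heads" using e that by (simp add: bij_betw_def)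
    then obtain x where x: "x \<in> heads" "e x = j" by blast
    have "{g. g < ?k \<and> ?b g = j} = {g. g < ?k \<and> ?f (item g) = x}"
      using x e h by (auto simp: bij_betw_def dest: inj_onD)
    then show ?thesis using p(2)[OF _ x(1)] bins_reindex[of \<rho> "\<lambda>y. ?f y = x"]
      by (simp flip: sum_distrib_left)
  qed
  ultimately show "packable ?k (\<lambda>g. s * item_size \<rho> (item g)) ?m (s * bin_size)"
    unfolding packable_def by (intro exI[of _ ?b]) auto
qed

end

section \<open>Bin packing as a circular instance\<close>

lemma abs_sin_mult_le: "\<bar>sin (real n * y)\<bar> \<le> real n * \<bar>sin y\<bar>"
proof (induction n)
  case (Suc n)
  have "sin (real (Suc n) * y) = sin (real n * y) * cos y + cos (real n * y) * sin y"
    by (simp add: distrib_right sin_add add.commute)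
  also have "\<bar>\<dots>\<bar> \<le> \<bar>sin (real n * y)\<bar> * \<bar>cos y\<bar> + \<bar>cos (real n * y)\<bar> * \<bar>sin y\<bar>"
    by (metis abs_mult abs_triangle_ineq)
  also have "\<dots> \<le> \<bar>sin (real n * y)\<bar> * 1 + 1 * \<bar>sin y\<bar>"
    by (intro add_mono mult_mono) auto
  also have "\<dots> \<le> real (Suc n) * \<bar>sin y\<bar>" using Suc by (simp add: algebra_simps)
  finally show ?case .
qed simp

text \<open>With \<open>y = pi / (2 * k)\<close> the bound on multiples gives
  \<open>1 = sin (k * y) \<le> k * sin y\<close>, and the sine increases from \<open>y\<close> to
  \<open>pi / 2\<close>. Angles beyond \<open>pi / 2\<close> are reflected.\<close>

lemma sin_fraction_ge:
  assumes "1 \<le> i" "i < k"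
  shows "1 / real k \<le> sin (pi * real i / real k)"
proof -
  have k: "real k \<ge> 2" using assms by linarith
  let ?y = "pi / (2 * real k)"
  have ge: "1 / real k \<le> sin t" if "?y \<le> t" "t \<le> pi / 2" for t
  proof -
    have y: "0 \<le> ?y" "?y \<le> pi / 2" using k by (auto simp: field_simps)
    have "1 = \<bar>sin (real k * ?y)\<bar>" using k by simp
    also have "\<dots> \<le> real k * \<bar>sin ?y\<bar>" by (rule abs_sin_mult_le)
    also have "\<bar>sin ?y\<bar> = sin ?y" using y pi_gt_zero by (intro abs_of_nonneg sin_ge_zero) linarith+
    also have "real k * sin ?y \<le> real k * sin t"
      using that y k pi_gt_zero by (intro mult_left_mono sin_monotone_2pi_le) linarith+
    finally show ?thesis using k by (simp add: field_simps)
  qed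
  let ?x = "pi * real i / real k"
  show ?thesis
  proof (cases "?x \<le> pi / 2")
    case True
    have "?y \<le> ?x" using assms k by (simp add: field_simps)
    then show ?thesis using True by (rule ge)
  next
    case False
    have "?y \<le> pi - ?x"
    proof -
      define e where "e = real k - real i"
      have "1 \<le> e" unfolding e_def using assms(2) by linarith
      then have "1 \<le> 2 * (real k - real i)" unfolding e_def[symmetric] by linarith
      then have "pi * 1 \<le> pi * (2 * (real k - real i))" by (intro mult_left_mono) auto
      then show ?thesis using k by (simp add: field_simps)
    qed
    then have "1 / real k \<le> sin (pi - ?x)" using False by (intro ge) auto
    then show ?thesis by simp
  qed
qed

lemma dist_unit_circle:
  "dist (cos \<theta>, sin \<theta>) (cos \<phi>, sin \<phi>) = 2 * \<bar>sin ((\<theta> - \<phi>) / 2)\<bar>"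
proof -
  have "(cos \<theta> - cos \<phi>)\<^sup>2 + (sin \<theta> - sin \<phi>)\<^sup>2 =
      ((cos \<theta>)\<^sup>2 + (sin \<theta>)\<^sup>2) + ((cos \<phi>)\<^sup>2 + (sin \<phi>)\<^sup>2) - 2 * (cos \<theta> * cos \<phi> + sin \<theta> * sin \<phi>)"
    by (simp add: power2_eq_square algebra_simps)
  also have "\<dots> = 2 - 2 * cos (\<theta> - \<phi>)" by (simp add: cos_diff)
  also have "\<theta> - \<phi> = 2 * ((\<theta> - \<phi>) / 2)" by simp
  also have "2 - 2 * cos (2 * ((\<theta> - \<phi>) / 2)) = (2 * \<bar>sin ((\<theta> - \<phi>) / 2)\<bar>)\<^sup>2"
    unfolding cos_double_sin by (simp add: power_mult_distrib)
  finally show ?thesis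
    unfolding dist_prod_def dist_real_def fst_conv snd_conv power2_abs by (simp only: real_sqrt_abs abs_mult abs_numeral abs_idempotent)
qed

text \<open>This is \<open>j / k\<close> of a turn plus a common rotation by
  \<open>1 / (k * k)\<close>. The rotation keeps the even spacing and makes the fraction reduced, so
  that its encoding can be written down without computing a gcd.\<close>

definition group_angle :: "nat \<Rightarrow> nat \<Rightarrow> rat" where
  "group_angle k j = of_nat (j * k + 1) / of_nat (k * k)"

definition group_point :: "nat \<Rightarrow> nat \<Rightarrow> real \<times> real" where
  "group_point k j = polar_point (0, 0) (1, group_angle k j)"

lemma group_point_eq:
  assumes "0 < k"
  shows "group_point k j = (let \<theta> = 2 * pi / real (k * k) + 2 * pi * real j / real k in (cos \<theta>, sin \<theta>))"
proof -
  have "2 * pi * real_of_rat (group_angle k j) = 2 * pi / real (k * k) + 2 * pi * real j / real k"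
    using assms by (simp add: group_angle_def of_rat_divide of_rat_add of_rat_mult field_simps)
  then show ?thesis by (simp add: group_point_def polar_point_def circle_point_def Let_def zero_prod_def[symmetric])
qed

lemma norm_group_point: "0 < k \<Longrightarrow> norm (group_point k j) = 1"
  by (simp add: group_point_eq Let_def norm_prod_def)

lemma dist_group_point:
  assumes "j < k" "j' < k" "j \<noteq> j'"
  shows "2 / real k \<le> dist (group_point k j) (group_point k j')"
  using assms
proof (induction j j' rule: linorder_wlog)
  case (le j j')
  have k: "0 < k" using le by simp
  have "dist (group_point k j) (group_point k j') = 2 * \<bar>sin (pi * real (j' - j) / real k)\<bar>"
  proof -
    have "(2 * pi / real (k * k) + 2 * pi * real j / real k - (2 * pi / real (k * k) + 2 * pi * real j' / real k)) / 2
        = - (pi * real (j' - j) / real k)"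
      using le k by (simp add: field_simps of_nat_diff)
    then show ?thesis unfolding group_point_eq[OF k] Let_def dist_unit_circle by simp
  qed
  moreover have "1 / real k \<le> sin (pi * real (j' - j) / real k)"
    using le by (intro sin_fraction_ge) auto
  ultimately show ?case by simp
next
  case (sym j j')
  then show ?case by (simp add: dist_commute)
qed

section \<open>Cost of a cluster of sources\<close>

lemma powr_le_self: "1 \<le> n \<Longrightarrow> \<alpha> \<le> 1 \<Longrightarrow> real n powr \<alpha> \<le> real n"
  using powr_mono[of \<alpha> 1 "real n"] by simp

text \<open>Since \<open>\<alpha> < 1\<close>, the cost per source falls as a group grows:
  \<open>n\<close> of the \<open>b\<close> sources of a group cost more on their own than their
  share \<open>n / b\<close> of \<open>b powr \<alpha>\<close>, unless \<open>n = b\<close>.\<close>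

lemma weight_le:
  assumes "1 \<le> n" "n \<le> b" "\<alpha> < 1"
  shows "real n * real b powr (\<alpha> - 1) \<le> real n powr \<alpha>"
    and "n < b \<Longrightarrow> real n * real b powr (\<alpha> - 1) < real n powr \<alpha>"
proof -
  have eq: "real n powr \<alpha> = real n * real n powr (\<alpha> - 1)"
    using assms by (simp add: powr_mult_base)
  show "real n * real b powr (\<alpha> - 1) \<le> real n powr \<alpha>"
    unfolding eq using assms by (intro mult_left_mono powr_mono2') auto
  show "n < b \<Longrightarrow> real n * real b powr (\<alpha> - 1) < real n powr \<alpha>"
    unfolding eq using assms by (intro mult_strict_left_mono powr_less_mono2_neg) auto
qed

text \<open>A source of a group of size \<open>b\<close> has weight \<open>b powr (\<alpha> - 1)\<close>, so that the group has weight
  \<open>b powr \<alpha>\<close>. The weight is less than the detour to a point that is close to another group.\<close>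

lemma cluster_cost:
  fixes P :: "nat \<Rightarrow> real \<times> real" and x :: "real \<times> real"
  assumes K: "finite K" "K \<noteq> {}" "\<And>s. s \<in> K \<Longrightarrow> g s < k"
    and P: "\<And>j. j < k \<Longrightarrow> norm (P j) = 1"
    and sep: "\<And>j j'. j < k \<Longrightarrow> j' < k \<Longrightarrow> j \<noteq> j' \<Longrightarrow> 2 * \<delta> \<le> dist (P j) (P j')"
    and weight: "\<And>j. j < k \<Longrightarrow> real (a j) powr (\<alpha> - 1) < \<delta>"
    and size: "\<And>j. j < k \<Longrightarrow> card {s \<in> K. g s = j} \<le> a j"
    and \<alpha>: "0 \<le> \<alpha>" "\<alpha> < 1"
  shows "(\<Sum>s\<in>K. real (a (g s)) powr (\<alpha> - 1)) \<le> (\<Sum>s\<in>K. dist (P (g s)) x) + norm x * real (card K) powr \<alpha>"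
    and "(\<Sum>s\<in>K. dist (P (g s)) x) + norm x * real (card K) powr \<alpha> \<le> (\<Sum>s\<in>K. real (a (g s)) powr (\<alpha> - 1)) \<Longrightarrow>
      \<exists>j<k. (\<forall>s\<in>K. g s = j) \<and> card K = a j"
proof -
  \<comment> \<open>Groups are at least \<open>2 * \<delta>\<close> apart, so at most one of them is
    closer than \<open>\<delta>\<close> to \<open>x\<close>. If there is none, any \<open>j0\<close>
    will do.\<close>
  have "\<exists>j0. \<forall>j<k. j \<noteq> j0 \<longrightarrow> \<delta> \<le> dist (P j) x"
  proof (cases "\<exists>j0<k. dist (P j0) x < \<delta>")
    case True
    then obtain j0 where j0: "j0 < k" "dist (P j0) x < \<delta>" by blast
    have "\<delta> \<le> dist (P j) x" if "j < k" "j \<noteq> j0" for j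
      using sep[OF that(1) j0(1) that(2)] j0(2) dist_triangle2[of "P j" "P j0" x] by linarith
    then show ?thesis by blast
  qed force
  then obtain j0 where j0: "\<And>j. j < k \<Longrightarrow> j \<noteq> j0 \<Longrightarrow> \<delta> \<le> dist (P j) x" by blast
  define K0 where "K0 = {s \<in> K. g s = j0}"
  define K1 where "K1 = K - K0"
  have fin: "finite K0" "finite K1" using K(1) by (auto simp: K0_def K1_def)
  have split: "(\<Sum>s\<in>K. f s) = (\<Sum>s\<in>K0. f s) + (\<Sum>s\<in>K1. f s)" for f :: "'a \<Rightarrow> real"
    using sum.subset_diff[of K0 K f] K(1) by (auto simp: K0_def K1_def)
  have K1_less: "real (a (g s)) powr (\<alpha> - 1) < dist (P (g s)) x" if "s \<in> K1" for s
  proof -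
    have "g s < k" "g s \<noteq> j0" using that K(3) by (auto simp: K0_def K1_def)
    then show ?thesis using weight j0 by fastforce
  qed
  then have K1_le: "(\<Sum>s\<in>K1. real (a (g s)) powr (\<alpha> - 1)) \<le> (\<Sum>s\<in>K1. dist (P (g s)) x)"
    by (intro sum_mono) (simp add: less_imp_le)
  let ?n = "card K0"
  have K0_sums: "(\<Sum>s\<in>K0. real (a (g s)) powr (\<alpha> - 1)) = real ?n * real (a j0) powr (\<alpha> - 1)"
    "(\<Sum>s\<in>K0. dist (P (g s)) x) = real ?n * dist (P j0) x"
    by (simp_all add: K0_def)
  have K0: "real ?n powr \<alpha> \<le> real ?n * dist (P j0) x + norm x * real (card K) powr \<alpha>" "j0 < k" if "1 \<le> ?n"
  proof -
    have "K0 \<noteq> {}" using that by auto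
    then obtain s where "s \<in> K0" by blast
    then show j: "j0 < k" using K(3) by (auto simp: K0_def)
    \<comment> \<open>The way from the circle through \<open>x\<close> to the centre has length at
      least 1. Charging \<open>?n powr \<alpha>\<close> throughout is a lower bound: the sources pay
      \<open>?n\<close> on the first part, and the second part carries the whole cluster.\<close>
    have "1 \<le> dist (P j0) x + norm x"
      using P[OF j] dist_triangle[of "P j0" 0 x] by (simp add: dist_commute)
    then have "real ?n powr \<alpha> * 1 \<le> real ?n powr \<alpha> * (dist (P j0) x + norm x)"
      by (intro mult_left_mono) auto
    also have "\<dots> = real ?n powr \<alpha> * dist (P j0) x + norm x * real ?n powr \<alpha>" by (simp add: algebra_simps)
    also have "\<dots> \<le> real ?n * dist (P j0) x + norm x * real (card K) powr \<alpha>"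
    proof (intro add_mono mult_right_mono mult_left_mono powr_mono2)
      show "real ?n powr \<alpha> \<le> real ?n" using powr_le_self[OF that] \<alpha> by simp
      show "real ?n \<le> real (card K)" using K(1) by (simp add: K0_def card_mono)
    qed (use \<alpha> in auto)
    finally show "real ?n powr \<alpha> \<le> real ?n * dist (P j0) x + norm x * real (card K) powr \<alpha>" by simp
  qed
  have n_le: "?n \<le> a j0" if "1 \<le> ?n" using size[OF K0(2)[OF that]] by (simp add: K0_def)
  have K0_le: "real ?n * real (a j0) powr (\<alpha> - 1) \<le> real ?n * dist (P j0) x + norm x * real (card K) powr \<alpha>"
  proof (cases "1 \<le> ?n")
    case True
    then show ?thesis using K0(1)[OF True] weight_le(1)[OF True n_le[OF True] \<alpha>(2)] by linarith
  next
    case False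
    then have "?n = 0" by linarith
    then show ?thesis by simp
  qed
  show "(\<Sum>s\<in>K. real (a (g s)) powr (\<alpha> - 1)) \<le> (\<Sum>s\<in>K. dist (P (g s)) x) + norm x * real (card K) powr \<alpha>"
    unfolding split K0_sums using K1_le K0_le by linarith
  assume le: "(\<Sum>s\<in>K. dist (P (g s)) x) + norm x * real (card K) powr \<alpha> \<le> (\<Sum>s\<in>K. real (a (g s)) powr (\<alpha> - 1))"
  \<comment> \<open>A source away from \<open>x\<close> pays strictly more than its weight, so a
    tight cluster has none.\<close>
  have "K1 = {}"
  proof (rule ccontr)
    assume "K1 \<noteq> {}"
    then have "(\<Sum>s\<in>K1. real (a (g s)) powr (\<alpha> - 1)) < (\<Sum>s\<in>K1. dist (P (g s)) x)"
      using fin K1_less by (intro sum_strict_mono) auto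
    then show False using le K0_le unfolding split K0_sums by linarith
  qed
  then have KK: "K = K0" by (auto simp: K0_def K1_def)
  then have n: "1 \<le> ?n" using K(1,2) by (simp add: card_gt_0_iff Suc_le_eq)
  \<comment> \<open>A proper part of a group also pays strictly more than its weights.\<close>
  have "?n = a j0"
  proof (rule ccontr)
    assume "?n \<noteq> a j0"
    then have "real ?n * real (a j0) powr (\<alpha> - 1) < real ?n powr \<alpha>"
      using n_le[OF n] weight_le(2)[OF n n_le[OF n] \<alpha>(2)] by simp
    then show False using K0(1)[OF n] le \<open>K1 = {}\<close> unfolding split K0_sums by simp
  qed
  moreover have "\<forall>s\<in>K. g s = j0" using KK by (auto simp: K0_def)
  ultimately show "\<exists>j<k. (\<forall>s\<in>K. g s = j) \<and> card K = a j" using K0(2)[OF n] KK by auto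
qed

subsection \<open>Forests of height two\<close>

lemma root_distance_unique:
  assumes "single_valued E" "(v, r) \<in> E ^^ n" "r \<in> roots V E" "(v, r') \<in> E ^^ n'" "r' \<in> roots V E"
  shows "n = n'"
  using assms
proof (induction n arbitrary: v n')
  case 0
  show ?case
  proof (cases n')
    case (Suc m)
    then obtain u where "(v, u) \<in> E" using "0.prems"(4) by (meson relpow_Suc_D2)
    then show ?thesis using "0.prems"(2,3) by (simp add: roots_def)
  qed simp
next
  case (Suc n)
  then obtain u where u: "(v, u) \<in> E" "(u, r) \<in> E ^^ n" by (meson relpow_Suc_D2)
  obtain m where m: "n' = Suc m" using u(1) Suc.prems by (cases n') (auto simp: roots_def)
  then obtain u' where u': "(v, u') \<in> E" "(u', r') \<in> E ^^ m" using Suc.prems by (meson relpow_Suc_D2)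
  then have "u' = u" using u(1) Suc.prems(1) single_valuedD by metis
  then show ?case using Suc.IH[OF Suc.prems(1) u(2) Suc.prems(3)] u' Suc.prems(5) m by auto
qed

lemma layer_eq:
  assumes "single_valued E" "(v, r) \<in> E ^^ n" "r \<in> roots V E"
  shows "layer V E v = n"
  unfolding layer_def using root_distance_unique[OF assms] assms(2,3) by (intro the_equality) blast+

lemma root_exists:
  assumes "rooted_forest V E" "v \<in> V"
  shows "\<exists>r\<in>roots V E. \<exists>n. (v, r) \<in> E ^^ n"
proof -
  have "finite E" using assms(1) by (auto simp: rooted_forest_def intro: finite_subset)
  then have "wf (E\<inverse>)" using assms(1) by (simp add: rooted_forest_def finite_acyclic_wf_converse)
  then show ?thesis using assms(2)
  proof (induction v rule: wf_induct_rule)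
    case (less v)
    show ?case
    proof (cases "v \<in> roots V E")
      case True
      then show ?thesis by (intro bexI[of _ v] exI[of _ 0]) auto
    next
      case False
      then obtain u where u: "(v, u) \<in> E" using less.prems by (auto simp: roots_def)
      then have "u \<in> V" using assms(1) by (auto simp: rooted_forest_def)
      then obtain r n where "r \<in> roots V E" "(u, r) \<in> E ^^ n" using less.IH u by blast
      then show ?thesis by (intro bexI[of _ r] exI[of _ "Suc n"] relpow_Suc_I2[OF u])
    qed
  qed
qed


text \<open>The vertices of layer 1: Steiner vertices and sources attached directly to a
  sink.\<close>

definition feeders :: "nat set \<Rightarrow> (nat \<times> nat) set \<Rightarrow> nat set" where
  "feeders V E = {u. \<exists>t\<in>roots V E. (u, t) \<in> E}"

definition cluster :: "flamecast \<Rightarrow> (nat \<times> nat) set \<Rightarrow> nat \<Rightarrow> nat set" where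
  "cluster I E u = {s \<in> sources I. (s, u) \<in> E\<^sup>*}"

text \<open>Height 2 leaves two shapes for the path of a source: an edge to a root, or two edges
  through one Steiner vertex. A source with a direct edge counts as its own feeder, so in both cases
  it lies in the cluster of exactly one feeder.\<close>

lemma height_two:
  assumes top: "topology I V E" and disj: "sources I \<inter> sinks I = {}" and height: "intermediate_layers I = 1"
    and U: "U = feeders V E" and K: "K = cluster I E"
  shows "\<And>s u. (s, u) \<in> E \<Longrightarrow> u \<notin> roots V E \<Longrightarrow> u \<in> U \<and> s \<in> sources I"
    and "\<And>s. s \<in> sources I \<Longrightarrow> K s = {s}"
    and "\<And>u. u \<in> U \<Longrightarrow> u \<notin> sources I \<Longrightarrow> K u = {s. (s, u) \<in> E}"
    and "\<And>s. s \<in> sources I \<Longrightarrow> \<exists>!u. u \<in> U \<and> s \<in> K u"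
    and "\<And>u. u \<in> U \<Longrightarrow> K u \<noteq> {}"
proof -
  have forest: "rooted_forest V E" and leaves: "leaves V E = sources I" and roots: "roots V E = V \<inter> sinks I"
    and layers: "\<And>v. v \<in> V \<Longrightarrow> layer V E v \<le> 2"
    using top height by (auto simp: topology_def)
  have sv: "single_valued E" and EV: "E \<subseteq> V \<times> V" using forest by (auto simp: rooted_forest_def)
  have leaf: "(u, s) \<notin> E" if "s \<in> sources I" for u s using that leaves by (auto simp: leaves_def)
  have srcV: "s \<in> V" if "s \<in> sources I" for s using that leaves by (auto simp: leaves_def)
  have short: "n \<le> 2" if "(v, r) \<in> E ^^ n" "r \<in> roots V E" "v \<in> V" for v r n
    using layers[OF that(3)] layer_eq[OF sv that(1,2)] by simp
  have in_U: "\<exists>t\<in>roots V E. (u, t) \<in> E ^^ 1" if "u \<in> U" for u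
    using that by (auto simp: U feeders_def)
  have inner: "u \<in> U \<and> s \<in> sources I" if "(s, u) \<in> E" "u \<notin> roots V E" for s u
  proof -
    have V: "s \<in> V" "u \<in> V" using that EV by auto
    obtain r n where r: "r \<in> roots V E" "(u, r) \<in> E ^^ n" using root_exists[OF forest V(2)] by blast
    have "n \<noteq> 0" using r that by (metis relpow_0_E)
    \<comment> \<open>A vertex with a child is at most in layer 1.\<close>
    moreover have "Suc n \<le> 2" using short[OF relpow_Suc_I2[OF that(1) r(2)] r(1) V(1)] .
    ultimately have n: "n = 1" by simp
    then have "u \<in> U" using r by (auto simp: U feeders_def)
    moreover have "s \<in> leaves V E"
    proof (rule ccontr)
      assume "s \<notin> leaves V E"
      then obtain c where c: "(c, s) \<in> E" using V by (auto simp: leaves_def)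
      then have "c \<in> V" using EV by auto
      then show False using short[OF relpow_Suc_I2[OF c relpow_Suc_I2[OF that(1) r(2)]] r(1)] n by simp
    qed
    ultimately show ?thesis using leaves by simp
  qed
  then show "\<And>s u. (s, u) \<in> E \<Longrightarrow> u \<notin> roots V E \<Longrightarrow> u \<in> U \<and> s \<in> sources I" .
  show Ks: "K s = {s}" if "s \<in> sources I" for s
    using that leaf by (auto simp: K cluster_def elim: rtranclE)
  have U_not_root: "u \<notin> roots V E" if "u \<in> U" for u
    using that by (auto simp: U feeders_def roots_def)
  show Ku: "K u = {s. (s, u) \<in> E}" if u: "u \<in> U" "u \<notin> sources I" for u
  proof (intro equalityI subsetI)
    fix s assume "s \<in> K u"
    then have s: "s \<in> sources I" "(s, u) \<in> E\<^sup>*" by (auto simp: K cluster_def)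
    then obtain y where y: "(s, y) \<in> E\<^sup>*" "(y, u) \<in> E" using u(2) by (auto elim: rtranclE)
    then have "y \<in> sources I" using inner U_not_root[OF u(1)] by blast
    then have "y = s" using Ks[of y] y(1) s(1) by (auto simp: K cluster_def)
    then show "s \<in> {s. (s, u) \<in> E}" using y by simp
  next
    fix s assume "s \<in> {s. (s, u) \<in> E}"
    then show "s \<in> K u" using inner U_not_root[OF u(1)] by (auto simp: K cluster_def)
  qed
  show "\<exists>!u. u \<in> U \<and> s \<in> K u" if s: "s \<in> sources I" for s
  proof -
    have "s \<notin> roots V E" using s disj roots by auto
    then obtain u where u: "(s, u) \<in> E" using srcV[OF s] by (auto simp: roots_def)
    show ?thesis
    proof (cases "u \<in> roots V E")
      case True
      have "x = s" if "x \<in> U" "s \<in> K x" for x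
      proof (rule ccontr)
        assume "x \<noteq> s"
        have "x \<notin> sources I" using Ks[of x] that(2) \<open>x \<noteq> s\<close> by auto
        then have "(s, x) \<in> E" using Ku that by auto
        then have "x = u" using u sv single_valuedD by metis
        then show False using True U_not_root that(1) by blast
      qed
      moreover have "s \<in> U" using True u by (auto simp: U feeders_def)
      ultimately show ?thesis using Ks[OF s] by (intro ex1I[of _ s]) auto
    next
      case False
      then have uU: "u \<in> U" using inner u by blast
      have "u \<notin> sources I" using leaf u by blast
      have "x = u" if "x \<in> U" "s \<in> K x" for x
      proof -
        have "x \<noteq> s"
        proof
          assume "x = s"
          then obtain t where "t \<in> roots V E" "(s, t) \<in> E" using \<open>x \<in> U\<close> by (auto simp: U feeders_def)
          then show False using u sv False single_valuedD by metis
        qed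
        then have "x \<notin> sources I" using Ks[of x] that(2) by auto
        then have "(s, x) \<in> E" using Ku that by auto
        then show ?thesis using u sv single_valuedD by metis
      qed
      then show ?thesis using uU u s by (intro ex1I[of _ u]) (auto simp: K cluster_def)
    qed
  qed
  show "K u \<noteq> {}" if u: "u \<in> U" for u
  proof (cases "u \<in> sources I")
    case True
    then show ?thesis using Ks by simp
  next
    case False
    have "u \<in> V" using u EV by (auto simp: U feeders_def)
    then obtain c where "(c, u) \<in> E" using False leaves by (auto simp: leaves_def)
    then show ?thesis using Ku[OF u False] by auto
  qed
qed

text \<open>Edges are split by whether their parent is a root. For a source that is its own feeder
  the inner sum is a distance from itself, 0, and the other term is its direct edge.\<close>

lemma cost_height_two:
  assumes top: "topology I V E" and disj: "sources I \<inter> sinks I = {}" and height: "intermediate_layers I = 1"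
    and sinks: "\<And>t. t \<in> sinks I \<Longrightarrow> p t = 0"
    and U: "U = feeders V E" and K: "K = cluster I E"
  shows "cost I E p = (\<Sum>u\<in>U. (\<Sum>s\<in>K u. dist (p s) (p u)) + norm (p u) * real (card (K u)) powr exponent I)"
proof -
  have forest: "rooted_forest V E" and leaves: "leaves V E = sources I" and roots: "roots V E = V \<inter> sinks I"
    using top by (auto simp: topology_def)
  have sv: "single_valued E" and EV: "E \<subseteq> V \<times> V" and finV: "finite V" using forest by (auto simp: rooted_forest_def)
  have finE: "finite E" using finite_subset[OF EV] finV by simp
  note h = height_two[OF top disj height U K]
  have UV: "U \<subseteq> V" using EV by (auto simp: U feeders_def)
  then have finU: "finite U" using finV finite_subset by blast
  have U_not_root: "u \<notin> roots V E" if "u \<in> U" for u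
    using that by (auto simp: U feeders_def roots_def)
  let ?f = "\<lambda>(u, v). dist (p u) (p v) * real (load I E u) powr exponent I"
  let ?E1 = "{e \<in> E. snd e \<in> roots V E}" and ?E2 = "{e \<in> E. snd e \<notin> roots V E}"
  have "cost I E p = sum ?f ?E1 + sum ?f ?E2"
    unfolding cost_def using finE by (subst sum.union_disjoint[symmetric]) (auto intro: arg_cong2[where f = sum])
  also have "sum ?f ?E1 = (\<Sum>u\<in>U. norm (p u) * real (card (K u)) powr exponent I)"
  proof -
    have inj: "inj_on fst ?E1" using sv by (auto simp: inj_on_def single_valued_def)
    have img: "fst ` ?E1 = U" by (force simp: U feeders_def)
    have "sum ?f ?E1 = (\<Sum>e\<in>?E1. norm (p (fst e)) * real (card (K (fst e))) powr exponent I)"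
      by (rule sum.cong) (auto simp: roots sinks load_def K cluster_def)
    also have "\<dots> = (\<Sum>u\<in>U. norm (p u) * real (card (K u)) powr exponent I)"
      using sum.reindex[OF inj, of "\<lambda>u. norm (p u) * real (card (K u)) powr exponent I"] img by simp
    finally show ?thesis .
  qed
  also have "sum ?f ?E2 = (\<Sum>u\<in>U. \<Sum>s\<in>K u. dist (p s) (p u))"
  proof -
    have "sum ?f ?E2 = (\<Sum>(s, u)\<in>?E2. dist (p s) (p u))"
    proof (rule sum.cong[OF refl], clarify)
      fix s u assume "(s, u) \<in> E" "snd (s, u) \<notin> roots V E"
      then have "K s = {s}" using h(1,2) by auto
      then have "load I E s = 1" by (simp add: load_def K cluster_def)
      then show "dist (p s) (p u) * real (load I E s) powr exponent I = dist (p s) (p u)" by simp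
    qed
    also have "\<dots> = (\<Sum>(u, s)\<in>(SIGMA u:U. {s. (s, u) \<in> E}). dist (p s) (p u))"
    proof -
      have "?E2 = prod.swap ` (SIGMA u:U. {s. (s, u) \<in> E})"
        using h(1) U_not_root by force
      then show ?thesis by (simp add: sum.reindex case_prod_unfold)
    qed
    also have "\<dots> = (\<Sum>u\<in>U. \<Sum>s | (s, u) \<in> E. dist (p s) (p u))"
      using finU finite_subset[OF _ finV, of "{s. (s, u) \<in> E}" for u] EV
      by (subst sum.Sigma) (auto)
    also have "\<dots> = (\<Sum>u\<in>U. \<Sum>s\<in>K u. dist (p s) (p u))"
    proof (rule sum.cong[OF refl])
      fix u assume u: "u \<in> U"
      show "(\<Sum>s | (s, u) \<in> E. dist (p s) (p u)) = (\<Sum>s\<in>K u. dist (p s) (p u))"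
      proof (cases "u \<in> sources I")
        case True
        then have "{s. (s, u) \<in> E} = {}" using leaves by (auto simp: leaves_def)
        then show ?thesis using h(2)[OF True] by simp
      next
        case False
        then show ?thesis using h(3)[OF u] by simp
      qed
    qed
    finally show ?thesis .
  qed
  finally show ?thesis by (simp add: sum.distrib)
qed


subsection \<open>The circular instance of a packing problem\<close>

definition group_list :: "nat \<Rightarrow> (nat \<Rightarrow> nat) \<Rightarrow> nat list" where
  "group_list k a = concat (map (\<lambda>j. replicate (a j) j) [0..<k])"

text \<open>The sinks have radius 0. Sinks and Steiner vertices get capacity \<open>c\<close>; layer
  2 holds only sources, whose load is 1.\<close>

definition packing_description :: "nat \<Rightarrow> (nat \<Rightarrow> nat) \<Rightarrow> nat \<Rightarrow> nat \<Rightarrow> description" where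
  "packing_description k a m c =
     \<lparr>reference = (0, 0), source_coords = map (\<lambda>j. (1, group_angle k j)) (group_list k a),
      sink_coords = replicate m (0, 0), capacity_list = [c, c, 1]\<rparr>"

definition packing_bound :: "nat \<Rightarrow> (nat \<Rightarrow> nat) \<Rightarrow> bound" where
  "packing_bound k a = map (\<lambda>j. (1, a j)) [0..<k]"

lemma length_group_list: "length (group_list k a) = (\<Sum>j<k. a j)"
  by (induction k) (simp_all add: group_list_def)

lemma filter_group_list: "length (filter ((=) j) (group_list k a)) = (if j < k then a j else 0)"
  by (induction k) (auto simp: group_list_def filter_replicate less_Suc_eq)

lemma group_list_less: "s < length (group_list k a) \<Longrightarrow> group_list k a ! s < k"
  using nth_mem[of s "group_list k a"] by (auto simp: group_list_def)

lemma card_group: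
  assumes "j < k"
  shows "card {s. s < length (group_list k a) \<and> group_list k a ! s = j} = a j"
proof -
  have "{s. s < length (group_list k a) \<and> group_list k a ! s = j} =
      {s. s < length (group_list k a) \<and> j = group_list k a ! s}" by auto
  then show ?thesis using filter_group_list[of j k a] assms by (simp add: length_filter_conv_card)
qed

lemma bound_value_packing: "bound_value \<alpha> (packing_bound k a) = (\<Sum>j<k. real (a j) powr \<alpha>)"
  by (simp add: bound_value_def packing_bound_def o_def interv_sum_list_conv_sum_set_nat atLeast0LessThan)

text \<open>\<open>1 / real k\<close> is half of the lower bound on the distance between groups and
  serves as the \<open>\<delta>\<close> of \<open>cluster_cost\<close>.\<close>

locale packing_instance =
  fixes k m c :: nat and a :: "nat \<Rightarrow> nat" and \<alpha> :: real
  assumes \<alpha>: "0 \<le> \<alpha>" "\<alpha> < 1" and k: "0 < k" and c: "0 < c"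
    and a: "\<And>j. j < k \<Longrightarrow> 0 < a j" and weight: "\<And>j. j < k \<Longrightarrow> real (a j) powr (\<alpha> - 1) < 1 / real k"
begin

abbreviation "S \<equiv> \<Sum>j<k. a j"
abbreviation "grp s \<equiv> group_list k a ! s"
abbreviation "I \<equiv> instance_of \<alpha> (packing_description k a m c)"

lemma I_simps:
  "sources I = {..<S}" "sinks I = {S..<S + m}" "capacities I = [c, c, 1]" "exponent I = \<alpha>"
  "s < S \<Longrightarrow> position I s = group_point k (grp s)"
  "S \<le> t \<Longrightarrow> t < S + m \<Longrightarrow> position I t = 0"
  by (simp_all add: instance_of_def packing_description_def Let_def length_group_list nth_append group_point_def
      polar_point_def circle_point_def zero_prod_def)

lemma grp_less: "s < S \<Longrightarrow> grp s < k"
  using group_list_less[of s k a] by (simp add: length_group_list)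

lemma card_grp: "j < k \<Longrightarrow> card {s. s < S \<and> grp s = j} = a j"
  using card_group[of j k a] by (simp add: length_group_list)

lemma grp_nonempty: "j < k \<Longrightarrow> \<exists>s<S. grp s = j"
proof -
  assume j: "j < k"
  then have "card {s. s < S \<and> grp s = j} \<noteq> 0" using card_grp a by fastforce
  then show ?thesis by (metis (mono_tags, lifting) card.empty empty_Collect_eq)
qed

lemma wf_I: "wf_flamecast I"
  using \<alpha> c by (auto simp: wf_flamecast_def I_simps)

lemma layers_I: "intermediate_layers I = 1"
  by (simp add: intermediate_layers_def I_simps)

lemma equally_spaced_I: "group_equally_spaced_circular I"
proof -
  have "circular I 0 1"
    using norm_group_point[OF k] by (auto simp: circular_def I_simps)
  moreover have "group_equally_spaced I 0 1"
    unfolding group_equally_spaced_def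
  proof (intro exI conjI ballI)
    show "grp ` sources I = {..<k}" using grp_less grp_nonempty by (force simp: I_simps)
    fix s assume "s \<in> sources I"
    then show "position I s = circle_point 0 1 (2 * pi / real (k * k) + 2 * pi * real (grp s) / real k)"
      by (simp add: I_simps group_point_eq[OF k] circle_point_def Let_def)
  qed
  ultimately show ?thesis unfolding group_equally_spaced_circular_def by blast
qed

lemma sum_weights: "(\<Sum>s<S. real (a (grp s)) powr (\<alpha> - 1)) = (\<Sum>j<k. real (a j) powr \<alpha>)"
proof -
  have "(\<Sum>s<S. real (a (grp s)) powr (\<alpha> - 1)) = (\<Sum>j<k. \<Sum>s | s \<in> {..<S} \<and> grp s = j. real (a (grp s)) powr (\<alpha> - 1))"
    by (rule sum.group[symmetric]) (use grp_less in auto)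
  also have "\<dots> = (\<Sum>j<k. real (a j) * real (a j) powr (\<alpha> - 1))"
    using card_grp by (intro sum.cong) auto
  also have "\<dots> = (\<Sum>j<k. real (a j) powr \<alpha>)"
    using a by (intro sum.cong) (auto simp: powr_mult_base)
  finally show ?thesis .
qed

text \<open>The weights of all sources add up to the cost bound, and no cluster costs less than its
  weights, so every cluster is tight. By the equality case each cluster is one entire group. It
  hangs below a single sink, and the load of a sink is the sum of its groups.\<close>

lemma layout_packable:
  assumes valid: "valid_layout I V E p" and cheap: "cost I E p \<le> (\<Sum>j<k. real (a j) powr \<alpha>)"
  shows "packable k a m c"
proof -
  have top: "topology I V E" and cap: "\<And>v. v \<in> V \<Longrightarrow> load I E v \<le> capacities I ! layer V E v"
    and emb: "embedding I p"
    using valid by (auto simp: valid_layout_def valid_topology_def)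
  have disj: "sources I \<inter> sinks I = {}" by (auto simp: I_simps)
  have p0: "p t = 0" if "t \<in> sinks I" for t using emb that by (auto simp: embedding_def I_simps)
  have ps: "p s = group_point k (grp s)" if "s < S" for s using emb that by (auto simp: embedding_def I_simps)
  have roots: "roots V E = V \<inter> sinks I" and sv: "single_valued E" and EV: "E \<subseteq> V \<times> V" "finite V"
    using top by (auto simp: topology_def rooted_forest_def)
  define U where "U = feeders V E"
  define K where "K = cluster I E"
  note h = height_two[OF top disj layers_I U_def K_def]
  have finU: "finite U" using finite_subset[of U V] EV by (auto simp: U_def feeders_def)
  have KS: "K u \<subseteq> {..<S}" for u by (auto simp: K_def cluster_def I_simps)
  then have finK: "finite (K u)" for u using finite_subset by blast
  let ?w = "\<lambda>s. real (a (grp s)) powr (\<alpha> - 1)"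
  let ?c = "\<lambda>u. (\<Sum>s\<in>K u. dist (p s) (p u)) + norm (p u) * real (card (K u)) powr \<alpha>"
  have cost: "cost I E p = (\<Sum>u\<in>U. ?c u)"
    using cost_height_two[OF top disj layers_I p0 U_def K_def] by (simp add: I_simps)
  have disjK: "K u \<inter> K u' = {}" if "u \<in> U" "u' \<in> U" "u \<noteq> u'" for u u'
  proof (rule ccontr)
    assume "K u \<inter> K u' \<noteq> {}"
    then obtain s where s: "s \<in> K u" "s \<in> K u'" by blast
    then have "s \<in> sources I" by (simp add: K_def cluster_def)
    then show False using h(4) that s by blast
  qed
  have "(\<Union>u\<in>U. K u) = {..<S}"
  proof
    show "(\<Union>u\<in>U. K u) \<subseteq> {..<S}" using KS by blast
    show "{..<S} \<subseteq> (\<Union>u\<in>U. K u)"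
    proof
      fix s assume "s \<in> {..<S}"
      then have "s \<in> sources I" by (simp add: I_simps)
      then show "s \<in> (\<Union>u\<in>U. K u)" using h(4) by blast
    qed
  qed
  then have weights: "(\<Sum>u\<in>U. \<Sum>s\<in>K u. ?w s) = (\<Sum>j<k. real (a j) powr \<alpha>)"
    using sum.UNION_disjoint[of U K ?w] finU finK disjK sum_weights by simp
  have cluster: "(\<Sum>s\<in>K u. ?w s) \<le> ?c u" "?c u \<le> (\<Sum>s\<in>K u. ?w s) \<Longrightarrow> \<exists>j<k. (\<forall>s\<in>K u. grp s = j) \<and> card (K u) = a j"
    if u: "u \<in> U" for u
  proof -
    have eq: "(\<Sum>s\<in>K u. dist (p s) (p u)) = (\<Sum>s\<in>K u. dist (group_point k (grp s)) (p u))"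
      using KS[of u] ps by (intro sum.cong) auto
    have size: "card {s \<in> K u. grp s = j} \<le> a j" if "j < k" for j
      using card_grp[OF that] card_mono[of "{s. s < S \<and> grp s = j}" "{s \<in> K u. grp s = j}"] KS by fastforce
    note cc = cluster_cost[OF finK h(5)[OF u], where g = grp and k = k and P = "group_point k" and \<delta> = "1 / real k"
        and a = a and \<alpha> = \<alpha> and x = "p u"]
    have g: "grp s < k" if "s \<in> K u" for s using that KS grp_less by blast
    show "(\<Sum>s\<in>K u. ?w s) \<le> ?c u"
      unfolding eq by (rule cc(1)) (use g norm_group_point[OF k] dist_group_point weight size \<alpha> in auto)
    show "\<exists>j<k. (\<forall>s\<in>K u. grp s = j) \<and> card (K u) = a j" if "?c u \<le> (\<Sum>s\<in>K u. ?w s)"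
      by (rule cc(2)) (use that[unfolded eq] g norm_group_point[OF k] dist_group_point weight size \<alpha> in auto)
  qed
  have tight: "?c u \<le> (\<Sum>s\<in>K u. ?w s)" if "u \<in> U" for u
  proof (rule ccontr)
    assume "\<not> ?thesis"
    then have "(\<Sum>u\<in>U. \<Sum>s\<in>K u. ?w s) < (\<Sum>u\<in>U. ?c u)"
      using that cluster(1) finU by (intro sum_strict_mono_ex1 bexI[of _ u]) auto
    then show False using weights cheap cost by simp
  qed
  have whole: "\<exists>j<k. K u = {s. s < S \<and> grp s = j}" if uU: "u \<in> U" for u
  proof -
    obtain j where j: "j < k" "\<forall>s\<in>K u. grp s = j" "card (K u) = a j" using cluster(2)[OF uU tight[OF uU]] by blast
    have "K u = {s. s < S \<and> grp s = j}"
      using j KS card_grp[OF j(1)] by (intro card_subset_eq) auto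
    then show ?thesis using j(1) by blast
  qed
  have "\<exists>t. t < m \<and> (\<forall>s<S. grp s = j \<longrightarrow> (s, S + t) \<in> E\<^sup>*) \<and> S + t \<in> roots V E" if j: "j < k" for j
  proof -
    obtain s where s: "s < S" "grp s = j" using grp_nonempty[OF j] by blast
    then have "s \<in> sources I" by (simp add: I_simps)
    from h(4)[OF this] obtain u where u: "u \<in> U" "s \<in> K u" by (elim ex1E conjE)
    obtain j' where "K u = {s. s < S \<and> grp s = j'}" using whole[OF u(1)] by blast
    then have Ku: "K u = {s. s < S \<and> grp s = j}" using u(2) s(2) by simp
    obtain r where r: "r \<in> roots V E" "(u, r) \<in> E" using u(1) by (auto simp: U_def feeders_def)
    then obtain t where t: "r = S + t" "t < m" using roots by (auto simp: I_simps le_iff_add)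
    have "(s', r) \<in> E\<^sup>*" if "s' < S" "grp s' = j" for s'
    proof -
      have "s' \<in> K u" using Ku that by simp
      then have "(s', u) \<in> E\<^sup>*" by (simp add: K_def cluster_def)
      then show ?thesis using r(2) by (rule rtrancl_into_rtrancl)
    qed
    then show ?thesis using t r by blast
  qed
  then obtain b where b: "\<And>j. j < k \<Longrightarrow> b j < m" "\<And>j s. j < k \<Longrightarrow> s < S \<Longrightarrow> grp s = j \<Longrightarrow> (s, S + b j) \<in> E\<^sup>*"
    "\<And>j. j < k \<Longrightarrow> S + b j \<in> roots V E" by metis
  have "(\<Sum>j | j < k \<and> b j = i. a j) \<le> c" if i: "i < m" for i
  proof (cases "\<exists>j<k. b j = i")
    case True
    then obtain j0 where j0: "j0 < k" "b j0 = i" by blast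
    then have r: "S + i \<in> roots V E" using b(3) by blast
    let ?J = "{j. j < k \<and> b j = i}"
    have "(\<Sum>j\<in>?J. a j) = (\<Sum>j\<in>?J. card {s. s < S \<and> grp s = j})" using card_grp by (intro sum.cong) auto
    also have "\<dots> = card (\<Union>j\<in>?J. {s. s < S \<and> grp s = j})"
      by (subst card_UN_disjoint) auto
    also have "\<dots> \<le> card {s \<in> sources I. (s, S + i) \<in> E\<^sup>*}"
      by (rule card_mono) (use b(2) in \<open>auto simp: I_simps\<close>)
    also have "\<dots> = load I E (S + i)" by (simp add: load_def)
    also have "\<dots> \<le> capacities I ! layer V E (S + i)"
      using cap r by (auto simp: roots_def)
    also have "layer V E (S + i) = 0"
      using layer_eq[OF sv _ r, of "S + i" 0] by simp
    finally show ?thesis by (simp add: I_simps)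
  next
    case False
    then have "{j. j < k \<and> b j = i} = {}" by auto
    then show ?thesis by (simp only: sum.empty)
  qed
  then show ?thesis unfolding packable_def using b(1) by blast
qed

text \<open>Each group has a Steiner vertex at its own position, so the edges of the sources have
  length 0, and each group pays for one edge of length 1 and load \<open>a j\<close>. Vertex
  \<open>S + m + j\<close> belongs to group \<open>j\<close>.\<close>

lemma packable_layout:
  assumes "packable k a m c"
  shows "\<exists>V E p. valid_layout I V E p \<and> cost I E p = (\<Sum>j<k. real (a j) powr \<alpha>)"
proof -
  obtain b where b: "\<And>j. j < k \<Longrightarrow> b j < m" "\<And>i. i < m \<Longrightarrow> (\<Sum>j | j < k \<and> b j = i. a j) \<le> c"
    using assms unfolding packable_def by blast
  define E1 where "E1 = (\<lambda>s. (s, S + m + grp s)) ` {..<S}"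
  define E2 where "E2 = (\<lambda>j. (S + m + j, S + b j)) ` {..<k}"
  define E where "E = E1 \<union> E2"
  \<comment> \<open>Only the sinks in use are vertices: an isolated sink would be a leaf that is not
    a source.\<close>
  define V where "V = {..<S} \<union> (\<lambda>j. S + b j) ` {..<k} \<union> (\<lambda>j. S + m + j) ` {..<k}"
  define p where "p v = (if v < S + m then position I v else group_point k (v - (S + m)))" for v
  have E_iff: "(u, v) \<in> E \<longleftrightarrow> u < S \<and> v = S + m + grp u \<or> (\<exists>j<k. u = S + m + j \<and> v = S + b j)" for u v
    by (auto simp: E_def E1_def E2_def)
  have E_src: "(s, S + m + grp s) \<in> E" if "s < S" for s using that by (simp add: E_iff)
  have E_st: "(S + m + j, S + b j) \<in> E" if "j < k" for j using that by (auto simp: E_iff)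
  have EV: "E \<subseteq> V \<times> V" using grp_less by (auto simp: E_iff V_def)
  have finV: "finite V" by (simp add: V_def)
  have sv: "single_valued E" by (auto simp: single_valued_def E_iff)
  have "E \<subseteq> Wellfounded.measure (\<lambda>v. if v < S then 0 else if v < S + m then 2 else 1)"
    using b(1) by (auto simp: E_iff)
  then have "acyclic E" using acyclic_subset[OF wf_acyclic[OF wf_measure]] by blast
  then have forest: "rooted_forest V E" using EV finV sv by (simp add: rooted_forest_def)
  have sources: "leaves V E = sources I"
  proof (intro equalityI subsetI)
    fix v assume "v \<in> leaves V E"
    then have v: "v \<in> V" "\<And>u. (u, v) \<notin> E" by (auto simp: leaves_def)
    have "v \<noteq> S + b j" "v \<noteq> S + m + j" if "j < k" for j
      using E_st[OF that] grp_nonempty[OF that] E_src v(2) by blast+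
    then show "v \<in> sources I" using v(1) by (auto simp: V_def I_simps)
  next
    fix v assume "v \<in> sources I"
    then show "v \<in> leaves V E" by (auto simp: leaves_def V_def I_simps E_iff)
  qed
  have roots: "roots V E = V \<inter> sinks I"
  proof (intro equalityI subsetI)
    fix v assume "v \<in> roots V E"
    then have v: "v \<in> V" "\<And>u. (v, u) \<notin> E" by (auto simp: roots_def)
    have "\<not> v < S" using E_src v(2) by blast
    moreover have "v \<noteq> S + m + j" if "j < k" for j using E_st[OF that] v(2) by blast
    ultimately show "v \<in> V \<inter> sinks I" using v(1) b(1) by (auto simp: V_def I_simps)
  next
    fix v assume "v \<in> V \<inter> sinks I"
    then show "v \<in> roots V E" by (auto simp: roots_def I_simps E_iff)
  qed
  have sink_root: "S + b j \<in> roots V E" if "j < k" for j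
    using that b(1) unfolding roots by (auto simp: V_def I_simps)
  have layer_sink: "layer V E (S + b j) = 0" if "j < k" for j
    using layer_eq[OF sv _ sink_root[OF that], of "S + b j" 0] by simp
  have layer_st: "layer V E (S + m + j) = 1" if "j < k" for j
    using layer_eq[OF sv _ sink_root[OF that], of "S + m + j" 1] E_st[OF that] by simp
  have layer_src: "layer V E s = 2" if "s < S" for s
  proof -
    have "(s, S + b (grp s)) \<in> E ^^ Suc (Suc 0)"
      using E_src[OF that] E_st[OF grp_less[OF that]] by auto
    then show ?thesis using layer_eq[OF sv _ sink_root[OF grp_less[OF that]]] by (simp add: numeral_2_eq_2)
  qed
  have reach: "(s, v) \<in> E\<^sup>* \<longleftrightarrow> v = s \<or> v = S + m + grp s \<or> v = S + b (grp s)" if s: "s < S" for s v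
  proof
    assume "(s, v) \<in> E\<^sup>*"
    then show "v = s \<or> v = S + m + grp s \<or> v = S + b (grp s)"
    proof (induction rule: rtrancl_induct)
      case (step y z)
      have "b (grp s) < m" using b(1) grp_less[OF s] .
      then show ?case using step s by (auto simp: E_iff)
    qed simp
  next
    have "(s, S + m + grp s) \<in> E" "(S + m + grp s, S + b (grp s)) \<in> E"
      using E_src[OF s] E_st[OF grp_less[OF s]] by auto
    then show "v = s \<or> v = S + m + grp s \<or> v = S + b (grp s) \<Longrightarrow> (s, v) \<in> E\<^sup>*"
      by (auto intro: rtrancl_into_rtrancl)
  qed
  have load_src: "load I E v = 1" if "v < S" for v
  proof -
    have "{s \<in> sources I. (s, v) \<in> E\<^sup>*} = {v}" using that by (auto simp: I_simps reach)
    then show ?thesis by (simp add: load_def)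
  qed
  have load_st: "load I E (S + m + j) = a j" if "j < k" for j
  proof -
    have "{s \<in> sources I. (s, S + m + j) \<in> E\<^sup>*} = {s. s < S \<and> grp s = j}"
      using b(1)[OF grp_less] by (auto simp: I_simps reach) fastforce
    then show ?thesis using card_grp[OF that] by (simp add: load_def)
  qed
  have load_sink: "load I E (S + i) = (\<Sum>j | j < k \<and> b j = i. a j)" if "i < m" for i
  proof -
    have "{s \<in> sources I. (s, S + i) \<in> E\<^sup>*} = (\<Union>j\<in>{j. j < k \<and> b j = i}. {s. s < S \<and> grp s = j})"
      using that grp_less by (auto simp: I_simps reach)
    then have "load I E (S + i) = card (\<Union>j\<in>{j. j < k \<and> b j = i}. {s. s < S \<and> grp s = j})"
      by (simp add: load_def)
    also have "\<dots> = (\<Sum>j | j < k \<and> b j = i. card {s. s < S \<and> grp s = j})"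
      by (rule card_UN_disjoint) auto
    also have "\<dots> = (\<Sum>j | j < k \<and> b j = i. a j)" using card_grp by (intro sum.cong) auto
    finally show ?thesis .
  qed
  have a_le: "a j \<le> c" if "j < k" for j
    using b(2)[OF b(1)[OF that]] member_le_sum[of j "{j'. j' < k \<and> b j' = b j}" a] that by simp
  have cases_V: "v < S \<or> (\<exists>j<k. v = S + b j) \<or> (\<exists>j<k. v = S + m + j)" if "v \<in> V" for v
    using that by (auto simp: V_def)
  have "topology I V E"
    unfolding topology_def using forest sources roots cases_V layer_src layer_st layer_sink layers_I by fastforce
  moreover have "load I E v \<le> capacities I ! layer V E v" if "v \<in> V" for v
    using cases_V[OF that] layer_src layer_st layer_sink load_src load_st load_sink b a_le
    by (auto simp: I_simps)
  moreover have "embedding I p" by (auto simp: embedding_def p_def I_simps)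
  ultimately have "valid_layout I V E p" by (simp add: valid_layout_def valid_topology_def)
  moreover have "cost I E p = (\<Sum>j<k. real (a j) powr \<alpha>)"
  proof -
    let ?f = "\<lambda>(u, v). dist (p u) (p v) * real (load I E u) powr exponent I"
    have "cost I E p = sum ?f E1 + sum ?f E2"
      unfolding cost_def E_def by (rule sum.union_disjoint) (auto simp: E1_def E2_def)
    also have "sum ?f E1 = 0"
      by (rule sum.neutral) (auto simp: E1_def p_def I_simps)
    also have "sum ?f E2 = (\<Sum>j<k. real (a j) powr \<alpha>)"
    proof -
      have "sum ?f E2 = (\<Sum>j<k. ?f (S + m + j, S + b j))"
        unfolding E2_def by (subst sum.reindex) (auto simp: inj_on_def)
      also have "\<dots> = (\<Sum>j<k. real (a j) powr \<alpha>)"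
        using b(1) load_st norm_group_point[OF k] by (intro sum.cong) (auto simp: p_def I_simps)
      finally show ?thesis .
    qed
    finally show ?thesis by simp
  qed
  ultimately show ?thesis by blast
qed

theorem FLaMECaST_packing:
  "(packing_description k a m c, packing_bound k a) \<in> FLaMECaST \<alpha> \<longleftrightarrow> packable k a m c"
  unfolding FLaMECaST_def using wf_I layout_packable packable_layout
  by (fastforce simp: bound_value_packing)

end

section \<open>Computations as cyclic tilings\<close>

type_synonym label = "nat \<times> nat option"

fun lab :: "config \<Rightarrow> int \<Rightarrow> label" where
  "lab (q, h, t) i = (t i, if h = i then Some q else None)"

text \<open>A halted configuration is a fixed point, so from the halting time on all rows show the
  final configuration.\<close>

definition next_config :: "machine \<Rightarrow> config \<Rightarrow> config" where
  "next_config M c = (case step M c of None \<Rightarrow> c | Some c' \<Rightarrow> c')"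

text \<open>The state that the head brings along when it leaves a cell labelled \<open>l\<close> by
  the move \<open>mv\<close>; \<open>None\<close> if it does not do so.\<close>

definition arrive :: "machine \<Rightarrow> move \<Rightarrow> label \<Rightarrow> nat option" where
  "arrive M mv l = (case snd l of None \<Rightarrow> None | Some q \<Rightarrow>
     (case M (q, fst l) of None \<Rightarrow> None | Some (q', s, mv') \<Rightarrow> if mv' = mv then Some q' else None))"

definition local_rule :: "machine \<Rightarrow> label \<Rightarrow> label \<Rightarrow> label \<Rightarrow> label" where
  "local_rule M a b c = (case snd b of
     Some q \<Rightarrow> (case M (q, fst b) of None \<Rightarrow> b
       | Some (q', s, mv) \<Rightarrow> (s, if mv = Move_None then Some q' else None))
   | None \<Rightarrow> (fst b, case arrive M Move_Right a of Some q \<Rightarrow> Some q | None \<Rightarrow> arrive M Move_Left c))"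

lemma lab_next: "lab (next_config M c) i = local_rule M (lab c (i - 1)) (lab c i) (lab c (i + 1))"
proof (cases c)
  case (fields q h t)
  show ?thesis
  proof (cases "M (q, t h)")
    case None
    then show ?thesis by (auto simp: fields next_config_def local_rule_def arrive_def split: if_splits)
  next
    case (Some r)
    obtain q' s mv where r: "r = (q', s, mv)" by (cases r)
    show ?thesis
      by (cases mv) (use Some in \<open>auto simp: fields r next_config_def local_rule_def arrive_def\<close>)
  qed
qed

definition config_at :: "machine \<Rightarrow> bool list \<Rightarrow> nat \<Rightarrow> config" where
  "config_at M u t = (next_config M ^^ t) (0, 0, tape_of u)"

lemma config_at_Suc: "config_at M u (Suc t) = next_config M (config_at M u t)"
  by (simp add: config_at_def)

lemma runs_config_at:
  assumes "runs M (0, 0, tape_of u) n c" "n \<le> t"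
  shows "config_at M u t = c"
proof -
  have stuck: "(next_config M ^^ t) c = c" if "step M c = None" for c t
    using that by (induction t) (auto simp: next_config_def)
  have "runs M c0 n c \<Longrightarrow> n \<le> t \<Longrightarrow> (next_config M ^^ t) c0 = c" for c0
  proof (induction arbitrary: t rule: runs.induct)
    case (halt c)
    then show ?case using stuck by simp
  next
    case (step c c' n c'')
    then obtain t' where "t = Suc t'" by (cases t) auto
    moreover have "next_config M c = c'" using step.hyps(1) by (simp add: next_config_def)
    ultimately show ?case using step.IH[of t'] step.prems by (simp add: funpow_Suc_right del: funpow.simps)
  qed
  then show ?thesis using assms by (simp add: config_at_def)
qed

lemma config_at_bounds:
  "\<exists>q h s. config_at M u t = (q, h, s) \<and> \<bar>h\<bar> \<le> int t \<and> (\<forall>i. int t \<le> \<bar>i\<bar> \<longrightarrow> s i = tape_of u i)"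
proof (induction t)
  case 0
  then show ?case by (simp add: config_at_def)
next
  case (Suc t)
  then obtain q h s where c: "config_at M u t = (q, h, s)" "\<bar>h\<bar> \<le> int t" "\<forall>i. int t \<le> \<bar>i\<bar> \<longrightarrow> s i = tape_of u i"
    by blast
  show ?case
  proof (cases "M (q, s h)")
    case None
    then show ?thesis using c by (auto simp: config_at_Suc next_config_def)
  next
    case (Some r)
    obtain q' a mv where r: "r = (q', a, mv)" by (cases r)
    show ?thesis using c Some r by (cases mv) (auto simp: config_at_Suc next_config_def)
  qed
qed

text \<open>The head moves one cell per step, so up to time \<open>t\<close> it stays within
  distance \<open>t\<close> of the origin and cells farther out keep their initial content. This is
  why the border columns of the torus can be held blank.\<close>

lemma lab_outside:
  assumes "int t < \<bar>i\<bar>" "i < 0 \<or> length u \<le> nat i"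
  shows "lab (config_at M u t) i = (0, None)"
proof -
  obtain q h s where "config_at M u t = (q, h, s)" "\<bar>h\<bar> \<le> int t" "\<forall>i. int t \<le> \<bar>i\<bar> \<longrightarrow> s i = tape_of u i"
    using config_at_bounds by blast
  then show ?thesis using assms by (auto simp: tape_of_def)
qed

section \<open>Windows of a computation as tiles\<close>

datatype condition = Any | Fixed label | Certificate | Accepting

text \<open>\<open>Certificate\<close> admits bits followed by blanks, so that the guessed cells
  spell a word. \<open>Accepting\<close> asks for symbol 2, which stands for \<open>True\<close>,
  the output of an accepting verifier.\<close>

fun satisfies :: "condition \<Rightarrow> label \<Rightarrow> label \<Rightarrow> bool" where
  "satisfies Any b c \<longleftrightarrow> True"
| "satisfies (Fixed l) b c \<longleftrightarrow> b = l"
| "satisfies Certificate b c \<longleftrightarrow> b \<in> {0, 1, 2} \<times> {None} \<and> (b = (0, None) \<longrightarrow> c = (0, None))"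
| "satisfies Accepting b c \<longleftrightarrow> fst b = 2"

text \<open>A tile is a cell with its two horizontal neighbours, together with its class: whether the cell
  lies in the first row, whether it lies in the last row, and a condition on its label.\<close>

type_synonym tile_class = "bool \<times> bool \<times> condition"
type_synonym tile = "tile_class \<times> label \<times> label \<times> label"

text \<open>Horizontal colours are the overlaps of adjacent windows. The outgoing vertical colour is
  the label computed for the cell below in the next row, the incoming one is the label of the cell
  itself. At the seam, where the last row meets the first, both are \<open>None\<close>.\<close>

fun colour :: "machine \<Rightarrow> nat \<Rightarrow> tile \<Rightarrow> label \<times> label + label option" where
  "colour M p ((f, l, d), a, b, c) =
     (if p = 0 then Inl (b, c) else if p = 1 then Inl (a, b)
      else if p = 2 then Inr (if l then None else Some (local_rule M a b c))
      else Inr (if f then None else Some b))"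

lemma colour_simps:
  "colour M 0 (k, a, b, c) = Inl (b, c)" "colour M 1 (k, a, b, c) = Inl (a, b)"
  "colour M 2 (k, a, b, c) = Inr (if fst (snd k) then None else Some (local_rule M a b c))"
  "colour M 3 (k, a, b, c) = Inr (if fst k then None else Some b)"
  by (cases k, simp)+

lemma tape_of_int: "tape_of u (int n) = (if n < length u then if u ! n then 2 else 1 else 0)"
  by (simp add: tape_of_def)

locale finite_machine =
  fixes M :: machine
  assumes finite_dom: "finite (dom M)"
begin

definition labels :: "label set" where
  "labels = ({0, 1, 2} \<union> (fst \<circ> snd) ` ran M) \<times> insert None (Some ` insert 0 (fst ` ran M))"

definition conditions :: "condition set" where
  "conditions = {Any, Certificate, Accepting} \<union> Fixed ` labels"

definition tiles :: "tile set" where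
  "tiles = {((f, l, d), a, b, c).
     d \<in> conditions \<and> a \<in> labels \<and> b \<in> labels \<and> c \<in> labels \<and> satisfies d b c}"

lemma tiles_iff [simp]: "((f, l, d), a, b, c) \<in> tiles \<longleftrightarrow>
    d \<in> conditions \<and> a \<in> labels \<and> b \<in> labels \<and> c \<in> labels \<and> satisfies d b c"
  by (simp add: tiles_def)

definition colours :: "(label \<times> label + label option) set" where
  "colours = (\<Union>p<4. colour M p ` tiles)"

definition classes :: "tile_class set" where
  "classes = UNIV \<times> UNIV \<times> conditions"

lemma finite_labels: "finite labels"
  using finite_ran[OF finite_dom] by (simp add: labels_def)

lemma finite_tiles: "finite tiles"
proof (rule finite_subset)
  show "tiles \<subseteq> (UNIV \<times> UNIV \<times> conditions) \<times> labels \<times> labels \<times> labels" by (auto simp: tiles_def)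
  show "finite ((UNIV \<times> UNIV \<times> conditions) \<times> labels \<times> labels \<times> labels :: tile set)"
    using finite_labels by (intro finite_cartesian_product) (auto simp: conditions_def)
qed

lemma finite_colours: "finite colours"
  using finite_tiles by (simp add: colours_def)

lemma finite_classes: "finite classes"
  using finite_labels unfolding classes_def by (intro finite_cartesian_product) (auto simp: conditions_def)

lemma blank_label: "(0, None) \<in> labels"
  by (simp add: labels_def)

lemma local_rule_labels:
  assumes "a \<in> labels" "b \<in> labels" "c \<in> labels"
  shows "local_rule M a b c \<in> labels"
proof -
  have r: "q' \<in> fst ` ran M" "s \<in> (fst \<circ> snd) ` ran M" if "M x = Some (q', s, mv)" for x q' s mv
  proof -
    have "(q', s, mv) \<in> ran M" using that by (rule ranI)
    then show "q' \<in> fst ` ran M" "s \<in> (fst \<circ> snd) ` ran M"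
      using image_eqI[of q' fst "(q', s, mv)"] image_eqI[of s "fst \<circ> snd" "(q', s, mv)"] by simp_all
  qed
  let ?A = "{0, 1, 2} \<union> (fst \<circ> snd) ` ran M" and ?Q = "insert None (Some ` insert 0 (fst ` ran M))"
  have arr: "arrive M mv l \<in> ?Q" for mv l
  proof (cases "arrive M mv l")
    case (Some q')
    then obtain x s mv' where "M x = Some (q', s, mv')"
      by (auto simp: arrive_def split: option.splits prod.splits if_splits)
    from r(1)[OF this] show ?thesis unfolding Some by (intro insertI2 imageI)
  qed simp
  obtain u e where b: "b = (u, e)" by (cases b)
  have u: "u \<in> ?A" using assms(2) unfolding b labels_def by (rule SigmaD1)
  show ?thesis
  proof (cases e)
    case None
    have "(case arrive M Move_Right a of None \<Rightarrow> arrive M Move_Left c | Some q \<Rightarrow> Some q) \<in> ?Q"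
      using arr[of Move_Right a] arr[of Move_Left c] by (cases "arrive M Move_Right a") simp_all
    from SigmaI[OF u this] show ?thesis
      unfolding local_rule_def b None labels_def snd_conv fst_conv option.case .
  next
    case (Some q)
    show ?thesis
    proof (cases "M (q, u)")
      case None
      then show ?thesis using assms(2) by (simp add: local_rule_def b Some)
    next
      case (Some x)
      obtain q' s mv where x: "x = (q', s, mv)" by (cases x)
      have "(if mv = Move_None then Some q' else None) \<in> ?Q" "s \<in> ?A"
        using r[OF Some[unfolded x]] by (simp, blast)
      from SigmaI[OF this(2,1)] show ?thesis
        using \<open>e = Some q\<close> Some x unfolding local_rule_def b labels_def by (simp only: snd_conv fst_conv option.case prod.case)
    qed
  qed
qed

definition tile_no :: "tile \<Rightarrow> nat" where "tile_no = to_nat_on tiles"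
definition tile_at :: "nat \<Rightarrow> tile" where "tile_at = from_nat_into tiles"
definition G :: nat where "G = card tiles"
definition \<Gamma> :: nat where "\<Gamma> = card colours + card classes"
definition cl :: "nat \<Rightarrow> nat" where "cl \<tau> = to_nat_on classes (fst (tile_at \<tau>))"
definition col :: "nat \<Rightarrow> nat \<Rightarrow> nat" where "col p \<tau> = to_nat_on colours (colour M p (tile_at \<tau>))"

text \<open>Any tile of the class will do. A constant window exists for every condition, since the
  default labels satisfy it together with themselves as right neighbour.\<close>

definition representative :: "tile_class \<Rightarrow> nat" where
  "representative k = (let l = (case snd (snd k) of Fixed l \<Rightarrow> l | Accepting \<Rightarrow> (2, None) | _ \<Rightarrow> (0, None))
     in tile_no (k, l, l, l))"

lemma tile_at_in: "\<tau> < G \<Longrightarrow> tile_at \<tau> \<in> tiles"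
  unfolding tile_at_def G_def by (rule from_nat_into) (metis card.empty not_less_zero)

lemma tile_no_less: "x \<in> tiles \<Longrightarrow> tile_no x < G"
  unfolding tile_no_def G_def using to_nat_on_finite[OF finite_tiles] by (auto simp: bij_betw_def)

lemma tile_at_no: "x \<in> tiles \<Longrightarrow> tile_at (tile_no x) = x"
  unfolding tile_at_def tile_no_def using finite_tiles by (simp add: countable_finite)

lemma tile_class_in: "x \<in> tiles \<Longrightarrow> fst x \<in> classes"
  by (auto simp: tiles_def classes_def)

lemma colour_in: "x \<in> tiles \<Longrightarrow> colour M p x \<in> colours"
proof -
  assume x: "x \<in> tiles"
  obtain f l d a b c where xe: "x = ((f, l, d), a, b, c)" by (metis prod.collapse)
  \<comment> \<open>All ports from 3 on have the same colour.\<close>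
  have "colour M p x = colour M (if p < 4 then p else 3) x" unfolding xe by simp
  also have "\<dots> \<in> colours" unfolding colours_def using x by (intro UN_I[of "if p < 4 then p else 3"] imageI) auto
  finally show ?thesis .
qed

lemma cl_eq_iff: "\<tau> < G \<Longrightarrow> \<tau>' < G \<Longrightarrow> cl \<tau> = cl \<tau>' \<longleftrightarrow> fst (tile_at \<tau>) = fst (tile_at \<tau>')"
  unfolding cl_def using tile_at_in tile_class_in finite_classes by (simp add: countable_finite)

lemma col_eq_iff: "\<tau> < G \<Longrightarrow> \<tau>' < G \<Longrightarrow> col p \<tau> = col q \<tau>' \<longleftrightarrow> colour M p (tile_at \<tau>) = colour M q (tile_at \<tau>')"
  unfolding col_def using tile_at_in colour_in finite_colours by (simp add: countable_finite)

lemma representative: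
  assumes "k \<in> classes"
  shows "representative k < G" "fst (tile_at (representative k)) = k"
proof -
  obtain f l d where k: "k = (f, l, d)" by (cases k)
  define b where "b = (case d of Fixed l \<Rightarrow> l | Accepting \<Rightarrow> (2, None) | _ \<Rightarrow> (0, None :: nat option))"
  have d: "d \<in> conditions" using assms by (simp add: classes_def k)
  have "b \<in> labels" using d by (cases d) (auto simp: b_def conditions_def labels_def)
  moreover have "satisfies d b b" by (cases d) (auto simp: b_def)
  ultimately have "(k, b, b, b) \<in> tiles" using d by (simp add: k)
  moreover have "representative k = tile_no (k, b, b, b)"
    by (simp add: representative_def b_def k Let_def)
  ultimately show "representative k < G" "fst (tile_at (representative k)) = k"
    using tile_no_less tile_at_no by auto
qed

lemma tile_system: "0 < N \<Longrightarrow> tile_system G \<Gamma> N cl col"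
proof
  show "cl \<tau> < \<Gamma>" if "\<tau> < G" for \<tau>
  proof -
    have "cl \<tau> \<in> {..<card classes}" unfolding cl_def
      using to_nat_on_finite[OF finite_classes] tile_class_in[OF tile_at_in[OF that]] by (auto simp: bij_betw_def)
    then show ?thesis by (simp add: \<Gamma>_def)
  qed
  show "col p \<tau> < \<Gamma>" if "\<tau> < G" for p \<tau>
  proof -
    have "col p \<tau> \<in> {..<card colours}" unfolding col_def
      using to_nat_on_finite[OF finite_colours] colour_in[OF tile_at_in[OF that]] by (auto simp: bij_betw_def)
    then show ?thesis by (simp add: \<Gamma>_def)
  qed
  \<comment> \<open>The blank window without a head reproduces itself in both directions.\<close>
  let ?x = "((False, False, Any), (0, None), (0, None), (0, None)) :: tile"
  have x: "?x \<in> tiles" by (simp add: conditions_def blank_label)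
  have "local_rule M (0, None) (0, None) (0, None) = (0, None)" by (simp add: local_rule_def arrive_def)
  then show "\<exists>\<tau><G. col 0 \<tau> = col 1 \<tau> \<and> col 2 \<tau> = col 3 \<tau>"
    using tile_no_less[OF x] tile_at_no[OF x] by (intro exI[of _ "tile_no ?x"]) (simp add: col_eq_iff)
qed

section \<open>Labellings of the torus\<close>

definition labelling :: "nat \<Rightarrow> nat \<Rightarrow> (nat \<Rightarrow> tile_class) \<Rightarrow> (nat \<Rightarrow> label) \<Rightarrow> bool" where
  "labelling N w k B \<longleftrightarrow> (\<forall>v<N. B v \<in> labels \<and>
     satisfies (snd (snd (k v))) (B v) (B ((v + 1) mod N)) \<and>
     (if fst (snd (k v)) then None else Some (local_rule M (B ((v + N - 1) mod N)) (B v) (B ((v + 1) mod N)))) =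
     (if fst (k ((v + w) mod N)) then None else Some (B ((v + w) mod N))))"

lemma mod_pred_succ: "0 < N \<Longrightarrow> v < N \<Longrightarrow> ((v + N - 1) mod N + 1) mod N = (v::nat)"
  by (cases "v = 0") (auto simp: mod_if)

lemma mod_succ_pred: "0 < N \<Longrightarrow> v < N \<Longrightarrow> ((v + 1) mod N + N - 1) mod N = (v::nat)"
  by (auto simp: mod_if)

text \<open>Horizontal colours force the side entries of each window to be the middle entries of the
  neighbouring windows, so a tiling is determined by its middle entries; the vertical colours then
  express the local rule.\<close>

lemma solves_iff_labelling:
  assumes N: "0 < N" and k: "\<And>v. v < N \<Longrightarrow> k v \<in> classes"
  shows "(\<exists>z. tile_system.solves G N w cl col (\<lambda>v. representative (k v)) z) \<longleftrightarrow> (\<exists>B. labelling N w k B)"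
proof
  interpret tile_system G \<Gamma> N w cl col using tile_system[OF N] .
  assume "\<exists>z. solves (\<lambda>v. representative (k v)) z"
  then obtain z where z: "\<And>v. v < N \<Longrightarrow> z v < G" "\<And>v. v < N \<Longrightarrow> cl (z v) = cl (representative (k v))"
    "\<And>v d. v < N \<Longrightarrow> d < 2 \<Longrightarrow> col (2 * d) (z v) = col (2 * d + 1) (z (next_cell d v))"
    unfolding solves_def by blast
  define A where "A v = fst (snd (tile_at (z v)))" for v
  define B where "B v = fst (snd (snd (tile_at (z v))))" for v
  define C where "C v = snd (snd (snd (tile_at (z v))))" for v
  have tile: "tile_at (z v) = (k v, A v, B v, C v)" if "v < N" for v
    using z(2)[OF that] cl_eq_iff[OF z(1)[OF that] representative(1)[OF k[OF that]]] representative(2)[OF k[OF that]]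
    by (simp add: A_def B_def C_def prod_eq_iff)
  have hor: "C v = B ((v + 1) mod N) \<and> B v = A ((v + 1) mod N)" if "v < N" for v
  proof -
    have "next_cell 0 v < N" by simp
    then have "colour M 0 (tile_at (z v)) = colour M 1 (tile_at (z (next_cell 0 v)))"
      using z(3)[OF that, of 0] col_eq_iff[OF z(1)[OF that] z(1)] by simp
    then show ?thesis unfolding tile[OF that] tile[OF \<open>next_cell 0 v < N\<close>] colour_simps
      by (simp add: next_cell_def)
  qed
  have pred: "A v = B ((v + N - 1) mod N)" if "v < N" for v
    using hor[of "(v + N - 1) mod N"] mod_pred_succ[OF N that] N by simp
  have "labelling N w k B"
    unfolding labelling_def
  proof (intro allI impI conjI)
    fix v assume v: "v < N"
    have t: "(k v, A v, B v, C v) \<in> tiles" using tile_at_in[OF z(1)[OF v]] tile[OF v] by simp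
    then show "B v \<in> labels" "satisfies (snd (snd (k v))) (B v) (B ((v + 1) mod N))"
      using hor[OF v] by (cases "k v"; simp)+
    have "next_cell 1 v < N" by simp
    then have "colour M 2 (tile_at (z v)) = colour M 3 (tile_at (z (next_cell 1 v)))"
      using z(3)[OF v, of 1] col_eq_iff[OF z(1)[OF v] z(1)] by simp
    then show "(if fst (snd (k v)) then None else Some (local_rule M (B ((v + N - 1) mod N)) (B v) (B ((v + 1) mod N)))) =
      (if fst (k ((v + w) mod N)) then None else Some (B ((v + w) mod N)))"
      unfolding tile[OF v] tile[OF \<open>next_cell 1 v < N\<close>] colour_simps conjunct1[OF hor[OF v]] pred[OF v]
      by (simp add: next_cell_def del: One_nat_def)
  qed
  then show "\<exists>B. labelling N w k B" by blast
next
  interpret tile_system G \<Gamma> N w cl col using tile_system[OF N] .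
  assume "\<exists>B. labelling N w k B"
  then obtain B where B: "labelling N w k B" by blast
  let ?t = "\<lambda>v. (k v, B ((v + N - 1) mod N), B v, B ((v + 1) mod N))"
  have t: "?t v \<in> tiles" if "v < N" for v
  proof -
    have "(v + N - 1) mod N < N" "(v + 1) mod N < N" using N by auto
    then have "B ((v + N - 1) mod N) \<in> labels" "B ((v + 1) mod N) \<in> labels" "B v \<in> labels"
      "satisfies (snd (snd (k v))) (B v) (B ((v + 1) mod N))"
      using B that unfolding labelling_def by blast+
    moreover have "snd (snd (k v)) \<in> conditions" using k[OF that] by (auto simp: classes_def)
    ultimately show ?thesis by (cases "k v") simp
  qed
  note less = tile_no_less[OF t] and at = tile_at_no[OF t]
  have "solves (\<lambda>v. representative (k v)) (\<lambda>v. tile_no (?t v))"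
    unfolding solves_def
  proof (intro allI impI conjI)
    fix v assume v: "v < N"
    show "tile_no (?t v) < G" by (rule less[OF v])
    show "cl (tile_no (?t v)) = cl (representative (k v))"
      using cl_eq_iff[OF less[OF v] representative(1)[OF k[OF v]]] representative(2)[OF k[OF v]] at[OF v] by simp
    fix d :: nat assume "d < 2"
    then consider "d = 0" | "d = 1" by linarith
    then show "col (2 * d) (tile_no (?t v)) = col (2 * d + 1) (tile_no (?t (next_cell d v)))"
    proof cases
      case 1
      have "colour M 0 (?t v) = colour M 1 (?t (next_cell 0 v))"
        using mod_succ_pred[OF N v] unfolding colour_simps by (simp add: next_cell_def)
      then show ?thesis unfolding 1 using col_eq_iff[OF less[OF v] less[OF next_cell_less]] at[OF v] at[OF next_cell_less] by simp
    next
      case 2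
      have "colour M 2 (?t v) = colour M 3 (?t (next_cell 1 v))"
        using B v unfolding labelling_def colour_simps by (simp add: next_cell_def)
      then show ?thesis unfolding 2 using col_eq_iff[OF less[OF v] less[OF next_cell_less]] at[OF v] at[OF next_cell_less] by simp
    qed
  qed
  then show "\<exists>z. solves (\<lambda>v. representative (k v)) z" by blast
qed

end

text \<open>Column \<open>i\<close> of row \<open>t\<close> is tape position
  \<open>i - (T + 1)\<close> at time \<open>t\<close>, so the columns range from
  \<open>-(T + 1)\<close> to \<open>T + 1\<close> and the two outermost are out of reach within
  \<open>T\<close> steps. Row 0 holds the start configuration: \<open>delimit x\<close> with the
  head at the origin in state 0, then \<open>L\<close> free cells for the certificate, blanks
  elsewhere. In row \<open>T\<close> the origin has to accept.\<close>

definition cell_class :: "bool list \<Rightarrow> nat \<Rightarrow> nat \<Rightarrow> nat \<Rightarrow> nat \<Rightarrow> tile_class" where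
  "cell_class x T L t i = (t = 0, t = T,
     if i = 0 \<or> i = 2 * T + 2 then Fixed (0, None)
     else if t = 0 then
       (if i < T + 1 then Fixed (0, None)
        else if i - (T + 1) < 2 * length x + 1
        then Fixed (tape_of (delimit x) (int (i - (T + 1))), if i = T + 1 then Some 0 else None)
        else if i - (T + 1) < 2 * length x + 1 + L then Certificate
        else Fixed (0, None))
     else if t = T \<and> i = T + 1 then Accepting else Any)"

lemma length_delimit: "length (delimit x) = 2 * length x + 1"
  by (induction x) (simp_all add: delimit_def)

text \<open>On the helix the neighbour of a border cell across the end of a row is a border cell of
  another row. Both are blank, and so is the tape position that the neighbour ought to show, so the
  jump goes unnoticed by the local rule.\<close>

lemma row_neighbours:
  fixes T :: nat and B :: "nat \<Rightarrow> label"
  defines "w \<equiv> 2 * T + 3"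
  defines "N \<equiv> (T + 1) * w"
  assumes v: "v < N" and border: "\<And>u. u < N \<Longrightarrow> u mod w = 0 \<or> u mod w = 2 * T + 2 \<Longrightarrow> B u = (0, None)"
    and row: "\<And>i. i < w \<Longrightarrow> B (v div w * w + i) = lab c (int i - int (T + 1))"
    and outside: "\<And>p. int (T + 1) \<le> \<bar>p\<bar> \<Longrightarrow> lab c p = (0, None)"
  shows "B ((v + 1) mod N) = lab c (int (v mod w) - int (T + 1) + 1)"
    and "B ((v + N - 1) mod N) = lab c (int (v mod w) - int (T + 1) - 1)"
proof -
  have w: "0 < w" and N: "0 < N" by (simp_all add: w_def N_def)
  define t i where "t = v div w" and "i = v mod w"
  have vti: "v = t * w + i" "i < w" using w by (simp_all add: t_def i_def)
  have t: "t \<le> T" using v w unfolding t_def N_def by (simp add: less_mult_imp_div_less less_Suc_eq_le[symmetric])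
  have dvd: "w dvd N" by (simp add: N_def)
  show "B ((v + 1) mod N) = lab c (int (v mod w) - int (T + 1) + 1)"
  proof (cases "i = 2 * T + 2")
    case True
    have "v + 1 = (t + 1) * w" using True vti by (simp add: w_def)
    then have "(v + 1) mod w = 0" by (metis mod_mult_self2_is_0)
    then have "(v + 1) mod N mod w = 0" using mod_mod_cancel[OF dvd] by metis
    then have "B ((v + 1) mod N) = (0, None)" using N by (intro border) auto
    moreover have "lab c (int (v mod w) - int (T + 1) + 1) = (0, None)"
      using True by (intro outside) (simp add: i_def)
    ultimately show ?thesis by simp
  next
    case False
    then have i: "i + 1 < w" using vti by (simp add: w_def)
    have "v + 1 < t * w + w" using i vti by simp
    also have "\<dots> = (t + 1) * w" by simp
    also have "\<dots> \<le> N" unfolding N_def using t by (intro mult_right_mono) auto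
    finally have "(v + 1) mod N = t * w + (i + 1)" using vti by simp
    then show ?thesis using row[OF i] by (simp add: t_def[symmetric] i_def[symmetric] algebra_simps)
  qed
  show "B ((v + N - 1) mod N) = lab c (int (v mod w) - int (T + 1) - 1)"
  proof (cases "i = 0")
    case True
    have "v + N - 1 = (w - 1) + (t + T) * w" using True vti w by (simp add: N_def algebra_simps)
    then have "(v + N - 1) mod w = (w - 1) mod w" by (metis mod_mult_self1)
    also have "\<dots> = 2 * T + 2" by (simp add: w_def)
    finally have "(v + N - 1) mod N mod w = 2 * T + 2" using mod_mod_cancel[OF dvd] by metis
    then have "B ((v + N - 1) mod N) = (0, None)" using N by (intro border) auto
    moreover have "lab c (int (v mod w) - int (T + 1) - 1) = (0, None)"
      using True by (intro outside) (simp add: i_def)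
    ultimately show ?thesis by simp
  next
    case False
    have "v + N - 1 = t * w + (i - 1) + N" using False vti by simp
    moreover have "t * w + (i - 1) < N" using v vti by simp
    ultimately have "(v + N - 1) mod N = t * w + (i - 1)" by simp
    moreover have "i - 1 < w" using vti by simp
    ultimately show ?thesis using row[of "i - 1"] False
      by (simp add: t_def[symmetric] i_def[symmetric] of_nat_diff algebra_simps)
  qed
qed

context finite_machine
begin

lemma lab_labels: "lab (config_at M u t) p \<in> labels"
proof (induction t arbitrary: p)
  case 0
  have "tape_of u p \<in> {0, 1, 2}" by (simp add: tape_of_def)
  then show ?case by (auto simp: config_at_def labels_def)
next
  case (Suc t)
  then show ?case unfolding config_at_Suc lab_next by (intro local_rule_labels)
qed

lemma cell_class_in: "cell_class x T L t i \<in> classes"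
proof -
  have "tape_of (delimit x) j \<in> {0, 1, 2}" for j by (simp add: tape_of_def)
  then have 1: "Fixed (tape_of (delimit x) j, if P then Some 0 else None) \<in> conditions" for j P
    unfolding conditions_def labels_def by (intro UnI2 imageI SigmaI UnI1) auto
  have 2: "Fixed (0, None) \<in> conditions" "Certificate \<in> conditions" "Accepting \<in> conditions" "Any \<in> conditions"
    unfolding conditions_def using blank_label by auto
  show ?thesis unfolding cell_class_def classes_def by (simp only: 1 2 mem_Times_iff fst_conv snd_conv UNIV_I simp_thms split: if_split)
qed

lemma accepting_labelling:
  fixes x :: "bool list" and T L :: nat
  defines "w \<equiv> 2 * T + 3"
  defines "N \<equiv> (T + 1) * w"
  assumes T: "2 * length x + 1 + L \<le> T" and y: "length y \<le> L"
    and acc: "fst (lab (config_at M (delimit x @ y) T) 0) = 2"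
  shows "labelling N w (\<lambda>v. cell_class x T L (v div w) (v mod w))
    (\<lambda>v. lab (config_at M (delimit x @ y) (v div w)) (int (v mod w) - int (T + 1)))"
proof -
  let ?u = "delimit x @ y"
  let ?k = "\<lambda>v. cell_class x T L (v div w) (v mod w)"
  define B where "B v = lab (config_at M ?u (v div w)) (int (v mod w) - int (T + 1))" for v
  have w: "0 < w" and N: "0 < N" by (simp_all add: w_def N_def)
  have len: "length ?u \<le> T" using T y by (simp add: length_delimit)
  have outside: "lab (config_at M ?u t) p = (0, None)" if "t \<le> T" "int (T + 1) \<le> \<bar>p\<bar>" for t p
    using that len by (intro lab_outside) auto
  have row: "v div w \<le> T" if "v < N" for v
    using that w unfolding N_def by (simp add: less_mult_imp_div_less less_Suc_eq_le[symmetric])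
  have border: "B u = (0, None)" if "u < N" "u mod w = 0 \<or> u mod w = 2 * T + 2" for u
    unfolding B_def using row[OF that(1)] that(2) by (intro outside) auto
  have "labelling N w ?k B"
    unfolding labelling_def
  proof (intro allI impI conjI)
    fix v assume v: "v < N"
    define t i where "t = v div w" and "i = v mod w"
    have vti: "v = t * w + i" "i < w" "t \<le> T" using w row[OF v] by (simp_all add: t_def i_def)
    let ?c = "config_at M ?u t" and ?p = "int i - int (T + 1)"
    have Bv: "B v = lab ?c ?p" by (simp add: B_def t_def i_def)
    have nb: "B ((v + 1) mod N) = lab ?c (?p + 1)" "B ((v + N - 1) mod N) = lab ?c (?p - 1)"
      using row_neighbours[where B = B and c = ?c and v = v and T = T, folded w_def, folded N_def, OF v border]
        outside[OF vti(3)] w by (simp_all add: B_def t_def i_def)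
    show "B v \<in> labels" unfolding Bv by (rule lab_labels)
    have init: "lab ?c q = (tape_of ?u q, if q = 0 then Some 0 else None)" if "t = 0" for q
      using that by (auto simp: config_at_def)
    show "satisfies (snd (snd (?k v))) (B v) (B ((v + 1) mod N))"
    proof (cases "i = 0 \<or> i = 2 * T + 2")
      case True
      then show ?thesis using border[OF v] by (simp add: cell_class_def i_def)
    next
      case inner: False
      show ?thesis
      proof (cases "t = 0")
        case t0: True
        show ?thesis
        proof (cases "i < T + 1")
          case True
          then have "lab ?c ?p = (0, None)" using init[OF t0, of ?p] by (auto simp: tape_of_def)
          then show ?thesis using True inner t0 Bv by (simp add: cell_class_def i_def[symmetric] t_def[symmetric])
        next
          case False
          define j where "j = i - (T + 1)"
          have p: "?p = int j" and ij: "i = T + 1 + j" using False by (simp_all add: j_def)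
          have Bj: "B v = (tape_of ?u (int j), if j = 0 then Some 0 else None)"
            unfolding Bv p using init[OF t0] by simp
          consider "j < 2 * length x + 1" | "2 * length x + 1 \<le> j" "j < 2 * length x + 1 + L" | "2 * length x + 1 + L \<le> j"
            by linarith
          then show ?thesis
          proof cases
            case 1
            then have "tape_of ?u (int j) = tape_of (delimit x) (int j)"
              by (simp add: tape_of_def length_delimit nth_append)
            then show ?thesis using 1 inner t0 Bj ij
              by (simp add: cell_class_def i_def[symmetric] t_def[symmetric])
          next
            case 2
            have "B ((v + 1) mod N) = (tape_of ?u (int j + 1), None)"
              unfolding nb p using init[OF t0, of "int j + 1"] by simp
            moreover have "tape_of ?u (int j) = 0 \<longrightarrow> tape_of ?u (int j + 1) = 0"
              by (auto simp: tape_of_def nat_add_distrib)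
            moreover have "tape_of ?u (int j) \<in> {0, 1, 2}" by (simp add: tape_of_def)
            ultimately show ?thesis using 2 inner t0 Bj ij
              by (auto simp: cell_class_def i_def[symmetric] t_def[symmetric])
          next
            case 3
            then have "tape_of ?u (int j) = 0" using y by (simp add: tape_of_def length_delimit)
            then show ?thesis using 3 inner t0 Bj ij
              by (simp add: cell_class_def i_def[symmetric] t_def[symmetric])
          qed
        qed
      next
        case False
        then show ?thesis using inner acc Bv
          by (simp add: cell_class_def i_def[symmetric] t_def[symmetric])
      qed
    qed
    show "(if fst (snd (?k v)) then None else Some (local_rule M (B ((v + N - 1) mod N)) (B v) (B ((v + 1) mod N)))) =
        (if fst (?k ((v + w) mod N)) then None else Some (B ((v + w) mod N)))"
    proof (cases "t = T")
      case True
      \<comment> \<open>Below row \<open>T\<close> comes row 0, where both sides are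
        \<open>None\<close>.\<close>
      then have "(v + w) mod N = i" using vti by (simp add: N_def w_def algebra_simps)
      then show ?thesis using True vti(2) by (simp add: cell_class_def t_def)
    next
      case False
      have eq: "v + w = (t + 1) * w + i" using vti by simp
      have "(t + 1) * w + i < (t + 2) * w" using vti by simp
      also have "\<dots> \<le> N" unfolding N_def using False vti(3) by (intro mult_right_mono) auto
      finally have m: "(v + w) mod N = (t + 1) * w + i" by (simp add: eq)
      have "(r * w + i) div w = r" "(r * w + i) mod w = i" for r using vti(2) w by simp_all
      note dm = this[of "t + 1"]
      have "B ((t + 1) * w + i) = local_rule M (lab ?c (?p - 1)) (lab ?c ?p) (lab ?c (?p + 1))"
        unfolding B_def dm using lab_next[of M ?c ?p] by (simp add: config_at_Suc)
      then show ?thesis unfolding m dm nb Bv using False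
        by (simp add: cell_class_def t_def[symmetric])
    qed
  qed
  then show ?thesis unfolding B_def .
qed

text \<open>Row 0 is fixed up to the certificate cells, from which \<open>y\<close> is read off. The
  local rule and the blank borders then make row after row the next configuration on
  \<open>delimit x @ y\<close>.\<close>

lemma labelling_accepting:
  fixes x :: "bool list" and T L :: nat
  defines "w \<equiv> 2 * T + 3"
  defines "N \<equiv> (T + 1) * w"
  assumes T: "2 * length x + 1 + L \<le> T"
    and B: "labelling N w (\<lambda>v. cell_class x T L (v div w) (v mod w)) B"
  shows "\<exists>y. length y \<le> L \<and> fst (lab (config_at M (delimit x @ y) T) 0) = 2"
proof -
  let ?k = "\<lambda>v. cell_class x T L (v div w) (v mod w)"
  have w: "0 < w" and N: "0 < N" by (simp_all add: w_def N_def)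
  \<comment> \<open>Otherwise row 0 would also be the last row, and its initial conditions would
    take the place of \<open>Accepting\<close>.\<close>
  have T1: "1 \<le> T" using T by simp
  have cell: "t * w + i < N" if "t \<le> T" "i < w" for t i
  proof -
    have "t * w + i < (t + 1) * w" using that by simp
    also have "\<dots> \<le> N" unfolding N_def using that by (intro mult_right_mono) auto
    finally show ?thesis .
  qed
  have dm: "(t * w + i) div w = t" "(t * w + i) mod w = i" if "i < w" for t i using that w by simp_all
  have sat: "satisfies (snd (snd (cell_class x T L t i))) (B (t * w + i)) (B ((t * w + i + 1) mod N))"
    if "t \<le> T" "i < w" for t i
    using B cell[OF that] dm[OF that(2)] unfolding labelling_def by metis
  have border: "B u = (0, None)" if "u < N" "u mod w = 0 \<or> u mod w = 2 * T + 2" for u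
  proof -
    have "satisfies (snd (snd (?k u))) (B u) (B ((u + 1) mod N))" using B that(1) unfolding labelling_def by blast
    then show ?thesis using that(2) by (simp add: cell_class_def)
  qed
  define sy where "sy j = fst (B (T + 1 + (2 * length x + 1) + j))" for j
  \<comment> \<open>The certificate ends at its first blank, or after \<open>L\<close> cells if none
    of them is blank.\<close>
  define p where "p = (LEAST j. L \<le> j \<or> sy j = 0)"
  define y where "y = map (\<lambda>j. sy j = 2) [0..<p]"
  have p_le: "p \<le> L" unfolding p_def by (rule Least_le) simp
  have p_prop: "L \<le> p \<or> sy p = 0" unfolding p_def by (rule LeastI[of _ L]) simp
  have p_min: "sy j \<noteq> 0" if "j < p" for j using not_less_Least[OF that[unfolded p_def]] by simp
  have cert: "B (T + 1 + (2 * length x + 1) + j) = (sy j, None) \<and> sy j \<in> {0, 1, 2} \<and> (sy j = 0 \<longrightarrow> B (T + 1 + (2 * length x + 1) + Suc j) = (0, None))"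
    if "j < L" for j
  proof -
    let ?i = "T + 1 + (2 * length x + 1) + j"
    have i: "?i < w" "?i + 1 < w" "?i \<noteq> 2 * T + 2" using that T by (simp_all add: w_def)
    have "(0 * w + ?i + 1) mod N = ?i + 1" using cell[of 0 "?i + 1"] i by simp
    then have "satisfies Certificate (B ?i) (B (?i + 1))"
      using sat[of 0 ?i] i that T1 by (simp add: cell_class_def)
    then show ?thesis unfolding sy_def by auto
  qed
  have zero: "sy j = 0" if "p \<le> j" "j < L" for j
    using that
  proof (induction j rule: dec_induct)
    case base
    then show ?case using p_prop by simp
  next
    case (step j)
    then have "B (T + 1 + (2 * length x + 1) + Suc j) = (0, None)" using cert[of j] by simp
    then show ?case by (simp add: sy_def)
  qed
  have sy_tape: "sy j = tape_of y (int j)" if "j < L" for j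
  proof (cases "j < p")
    case True
    then show ?thesis using p_min[OF True] cert[OF that] by (auto simp: tape_of_def y_def)
  next
    case False
    then show ?thesis using zero[of j] that by (simp add: tape_of_def y_def)
  qed
  have leny: "length y \<le> L" using p_le by (simp add: y_def)
  let ?u = "delimit x @ y"
  have len: "length ?u \<le> T" using T leny by (simp add: length_delimit)
  have outside: "lab (config_at M ?u t) q = (0, None)" if "t \<le> T" "int (T + 1) \<le> \<bar>q\<bar>" for t q
    using that len by (intro lab_outside) auto
  have rows: "\<forall>i<w. B (t * w + i) = lab (config_at M ?u t) (int i - int (T + 1))" if "t \<le> T" for t
    using that
  proof (induction t)
    case 0
    have init: "lab (config_at M ?u 0) q = (tape_of ?u q, if q = 0 then Some 0 else None)" for q
      by (auto simp: config_at_def)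
    show ?case
    proof (intro allI impI)
      fix i assume i: "i < w"
      show "B (0 * w + i) = lab (config_at M ?u 0) (int i - int (T + 1))"
      proof (cases "i = 0 \<or> i = 2 * T + 2")
        case True
        then have "B i = (0, None)" using border[of i] cell[of 0 i] i by simp
        moreover have "lab (config_at M ?u 0) (int i - int (T + 1)) = (0, None)"
          using True by (intro outside) auto
        ultimately show ?thesis by simp
      next
        case inner: False
        note s = sat[of 0 i, OF _ i]
        show ?thesis
        proof (cases "i < T + 1")
          case True
          then have "B i = (0, None)" using s inner by (simp add: cell_class_def)
          then show ?thesis using True init by (auto simp: tape_of_def)
        next
          case False
          define j where "j = i - (T + 1)"
          have q: "int i - int (T + 1) = int j" and ij: "i = T + 1 + j" using False by (simp_all add: j_def)
          have R: "lab (config_at M ?u 0) (int j) = (tape_of ?u (int j), if j = 0 then Some 0 else None)"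
            using init[of "int j"] by simp
          consider "j < 2 * length x + 1" | "2 * length x + 1 \<le> j" "j < 2 * length x + 1 + L" | "2 * length x + 1 + L \<le> j"
            by linarith
          then show ?thesis unfolding q R
          proof cases
            case 1
            then have "tape_of ?u (int j) = tape_of (delimit x) (int j)"
              by (simp add: tape_of_def length_delimit nth_append)
            then show "B (0 * w + i) = (tape_of ?u (int j), if j = 0 then Some 0 else None)"
              using 1 s inner ij by (simp add: cell_class_def)
          next
            case 2
            define l where "l = j - (2 * length x + 1)"
            have l: "j = 2 * length x + 1 + l" "l < L" using 2 by (simp_all add: l_def)
            have "B i = (sy l, None)" using cert[OF l(2)] ij l(1) by (simp add: add.assoc)
            moreover have "tape_of ?u (int j) = tape_of y (int l)"
              unfolding tape_of_int using l by (simp add: length_delimit nth_append)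
            ultimately show "B (0 * w + i) = (tape_of ?u (int j), if j = 0 then Some 0 else None)"
              using sy_tape[OF l(2)] l(1) by simp
          next
            case 3
            then have "tape_of ?u (int j) = 0" using leny by (simp add: tape_of_def length_delimit)
            then show "B (0 * w + i) = (tape_of ?u (int j), if j = 0 then Some 0 else None)"
              using 3 s inner ij by (simp add: cell_class_def)
          qed
        qed
      qed
    qed
  next
    case (Suc t)
    then have IH: "B (t * w + i) = lab (config_at M ?u t) (int i - int (T + 1))" if "i < w" for i using that by simp
    have t: "t < T" "t \<le> T" using Suc.prems by simp_all
    show ?case
    proof (intro allI impI)
      fix i assume i: "i < w"
      let ?v = "t * w + i" and ?c = "config_at M ?u t" and ?p = "int i - int (T + 1)"
      have v: "?v < N" by (rule cell[OF t(2) i])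
      have nb: "B ((?v + 1) mod N) = lab ?c (?p + 1)" "B ((?v + N - 1) mod N) = lab ?c (?p - 1)"
        using row_neighbours[where B = B and c = ?c and v = ?v and T = T, folded w_def, folded N_def, OF v border]
          outside[OF t(2)] IH dm[OF i] by simp_all
      have m: "(?v + w) mod N = Suc t * w + i"
        using cell[of "Suc t" i] t i by (simp add: algebra_simps)
      have "(if fst (snd (?k ?v)) then None else Some (local_rule M (B ((?v + N - 1) mod N)) (B ?v) (B ((?v + 1) mod N)))) =
        (if fst (?k ((?v + w) mod N)) then None else Some (B ((?v + w) mod N)))"
        using B v unfolding labelling_def by blast
      then have "local_rule M (lab ?c (?p - 1)) (lab ?c ?p) (lab ?c (?p + 1)) = B (Suc t * w + i)"
        unfolding m dm[OF i] nb IH[OF i] using t by (simp add: cell_class_def)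
      then show "B (Suc t * w + i) = lab (config_at M ?u (Suc t)) ?p"
        unfolding config_at_Suc lab_next by simp
    qed
  qed
  have "T + 1 < w" by (simp add: w_def)
  then have final: "B (T * w + (T + 1)) = lab (config_at M ?u T) 0" using rows[OF order_refl, rule_format, of "T + 1"] by simp
  have "satisfies Accepting (B (T * w + (T + 1))) (B ((T * w + (T + 1) + 1) mod N))"
    using sat[of T "T + 1"] T1 by (simp add: cell_class_def w_def)
  then show ?thesis using leny final by (intro exI[of _ y]) auto
qed

end

section \<open>Counter programs on a Turing machine\<close>

inductive reach :: "machine \<Rightarrow> config \<Rightarrow> nat \<Rightarrow> config \<Rightarrow> bool" for M where
  reach_refl: "reach M c 0 c"
| reach_step: "step M c = Some c' \<Longrightarrow> reach M c' n c'' \<Longrightarrow> reach M c (Suc n) c''"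

lemma reach_trans: "reach M a m b \<Longrightarrow> reach M b n c \<Longrightarrow> reach M a (m + n) c"
  by (induction rule: reach.induct) (auto intro: reach.intros)

lemma reach_runs: "reach M a n b \<Longrightarrow> step M b = None \<Longrightarrow> runs M a n b"
  by (induction rule: reach.induct) (auto intro: runs.intros)

lemma reach_one: "M (q, t h) = Some (q', a, m) \<Longrightarrow> reach M (q, h, t) 1 (q', h + shift m, t(h := a))"
  using reach_step[OF _ reach_refl, of M "(q, h, t)"] by simp

lemma reach_one':
  assumes "M (q, t h) = Some (q', a, m)" "h' = h + shift m" "t' = t(h := a)"
  shows "reach M (q, h, t) 1 (q', h', t')"
  using reach_one[of M q t h] assms by simp

lemma reach_right:
  assumes "\<And>i. h \<le> i \<Longrightarrow> i < h + int d \<Longrightarrow> M (q, t i) = Some (q, t i, Move_Right)"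
  shows "reach M (q, h, t) d (q, h + int d, t)"
  using assms
proof (induction d arbitrary: h)
  case 0
  then show ?case by (simp add: reach_refl)
next
  case (Suc d)
  have "reach M (q, h, t) 1 (q, h + 1, t)"
    by (rule reach_one') (use Suc.prems[of h] in auto)
  moreover have "reach M (q, h + 1, t) d (q, (h + 1) + int d, t)"
    by (rule Suc.IH) (use Suc.prems in auto)
  ultimately show ?case
    using reach_trans by (fastforce simp: algebra_simps)
qed

lemma reach_left:
  assumes "\<And>i. h < i \<Longrightarrow> i \<le> h + int d \<Longrightarrow> M (q, t i) = Some (q, t i, Move_Left)"
  shows "reach M (q, h + int d, t) d (q, h, t)"
  using assms
proof (induction d)
  case 0
  then show ?case by (simp add: reach_refl)
next
  case (Suc d)
  have "reach M (q, h + int (Suc d), t) 1 (q, h + int d, t)"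
    by (rule reach_one') (use Suc.prems[of "h + int (Suc d)"] in auto)
  moreover have "reach M (q, h + int d, t) d (q, h, t)"
    by (rule Suc.IH) (use Suc.prems in auto)
  ultimately show ?case
    using reach_trans by fastforce
qed

text \<open>A tape symbol packs four tracks: an input symbol, a flag for cell 0, an output symbol and the
  set of registers whose value is the index of the cell. The input symbols themselves are the
  symbols whose other tracks are empty.\<close>

definition sym :: "nat \<Rightarrow> bool \<Rightarrow> nat \<Rightarrow> nat set \<Rightarrow> nat" where
  "sym a z u S = a + 3 * prod_encode (u, prod_encode (of_bool z, set_encode S))"

definition s_in :: "nat \<Rightarrow> nat" where "s_in s = s mod 3"
definition s_out :: "nat \<Rightarrow> nat" where "s_out s = fst (prod_decode (s div 3))"
definition s_zero :: "nat \<Rightarrow> bool" where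
  "s_zero s \<longleftrightarrow> fst (prod_decode (snd (prod_decode (s div 3)))) = 1"
definition s_marks :: "nat \<Rightarrow> nat set" where
  "s_marks s = set_decode (snd (prod_decode (snd (prod_decode (s div 3)))))"

lemma sym_simps [simp]:
  assumes "a < 3" "finite S"
  shows "s_in (sym a z u S) = a" "s_out (sym a z u S) = u" "s_zero (sym a z u S) = z"
    "s_marks (sym a z u S) = S"
  using assms by (auto simp: sym_def s_in_def s_out_def s_zero_def s_marks_def)

lemma sym_raw: "sym a False 0 {} = a"
  by (simp add: sym_def prod_encode_def)

definition unmark :: "nat \<Rightarrow> nat \<Rightarrow> nat" where
  "unmark r s = sym (s_in s) (s_zero s) (s_out s) (s_marks s - {r})"
definition mark :: "nat \<Rightarrow> nat \<Rightarrow> nat" where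
  "mark r s = sym (s_in s) (s_zero s) (s_out s) (insert r (s_marks s))"
definition put :: "bool \<Rightarrow> nat \<Rightarrow> nat" where
  "put b s = sym (s_in s) (s_zero s) (if b then 2 else 1) (s_marks s)"

definition symbols :: "nat \<Rightarrow> nat set" where
  "symbols R = (\<lambda>(a, z, u, S). sym a z u S) ` ({..<3} \<times> UNIV \<times> {..<3} \<times> Pow {..<R})"

lemma finite_symbols: "finite (symbols R)"
  unfolding symbols_def by (intro finite_imageI finite_cartesian_product) auto

lemma symbols_I: "a < 3 \<Longrightarrow> u < 3 \<Longrightarrow> S \<subseteq> {..<R} \<Longrightarrow> sym a z u S \<in> symbols R"
  unfolding symbols_def by (rule image_eqI[of _ _ "(a, z, u, S)"]) auto

definition cells :: "nat \<Rightarrow> bool list \<Rightarrow> (nat \<Rightarrow> nat) \<Rightarrow> bool list \<Rightarrow> int \<Rightarrow> nat" where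
  "cells R x \<sigma> u i = sym (tape_of x i) (i = 0) (tape_of u i) {r. r < R \<and> int (\<sigma> r) = i}"

lemma tape_of_less: "tape_of x i < 3"
  by (simp add: tape_of_def)

lemma cells_simps [simp]:
  "s_in (cells R x \<sigma> u i) = tape_of x i" "s_out (cells R x \<sigma> u i) = tape_of u i"
  "s_zero (cells R x \<sigma> u i) \<longleftrightarrow> i = 0" "s_marks (cells R x \<sigma> u i) = {r. r < R \<and> int (\<sigma> r) = i}"
  by (simp_all add: cells_def tape_of_less)

lemma cells_symbols [simp]: "cells R x \<sigma> u i \<in> symbols R"
  unfolding cells_def by (intro symbols_I tape_of_less) auto

section \<open>Counter commands and their machine code\<close>

datatype test = Is_Zero nat | Is_Input nat nat

datatype com = Skip | Inc nat | Dec nat | Out bool | Seq com com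
  | Branch test com com | Until test com

fun test_reg :: "test \<Rightarrow> nat" where
  "test_reg (Is_Zero r) = r"
| "test_reg (Is_Input r a) = r"

fun test_sym :: "test \<Rightarrow> nat \<Rightarrow> bool" where
  "test_sym (Is_Zero r) s = s_zero s"
| "test_sym (Is_Input r a) s = (s_in s = a)"

fun holds :: "bool list \<Rightarrow> (nat \<Rightarrow> nat) \<Rightarrow> test \<Rightarrow> bool" where
  "holds x \<sigma> (Is_Zero r) = (\<sigma> r = 0)"
| "holds x \<sigma> (Is_Input r a) = (tape_of x (int (\<sigma> r)) = a)"

inductive big :: "bool list \<Rightarrow> com \<Rightarrow> (nat \<Rightarrow> nat) \<Rightarrow> bool list \<Rightarrow> nat \<Rightarrow> (nat \<Rightarrow> nat) \<Rightarrow> bool list \<Rightarrow> bool"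
  for x where
  big_Skip: "big x Skip \<sigma> u 0 \<sigma> u"
| big_Inc: "big x (Inc r) \<sigma> u 1 (\<sigma>(r := \<sigma> r + 1)) u"
| big_Dec: "big x (Dec r) \<sigma> u 1 (\<sigma>(r := \<sigma> r - 1)) u"
| big_Out: "big x (Out b) \<sigma> u 1 \<sigma> (u @ [b])"
| big_Seq: "big x c \<sigma> u t \<sigma>' u' \<Longrightarrow> big x d \<sigma>' u' t' \<sigma>'' u'' \<Longrightarrow> big x (Seq c d) \<sigma> u (t + t') \<sigma>'' u''"
| big_True: "holds x \<sigma> b \<Longrightarrow> big x c \<sigma> u t \<sigma>' u' \<Longrightarrow> big x (Branch b c d) \<sigma> u (t + 1) \<sigma>' u'"
| big_False: "\<not> holds x \<sigma> b \<Longrightarrow> big x d \<sigma> u t \<sigma>' u' \<Longrightarrow> big x (Branch b c d) \<sigma> u (t + 1) \<sigma>' u'"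
| big_Exit: "holds x \<sigma> b \<Longrightarrow> big x (Until b c) \<sigma> u 1 \<sigma> u"
| big_Loop: "\<not> holds x \<sigma> b \<Longrightarrow> big x c \<sigma> u t \<sigma>' u' \<Longrightarrow> big x (Until b c) \<sigma>' u' t' \<sigma>'' u'' \<Longrightarrow>
    big x (Until b c) \<sigma> u (t + t' + 1) \<sigma>'' u''"

fun regs_below :: "nat \<Rightarrow> com \<Rightarrow> bool" where
  "regs_below R Skip \<longleftrightarrow> True"
| "regs_below R (Inc r) \<longleftrightarrow> r < R"
| "regs_below R (Dec r) \<longleftrightarrow> r < R"
| "regs_below R (Out b) \<longleftrightarrow> True"
| "regs_below R (Seq c d) \<longleftrightarrow> regs_below R c \<and> regs_below R d"
| "regs_below R (Branch b c d) \<longleftrightarrow> test_reg b < R \<and> regs_below R c \<and> regs_below R d"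
| "regs_below R (Until b c) \<longleftrightarrow> test_reg b < R \<and> regs_below R c"

lemma regs_below_mono: "regs_below R c \<Longrightarrow> R \<le> R' \<Longrightarrow> regs_below R' c"
  by (induction c) auto

lemma regs_below_ex: "\<exists>R. regs_below R c"
proof (induction c)
  case (Seq c d)
  then obtain R R' where "regs_below R c" "regs_below R' d" by blast
  then have "regs_below (max R R') (Seq c d)" by (auto intro: regs_below_mono)
  then show ?case by blast
next
  case (Branch b c d)
  then obtain R R' where "regs_below R c" "regs_below R' d" by blast
  then have "regs_below (max (Suc (test_reg b)) (max R R')) (Branch b c d)"
    by (auto intro: regs_below_mono)
  then show ?case by blast
next
  case (Until b c)
  then obtain R where "regs_below R c" by blast
  then have "regs_below (max (Suc (test_reg b)) R) (Until b c)"
    by (auto intro: regs_below_mono)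
  then show ?case by blast
qed auto

text \<open>A unit of time adds at most one to a register or to the output, so the running time also
  bounds the stretch of tape in use.\<close>

lemma big_growth: "big x c \<sigma> u t \<sigma>' u' \<Longrightarrow> \<sigma>' r \<le> \<sigma> r + t \<and> length u' \<le> length u + t"
  by (induction rule: big.induct) auto

fun code_size :: "com \<Rightarrow> nat" where
  "code_size Skip = 0"
| "code_size (Inc r) = 3"
| "code_size (Dec r) = 3"
| "code_size (Out b) = 2"
| "code_size (Seq c d) = code_size c + code_size d"
| "code_size (Branch b c d) = 4 + code_size c + code_size d"
| "code_size (Until b c) = 4 + code_size c"

text \<open>Every command starts and ends with the head on cell 0, which is recognised by its
  flag.\<close>

definition rewind :: "nat \<Rightarrow> nat \<Rightarrow> nat \<Rightarrow> (nat \<times> nat \<times> move) option" where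
  "rewind q q' s = Some (if s_zero s then (q', s, Move_None) else (q, s, Move_Left))"

definition branch_code :: "test \<Rightarrow> nat \<Rightarrow> nat \<Rightarrow> nat \<Rightarrow> nat \<Rightarrow> nat \<Rightarrow> (nat \<times> nat \<times> move) option" where
  "branch_code b p l l' q s =
     (if q = p then
        Some (if test_reg b \<in> s_marks s
              then (if test_sym b s then p + 1 else p + 2, s, Move_None) else (p, s, Move_Right))
      else if q = p + 1 then rewind q l s else rewind q l' s)"

text \<open>The code of \<open>c\<close> uses the states from \<open>p\<close> to
  \<open>p + code_size c - 1\<close> and is left in state \<open>p + code_size c\<close>. Changing a
  register moves its mark by one cell; \<open>Dec\<close> leaves a mark on cell 0 in place. The
  state after the body of \<open>Branch\<close> jumps over the other branch, the one after the body
  of \<open>Until\<close> jumps back to the test.\<close>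

fun code :: "com \<Rightarrow> nat \<Rightarrow> nat \<Rightarrow> nat \<Rightarrow> (nat \<times> nat \<times> move) option" where
  "code Skip p q s = None"
| "code (Inc r) p q s =
     (if q = p then
        Some (if r \<in> s_marks s then (p + 1, unmark r s, Move_Right) else (p, s, Move_Right))
      else if q = p + 1 then Some (p + 2, mark r s, Move_None) else rewind q (p + 3) s)"
| "code (Dec r) p q s =
     (if q = p then
        Some (if r \<in> s_marks s
              then if s_zero s then (p + 2, s, Move_None) else (p + 1, unmark r s, Move_Left)
              else (p, s, Move_Right))
      else if q = p + 1 then Some (p + 2, mark r s, Move_None) else rewind q (p + 3) s)"
| "code (Out b) p q s =
     (if q = p then Some (if s_out s = 0 then (p + 1, put b s, Move_None) else (p, s, Move_Right))
      else rewind q (p + 2) s)"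
| "code (Seq c d) p q s =
     (if q < p + code_size c then code c p q s else code d (p + code_size c) q s)"
| "code (Branch b c d) p q s =
     (if q < p + 3 then branch_code b p (p + 3) (p + 4 + code_size c) q s
      else if q < p + 3 + code_size c then code c (p + 3) q s
      else if q = p + 3 + code_size c
      then Some (p + 4 + code_size c + code_size d, s, Move_None)
      else code d (p + 4 + code_size c) q s)"
| "code (Until b c) p q s =
     (if q < p + 3 then branch_code b p (p + 4 + code_size c) (p + 3) q s
      else if q < p + 3 + code_size c then code c (p + 3) q s
      else Some (p, s, Move_None))"

definition agrees :: "nat \<Rightarrow> machine \<Rightarrow> com \<Rightarrow> nat \<Rightarrow> bool" where
  "agrees R M c p \<longleftrightarrow>
     (\<forall>q s. p \<le> q \<longrightarrow> q < p + code_size c \<longrightarrow> s \<in> symbols R \<longrightarrow> M (q, s) = code c p q s)"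

lemma agreesD:
  "agrees R M c p \<Longrightarrow> p \<le> q \<Longrightarrow> q < p + code_size c \<Longrightarrow> s \<in> symbols R \<Longrightarrow> M (q, s) = code c p q s"
  unfolding agrees_def by blast

lemma reach_rewind:
  assumes "\<And>s. s \<in> symbols R \<Longrightarrow> M (q, s) = rewind q q' s"
  shows "reach M (q, int h, cells R x \<sigma> u) (h + 1) (q', 0, cells R x \<sigma> u)"
proof -
  have "reach M (q, 0 + int h, cells R x \<sigma> u) h (q, 0, cells R x \<sigma> u)"
    by (rule reach_left) (simp add: assms rewind_def)
  moreover have "reach M (q, 0, cells R x \<sigma> u) 1 (q', 0, cells R x \<sigma> u)"
    by (rule reach_one') (auto simp: assms rewind_def)
  ultimately show ?thesis using reach_trans by fastforce
qed

lemma reach_find: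
  assumes "\<And>s. s \<in> symbols R \<Longrightarrow> r \<notin> s_marks s \<Longrightarrow> M (q, s) = Some (q, s, Move_Right)"
  shows "reach M (q, 0, cells R x \<sigma> u) (\<sigma> r) (q, int (\<sigma> r), cells R x \<sigma> u)"
proof -
  have "reach M (q, 0, cells R x \<sigma> u) (\<sigma> r) (q, 0 + int (\<sigma> r), cells R x \<sigma> u)"
    by (rule reach_right) (simp add: assms)
  then show ?thesis by simp
qed

lemma cells_move:
  assumes "r < R" "h \<noteq> \<sigma> r"
  shows "(cells R x \<sigma> u)(int (\<sigma> r) := unmark r (cells R x \<sigma> u (int (\<sigma> r))),
      int h := mark r (cells R x \<sigma> u (int h))) = cells R x (\<sigma>(r := h)) u"
proof
  fix i
  show "((cells R x \<sigma> u)(int (\<sigma> r) := unmark r (cells R x \<sigma> u (int (\<sigma> r))),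
      int h := mark r (cells R x \<sigma> u (int h)))) i = cells R x (\<sigma>(r := h)) u i"
    using assms unfolding cells_def
    by (auto simp: unmark_def mark_def tape_of_less intro!: arg_cong[where f = "sym _ _ _"])
qed

lemma cells_put:
  "(cells R x \<sigma> u)(int (length u) := put b (cells R x \<sigma> u (int (length u)))) = cells R x \<sigma> (u @ [b])"
  by (auto simp: fun_eq_iff cells_def put_def tape_of_less)
     (auto simp: tape_of_def nth_append intro!: arg_cong[where f = "\<lambda>a. sym _ _ a _"])

lemma reach_test:
  assumes "\<And>q s. p \<le> q \<Longrightarrow> q < p + 3 \<Longrightarrow> s \<in> symbols R \<Longrightarrow> M (q, s) = branch_code b p l l' q s"
    and "test_reg b < R" "\<sigma> (test_reg b) \<le> S"
  shows "\<exists>n\<le>2 * S + 2. reach M (p, 0, cells R x \<sigma> u) n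
           (if holds x \<sigma> b then l else l', 0, cells R x \<sigma> u)"
proof -
  let ?r = "test_reg b" and ?c = "cells R x \<sigma> u"
  let ?q = "if holds x \<sigma> b then p + 1 else p + 2"
  have 1: "reach M (p, 0, ?c) (\<sigma> ?r) (p, int (\<sigma> ?r), ?c)"
    by (rule reach_find) (simp add: assms branch_code_def)
  have "holds x \<sigma> b \<longleftrightarrow> test_sym b (?c (int (\<sigma> ?r)))"
    by (cases b) auto
  then have 2: "reach M (p, int (\<sigma> ?r), ?c) 1 (?q, int (\<sigma> ?r), ?c)"
    by (intro reach_one') (use assms(2) in \<open>auto simp: assms(1) branch_code_def\<close>)
  have 3: "reach M (?q, int (\<sigma> ?r), ?c) (\<sigma> ?r + 1) (if holds x \<sigma> b then l else l', 0, ?c)"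
    by (rule reach_rewind) (auto simp: assms(1) branch_code_def)
  show ?thesis
    using reach_trans[OF reach_trans[OF 1 2] 3] assms(3) by (intro exI[of _ "\<sigma> ?r + 1 + (\<sigma> ?r + 1)"]) auto
qed

text \<open>\<open>S\<close> bounds all head positions. It is required to exceed each register and
  the output by the time still to be spent, a condition that \<open>big_growth\<close> carries from
  one command to the next. A unit of time costs at most a walk to a cell up to \<open>S\<close> and
  back, plus a constant.\<close>

lemma simulate:
  assumes "big x c \<sigma> u t \<sigma>' u'"
    and "regs_below R c" "agrees R M c p" "\<And>r. r < R \<Longrightarrow> \<sigma> r + t \<le> S" "length u + t \<le> S"
  shows "\<exists>n\<le>t * (2 * S + 6). reach M (p, 0, cells R x \<sigma> u) n (p + code_size c, 0, cells R x \<sigma>' u')"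
  using assms
proof (induction arbitrary: p rule: big.induct)
  case (big_Skip \<sigma> u)
  then show ?case by (auto intro: reach_refl)
next
  case (big_Inc r \<sigma> u)
  note M = agreesD[OF big_Inc.prems(2)]
  let ?c = "cells R x \<sigma> u" and ?h = "\<sigma> r"
  let ?c1 = "?c(int ?h := unmark r (?c (int ?h)))"
  let ?c2 = "cells R x (\<sigma>(r := ?h + 1)) u"
  have c2: "?c2 = ?c1(int (?h + 1) := mark r (?c (int (?h + 1))))"
    using cells_move[of r R "?h + 1" \<sigma> x u] big_Inc.prems(1) by simp
  have "reach M (p, 0, ?c) ?h (p, int ?h, ?c)"
    by (rule reach_find) (simp add: M)
  moreover have "reach M (p, int ?h, ?c) 1 (p + 1, int ?h + 1, ?c1)"
    using big_Inc.prems(1) by (intro reach_one'[of _ _ _ _ _ "unmark r (?c (int ?h))" Move_Right]) (auto simp: M)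
  moreover have "reach M (p + 1, int ?h + 1, ?c1) 1 (p + 2, int (?h + 1), ?c2)"
  proof (rule reach_one'[where m = Move_None])
    show "M (p + 1, ?c1 (int ?h + 1)) = Some (p + 2, mark r (?c (int ?h + 1)), Move_None)"
      by (simp add: M)
    show "?c2 = ?c1(int ?h + 1 := mark r (?c (int ?h + 1)))"
      using c2 by (simp add: add.commute)
  qed simp
  moreover have "reach M (p + 2, int (?h + 1), ?c2) (?h + 1 + 1) (p + 3, 0, ?c2)"
    by (rule reach_rewind) (simp add: M)
  ultimately have "reach M (p, 0, ?c) (?h + 1 + 1 + (?h + 1 + 1)) (p + 3, 0, ?c2)"
    using reach_trans by blast
  moreover have "?h + 1 + 1 + (?h + 1 + 1) \<le> 1 * (2 * S + 6)"
    using big_Inc.prems(1) big_Inc.prems(3)[of r] by simp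
  ultimately show ?case unfolding code_size.simps by blast
next
  case (big_Dec r \<sigma> u)
  note M = agreesD[OF big_Dec.prems(2)]
  let ?c = "cells R x \<sigma> u" and ?h = "\<sigma> r"
  have 0: "reach M (p, 0, ?c) ?h (p, int ?h, ?c)"
    by (rule reach_find) (simp add: M)
  show ?case
  proof (cases "\<sigma> r = 0")
    case True
    have "reach M (p, int ?h, ?c) 1 (p + 2, int 0, ?c)"
      using big_Dec.prems(1) True by (intro reach_one') (auto simp: M)
    moreover have "reach M (p + 2, int 0, ?c) (0 + 1) (p + 3, 0, ?c)"
      by (rule reach_rewind) (simp add: M)
    ultimately have "reach M (p, 0, ?c) (?h + 1 + (0 + 1)) (p + 3, 0, ?c)"
      using 0 reach_trans by blast
    moreover have "\<sigma>(r := \<sigma> r - 1) = \<sigma>" using True by auto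
    moreover have "?h + 1 + (0 + 1) \<le> 1 * (2 * S + 6)" using True by simp
    ultimately show ?thesis unfolding code_size.simps by metis
  next
    case False
    let ?c1 = "?c(int ?h := unmark r (?c (int ?h)))"
    let ?c2 = "cells R x (\<sigma>(r := ?h - 1)) u"
    have c2: "?c2 = ?c1(int (?h - 1) := mark r (?c (int (?h - 1))))"
      using cells_move[of r R "?h - 1" \<sigma> x u] big_Dec.prems(1) False by simp
    have "reach M (p, int ?h, ?c) 1 (p + 1, int (?h - 1), ?c1)"
      using big_Dec.prems(1) False
      by (intro reach_one'[of _ _ _ _ _ "unmark r (?c (int ?h))" Move_Left]) (auto simp: M)
    moreover have "reach M (p + 1, int (?h - 1), ?c1) 1 (p + 2, int (?h - 1), ?c2)"
    proof (rule reach_one'[where m = Move_None])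
      show "M (p + 1, ?c1 (int (?h - 1))) = Some (p + 2, mark r (?c (int (?h - 1))), Move_None)"
        using False by (simp add: M)
      show "?c2 = ?c1(int (?h - 1) := mark r (?c (int (?h - 1))))" by (rule c2)
    qed simp
    moreover have "reach M (p + 2, int (?h - 1), ?c2) (?h - 1 + 1) (p + 3, 0, ?c2)"
      by (rule reach_rewind) (simp add: M)
    ultimately have "reach M (p, 0, ?c) (?h + 1 + 1 + (?h - 1 + 1)) (p + 3, 0, ?c2)"
      using 0 reach_trans by blast
    moreover have "?h + 1 + 1 + (?h - 1 + 1) \<le> 1 * (2 * S + 6)"
      using big_Dec.prems(1) big_Dec.prems(3)[of r] by simp
    ultimately show ?thesis unfolding code_size.simps by blast
  qed
next
  case (big_Out b \<sigma> u)
  note M = agreesD[OF big_Out.prems(2)]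
  let ?c = "cells R x \<sigma> u" and ?h = "length u"
  have "reach M (p, 0, ?c) ?h (p, 0 + int ?h, ?c)"
    by (rule reach_right) (auto simp: M tape_of_def)
  moreover have "reach M (p, 0 + int ?h, ?c) 1 (p + 1, int ?h, cells R x \<sigma> (u @ [b]))"
    unfolding cells_put[symmetric]
    by (rule reach_one'[of _ _ _ _ _ "put b (?c (int ?h))" Move_None]) (auto simp: M tape_of_def)
  moreover have "reach M (p + 1, int ?h, cells R x \<sigma> (u @ [b])) (?h + 1) (p + 2, 0, cells R x \<sigma> (u @ [b]))"
    by (rule reach_rewind) (simp add: M)
  ultimately have "reach M (p, 0, ?c) (?h + 1 + (?h + 1)) (p + 2, 0, cells R x \<sigma> (u @ [b]))"
    using reach_trans by blast
  moreover have "?h + 1 + (?h + 1) \<le> 1 * (2 * S + 6)"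
    using big_Out.prems(4) by simp
  ultimately show ?case unfolding code_size.simps by blast
next
  case (big_Seq c \<sigma> u t \<sigma>' u' d t' \<sigma>'' u'')
  note g = big_growth[OF big_Seq.hyps(1)]
  have "\<exists>n\<le>t * (2 * S + 6). reach M (p, 0, cells R x \<sigma> u) n (p + code_size c, 0, cells R x \<sigma>' u')"
    by (rule big_Seq.IH(1))
       (use big_Seq.prems in \<open>fastforce simp: agrees_def\<close>)+
  moreover have "\<exists>n\<le>t' * (2 * S + 6). reach M (p + code_size c, 0, cells R x \<sigma>' u') n
      (p + code_size c + code_size d, 0, cells R x \<sigma>'' u'')"
  proof (rule big_Seq.IH(2))
    show "agrees R M d (p + code_size c)" using big_Seq.prems(2) by (auto simp: agrees_def)
    show "\<sigma>' r + t' \<le> S" if "r < R" for r using big_Seq.prems(3)[OF that] g[of r] by simp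
    show "length u' + t' \<le> S" using big_Seq.prems(4) g[of 0] by simp
  qed (use big_Seq.prems in auto)
  ultimately obtain n n' where "n \<le> t * (2 * S + 6)" "n' \<le> t' * (2 * S + 6)"
    and "reach M (p, 0, cells R x \<sigma> u) (n + n') (p + code_size c + code_size d, 0, cells R x \<sigma>'' u'')"
    using reach_trans by blast
  then show ?case by (intro exI[of _ "n + n'"]) (auto simp: algebra_simps)
next
  case (big_True \<sigma> b c u t \<sigma>' u' d)
  have "\<exists>n\<le>2 * S + 2. reach M (p, 0, cells R x \<sigma> u) n
           (if holds x \<sigma> b then p + 3 else p + 4 + code_size c, 0, cells R x \<sigma> u)"
    by (rule reach_test) (use big_True.prems(1) big_True.prems(3)[of "test_reg b"] agreesD[OF big_True.prems(2)] in auto)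
  moreover have "\<exists>n\<le>t * (2 * S + 6). reach M (p + 3, 0, cells R x \<sigma> u) n (p + 3 + code_size c, 0, cells R x \<sigma>' u')"
  proof (rule big_True.IH)
    show "agrees R M c (p + 3)" using big_True.prems(2) by (auto simp: agrees_def)
    show "\<sigma> r + t \<le> S" if "r < R" for r using big_True.prems(3)[OF that] by simp
  qed (use big_True.prems in auto)
  moreover have "reach M (p + 3 + code_size c, 0, cells R x \<sigma>' u') 1 (p + 4 + code_size c + code_size d, 0, cells R x \<sigma>' u')"
    by (rule reach_one') (use agreesD[OF big_True.prems(2)] in auto)
  ultimately obtain n n' where "n \<le> 2 * S + 2" "n' \<le> t * (2 * S + 6)"
    and "reach M (p, 0, cells R x \<sigma> u) (n + n' + 1) (p + 4 + code_size c + code_size d, 0, cells R x \<sigma>' u')"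
    using reach_trans unfolding if_P[OF big_True.hyps(1)] by blast
  then show ?case by (intro exI[of _ "n + n' + 1"]) (auto simp: algebra_simps)
next
  case (big_False \<sigma> b d u t \<sigma>' u' c)
  have "\<exists>n\<le>2 * S + 2. reach M (p, 0, cells R x \<sigma> u) n
           (if holds x \<sigma> b then p + 3 else p + 4 + code_size c, 0, cells R x \<sigma> u)"
    by (rule reach_test) (use big_False.prems(1) big_False.prems(3)[of "test_reg b"] agreesD[OF big_False.prems(2)] in auto)
  moreover have "\<exists>n\<le>t * (2 * S + 6). reach M (p + 4 + code_size c, 0, cells R x \<sigma> u) n
      (p + 4 + code_size c + code_size d, 0, cells R x \<sigma>' u')"
  proof (rule big_False.IH)
    show "agrees R M d (p + 4 + code_size c)" using big_False.prems(2) by (auto simp: agrees_def)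
    show "\<sigma> r + t \<le> S" if "r < R" for r using big_False.prems(3)[OF that] by simp
  qed (use big_False.prems in auto)
  ultimately obtain n n' where "n \<le> 2 * S + 2" "n' \<le> t * (2 * S + 6)"
    and "reach M (p, 0, cells R x \<sigma> u) (n + n') (p + 4 + code_size c + code_size d, 0, cells R x \<sigma>' u')"
    using reach_trans unfolding if_not_P[OF big_False.hyps(1)] by blast
  then show ?case by (intro exI[of _ "n + n'"]) (auto simp: algebra_simps)
next
  case (big_Exit \<sigma> b c u)
  have "\<exists>n\<le>2 * S + 2. reach M (p, 0, cells R x \<sigma> u) n
           (if holds x \<sigma> b then p + 4 + code_size c else p + 3, 0, cells R x \<sigma> u)"
    by (rule reach_test) (use big_Exit.prems(1) big_Exit.prems(3)[of "test_reg b"] agreesD[OF big_Exit.prems(2)] in auto)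
  then obtain n where "n \<le> 2 * S + 2" "reach M (p, 0, cells R x \<sigma> u) n (p + 4 + code_size c, 0, cells R x \<sigma> u)"
    unfolding if_P[OF big_Exit.hyps(1)] by blast
  then show ?case by (intro exI[of _ n]) (auto simp: algebra_simps)
next
  case (big_Loop \<sigma> b c u t \<sigma>' u' t' \<sigma>'' u'')
  note g = big_growth[OF big_Loop.hyps(2)]
  have "\<exists>n\<le>2 * S + 2. reach M (p, 0, cells R x \<sigma> u) n
           (if holds x \<sigma> b then p + 4 + code_size c else p + 3, 0, cells R x \<sigma> u)"
    by (rule reach_test) (use big_Loop.prems(1) big_Loop.prems(3)[of "test_reg b"] agreesD[OF big_Loop.prems(2)] in auto)
  moreover have "\<exists>n\<le>t * (2 * S + 6). reach M (p + 3, 0, cells R x \<sigma> u) n (p + 3 + code_size c, 0, cells R x \<sigma>' u')"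
  proof (rule big_Loop.IH(1))
    show "agrees R M c (p + 3)" using big_Loop.prems(2) by (auto simp: agrees_def)
    show "\<sigma> r + t \<le> S" if "r < R" for r using big_Loop.prems(3)[OF that] by simp
  qed (use big_Loop.prems in auto)
  moreover have "reach M (p + 3 + code_size c, 0, cells R x \<sigma>' u') 1 (p, 0, cells R x \<sigma>' u')"
    by (rule reach_one') (use agreesD[OF big_Loop.prems(2)] in auto)
  moreover have "\<exists>n\<le>t' * (2 * S + 6). reach M (p, 0, cells R x \<sigma>' u') n (p + code_size (Until b c), 0, cells R x \<sigma>'' u'')"
  proof (rule big_Loop.IH(2))
    show "\<sigma>' r + t' \<le> S" if "r < R" for r using big_Loop.prems(3)[OF that] g[of r] by simp
    show "length u' + t' \<le> S" using big_Loop.prems(4) g[of 0] by simp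
  qed (use big_Loop.prems in auto)
  ultimately obtain n n' n'' where "n \<le> 2 * S + 2" "n' \<le> t * (2 * S + 6)" "n'' \<le> t' * (2 * S + 6)"
    and "reach M (p, 0, cells R x \<sigma> u) (n + n' + 1 + n'') (p + code_size (Until b c), 0, cells R x \<sigma>'' u'')"
    using reach_trans unfolding if_not_P[OF big_Loop.hyps(1)] by blast
  then show ?case by (intro exI[of _ "n + n' + 1 + n''"]) (auto simp: algebra_simps)
qed

section \<open>Polynomial bounds\<close>

definition poly_bounded :: "(nat \<Rightarrow> nat) \<Rightarrow> bool" where
  "poly_bounded g \<longleftrightarrow> (\<exists>c k. \<forall>m. g m \<le> c * m ^ k + c)"

lemma poly_bounded_mono: "poly_bounded g \<Longrightarrow> (\<And>m. f m \<le> g m) \<Longrightarrow> poly_bounded f"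
  unfolding poly_bounded_def by (meson order_trans)

lemma poly_bounded_const: "poly_bounded (\<lambda>_. a)"
  unfolding poly_bounded_def by (intro exI[of _ a]) auto

lemma poly_bounded_id: "poly_bounded (\<lambda>m. m)"
  unfolding poly_bounded_def by (intro exI[of _ 1]) auto

text \<open>The \<open>+ 1\<close> is for \<open>m = 0\<close>, where \<open>m ^ 0 = 1\<close> while
  positive powers vanish.\<close>

lemma power_le_power_Suc: "(m::nat) ^ k \<le> m ^ (k + j) + 1"
proof (cases "m = 0")
  case False
  then have "m ^ k \<le> m ^ (k + j)" by (intro power_increasing) auto
  then show ?thesis by simp
qed (simp add: power_0_left)

lemma poly_bounded_add:
  assumes "poly_bounded f" "poly_bounded g"
  shows "poly_bounded (\<lambda>m. f m + g m)"
proof -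
  from assms obtain c k d l where f: "\<And>m. f m \<le> c * m ^ k + c" and g: "\<And>m. g m \<le> d * m ^ l + d"
    unfolding poly_bounded_def by blast
  have "f m + g m \<le> (2 * (c + d)) * m ^ (k + l) + 2 * (c + d)" for m
  proof -
    have "f m + g m \<le> c * m ^ k + c + (d * m ^ l + d)" using f[of m] g[of m] by simp
    also have "\<dots> \<le> c * (m ^ (k + l) + 1) + c + (d * (m ^ (l + k) + 1) + d)"
      using power_le_power_Suc[of m k l] power_le_power_Suc[of m l k] by (intro add_mono mult_left_mono) auto
    also have "\<dots> \<le> (2 * (c + d)) * m ^ (k + l) + 2 * (c + d)" by (simp add: algebra_simps)
    finally show ?thesis .
  qed
  then show ?thesis unfolding poly_bounded_def by blast
qed

lemma poly_bounded_mult: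
  assumes "poly_bounded f" "poly_bounded g"
  shows "poly_bounded (\<lambda>m. f m * g m)"
proof -
  from assms obtain c k d l where f: "\<And>m. f m \<le> c * m ^ k + c" and g: "\<And>m. g m \<le> d * m ^ l + d"
    unfolding poly_bounded_def by blast
  have "f m * g m \<le> (3 * (c * d)) * m ^ (k + l) + 3 * (c * d)" for m
  proof -
    have "f m * g m \<le> (c * m ^ k + c) * (d * m ^ l + d)" using f[of m] g[of m] by (rule mult_le_mono)
    also have "\<dots> = c * d * (m ^ (k + l) + m ^ k + m ^ l + 1)" by (simp add: algebra_simps power_add)
    also have "\<dots> \<le> c * d * (m ^ (k + l) + (m ^ (k + l) + 1) + (m ^ (l + k) + 1) + 1)"
      using power_le_power_Suc[of m k l] power_le_power_Suc[of m l k] by (intro mult_left_mono add_mono) auto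
    also have "\<dots> = (3 * (c * d)) * m ^ (k + l) + 3 * (c * d)" by (simp add: algebra_simps)
    finally show ?thesis .
  qed
  then show ?thesis unfolding poly_bounded_def by blast
qed

lemma poly_bounded_power: "poly_bounded f \<Longrightarrow> poly_bounded (\<lambda>m. f m ^ k)"
  by (induction k) (auto intro: poly_bounded_const poly_bounded_mult)

lemma poly_bounded_comp:
  assumes "poly_bounded f" "poly_bounded g"
  shows "poly_bounded (\<lambda>m. f (g m))"
proof -
  from assms(1) obtain c k where f: "\<And>m. f m \<le> c * m ^ k + c"
    unfolding poly_bounded_def by blast
  show ?thesis
    by (rule poly_bounded_mono[where g = "\<lambda>m. c * g m ^ k + c"])
       (auto intro!: poly_bounded_add poly_bounded_mult poly_bounded_const poly_bounded_power assms(2) f)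
qed

text \<open>State 0 puts the flag and the marks of all registers, which start at 0, on cell 0. The
  last state replaces each packed symbol by its output track while moving right and halts at the
  first 0.\<close>

definition program_machine :: "nat \<Rightarrow> com \<Rightarrow> machine" where
  "program_machine R c = (\<lambda>(q, s).
     if q = 0 then (if s < 3 then Some (1, sym s True 0 {..<R}, Move_None) else None)
     else if s \<notin> symbols R then None
     else if q < 1 + code_size c then code c 1 q s
     else if q = 1 + code_size c \<and> s \<noteq> 0 then Some (q, s_out s, Move_Right)
     else None)"

lemma finite_dom_program_machine: "finite (dom (program_machine R c))"
proof (rule finite_subset)
  show "dom (program_machine R c) \<subseteq> {..1 + code_size c} \<times> ({..<3} \<union> symbols R)"
    by (auto simp: program_machine_def dom_def split: if_splits)
  show "finite ({..1 + code_size c} \<times> ({..<3} \<union> symbols R))"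
    by (intro finite_cartesian_product finite_UnI finite_symbols) auto
qed

text \<open>When all registers are 0 again, their marks are on cell 0, and the nonblank cells form
  an interval. Hence the final sweep, which stops at a blank, leaves no mark behind. The 1 in the
  maximum is cell 0 with its flag.\<close>

lemma cells_nonblank:
  "cells R x (\<lambda>_. 0) u i \<noteq> 0 \<longleftrightarrow> 0 \<le> i \<and> i < int (max 1 (max (length x) (length u)))"
proof -
  have "sym a z b S = 0 \<longleftrightarrow> a = 0 \<and> \<not> z \<and> b = 0 \<and> S = {}" if "finite S" "a < 3" for a z b S
  proof
    assume "sym a z b S = 0"
    then have "sym a z b S = sym 0 False 0 {}" by (simp add: sym_raw)
    then show "a = 0 \<and> \<not> z \<and> b = 0 \<and> S = {}"
      using sym_simps[OF that(2,1)] sym_simps[of 0 "{}"] by (metis finite.emptyI zero_less_numeral)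
  qed (simp add: sym_raw)
  then show ?thesis unfolding cells_def
    by (simp add: tape_of_less) (auto simp: tape_of_def)
qed

theorem polytime_program:
  assumes prog: "\<And>x. \<exists>t\<le>g (length x). big x c (\<lambda>_. 0) [] t (\<lambda>_. 0) (f x)"
    and g: "poly_bounded g"
  shows "polytime f"
proof -
  obtain R where R: "regs_below R c" using regs_below_ex by blast
  \<comment> \<open>The summands of the time bound belong to initialisation, simulation and the
    final sweep over input and output.\<close>
  let ?M = "program_machine R c" and ?T = "\<lambda>n. 1 + g n * (2 * g n + 6) + (1 + n + g n)"
  have "poly_bounded ?T"
    by (intro poly_bounded_add poly_bounded_mult poly_bounded_const poly_bounded_id g)
  then obtain a k where ak: "\<And>n. ?T n \<le> a * n ^ k + a" unfolding poly_bounded_def by blast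
  have "computes_within ?M (?T (length x)) x (f x)" for x
  proof -
    obtain t where t: "t \<le> g (length x)" and b: "big x c (\<lambda>_. 0) [] t (\<lambda>_. 0) (f x)"
      using prog by blast
    have start: "reach ?M (0, 0, tape_of x) 1 (1, 0, cells R x (\<lambda>_. 0) [])"
    proof (rule reach_one'[where m = Move_None])
      show "?M (0, tape_of x 0) = Some (1, sym (tape_of x 0) True 0 {..<R}, Move_None)"
        by (simp add: program_machine_def tape_of_less)
      show "cells R x (\<lambda>_. 0) [] = (tape_of x)(0 := sym (tape_of x 0) True 0 {..<R})"
        by (auto simp: fun_eq_iff cells_def tape_of_def sym_raw lessThan_def)
    qed simp
    obtain n where n: "n \<le> t * (2 * t + 6)"
      "reach ?M (1, 0, cells R x (\<lambda>_. 0) []) n (1 + code_size c, 0, cells R x (\<lambda>_. 0) (f x))"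
      using simulate[OF b R, of ?M 1 t] by (auto simp: agrees_def program_machine_def)
    \<comment> \<open>Left of the head the tape is plain output already, from the head on it is
      still packed.\<close>
    have "reach ?M (1 + code_size c, 0, cells R x (\<lambda>_. 0) (f x)) d
        (1 + code_size c, int d, \<lambda>i. if i < int d then tape_of (f x) i else cells R x (\<lambda>_. 0) (f x) i)"
      if "d \<le> max 1 (max (length x) (length (f x)))" for d
      using that
    proof (induction d)
      case 0
      have "(\<lambda>i. if i < int 0 then tape_of (f x) i else cells R x (\<lambda>_. 0) (f x) i) = cells R x (\<lambda>_. 0) (f x)"
      proof
        fix i
        show "(if i < int 0 then tape_of (f x) i else cells R x (\<lambda>_. 0) (f x) i) = cells R x (\<lambda>_. 0) (f x) i"
          using cells_nonblank[of R x "f x" i] by (auto simp: tape_of_def)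
      qed
      then show ?case by (simp add: reach_refl)
    next
      case (Suc d)
      let ?t = "\<lambda>d i. if i < int d then tape_of (f x) i else cells R x (\<lambda>_. 0) (f x) i"
      have 1: "reach ?M (1 + code_size c, int d, ?t d) 1 (1 + code_size c, int (Suc d), ?t (Suc d))"
      proof (rule reach_one'[where m = Move_Right])
        have "cells R x (\<lambda>_. 0) (f x) (int d) \<noteq> 0" using Suc.prems cells_nonblank[of R x "f x" "int d"] by auto
        then show "?M (1 + code_size c, ?t d (int d)) = Some (1 + code_size c, tape_of (f x) (int d), Move_Right)"
          by (auto simp: program_machine_def)
      qed (auto simp: fun_eq_iff)
      have 0: "reach ?M (1 + code_size c, 0, cells R x (\<lambda>_. 0) (f x)) d (1 + code_size c, int d, ?t d)"
        using Suc by simp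
      show ?case using reach_trans[OF 0 1] unfolding Suc_eq_plus1 .
    qed
    then have "reach ?M (1 + code_size c, 0, cells R x (\<lambda>_. 0) (f x)) (max 1 (max (length x) (length (f x))))
        (1 + code_size c, int (max 1 (max (length x) (length (f x)))),
          \<lambda>i. if i < int (max 1 (max (length x) (length (f x)))) then tape_of (f x) i else cells R x (\<lambda>_. 0) (f x) i)"
      by blast
    also have "(\<lambda>i. if i < int (max 1 (max (length x) (length (f x)))) then tape_of (f x) i else cells R x (\<lambda>_. 0) (f x) i)
        = tape_of (f x)"
    proof
      fix i
      show "(if i < int (max 1 (max (length x) (length (f x)))) then tape_of (f x) i else cells R x (\<lambda>_. 0) (f x) i)
        = tape_of (f x) i"
        using cells_nonblank[of R x "f x" i] by (auto simp: tape_of_def)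
    qed
    finally have finish: "reach ?M (1 + code_size c, 0, cells R x (\<lambda>_. 0) (f x)) (max 1 (max (length x) (length (f x))))
        (1 + code_size c, int (max 1 (max (length x) (length (f x)))), tape_of (f x))" .
    have "reach ?M (0, 0, tape_of x) (1 + n + max 1 (max (length x) (length (f x))))
       (1 + code_size c, int (max 1 (max (length x) (length (f x)))), tape_of (f x))"
      by (rule reach_trans[OF reach_trans[OF start n(2)] finish])
    moreover have "step ?M (1 + code_size c, int (max 1 (max (length x) (length (f x)))), tape_of (f x)) = None"
      by (auto simp: program_machine_def tape_of_def)
    moreover have "1 + n + max 1 (max (length x) (length (f x))) \<le> ?T (length x)"
    proof -
      have "n \<le> g (length x) * (2 * g (length x) + 6)"
        using n(1) t by (meson add_le_mono1 le_trans mult_le_mono nat_mult_le_cancel_disj)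
      moreover have "length (f x) \<le> g (length x)" using big_growth[OF b] t by simp
      ultimately show ?thesis by simp
    qed
    ultimately show ?thesis unfolding computes_within_def using reach_runs by blast
  qed
  then have "computes_within ?M (a * length x ^ k + a) x (f x)" for x
    using ak unfolding computes_within_def by (meson order_trans)
  then show ?thesis unfolding polytime_def using finite_dom_program_machine by blast
qed

section \<open>A language for polynomial-time output\<close>

text \<open>An upper bound on the time composes more easily than the exact count of
  \<open>big\<close>.\<close>

definition does :: "bool list \<Rightarrow> com \<Rightarrow> (nat \<Rightarrow> nat) \<Rightarrow> bool list \<Rightarrow> nat \<Rightarrow> (nat \<Rightarrow> nat) \<Rightarrow> bool list \<Rightarrow> bool"
  where "does x c \<sigma> u t \<sigma>' u' \<longleftrightarrow> (\<exists>t'\<le>t. big x c \<sigma> u t' \<sigma>' u')"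

lemma does_mono: "does x c \<sigma> u t \<sigma>' u' \<Longrightarrow> t \<le> t' \<Longrightarrow> does x c \<sigma> u t' \<sigma>' u'"
  unfolding does_def by (meson order_trans)

lemma does_Skip: "\<sigma>' = \<sigma> \<Longrightarrow> does x Skip \<sigma> u t \<sigma>' u"
  unfolding does_def using big_Skip by blast

lemma does_Inc: "\<sigma>' = \<sigma>(r := \<sigma> r + 1) \<Longrightarrow> 1 \<le> t \<Longrightarrow> does x (Inc r) \<sigma> u t \<sigma>' u"
  unfolding does_def using big_Inc by blast

lemma does_Dec: "\<sigma>' = \<sigma>(r := \<sigma> r - 1) \<Longrightarrow> 1 \<le> t \<Longrightarrow> does x (Dec r) \<sigma> u t \<sigma>' u"
  unfolding does_def using big_Dec by blast

lemma does_Out: "u' = u @ [b] \<Longrightarrow> 1 \<le> t \<Longrightarrow> does x (Out b) \<sigma> u t \<sigma> u'"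
  unfolding does_def using big_Out by blast

lemma does_Seq:
  assumes "does x c \<sigma> u t \<sigma>' u'" "does x d \<sigma>' u' t' \<sigma>'' u''" "t + t' \<le> k"
  shows "does x (Seq c d) \<sigma> u k \<sigma>'' u''"
proof -
  obtain s s' where "s \<le> t" "big x c \<sigma> u s \<sigma>' u'" "s' \<le> t'" "big x d \<sigma>' u' s' \<sigma>'' u''"
    using assms unfolding does_def by blast
  then have "s + s' \<le> k" "big x (Seq c d) \<sigma> u (s + s') \<sigma>'' u''"
    using assms(3) big_Seq by (auto intro: order_trans)
  then show ?thesis unfolding does_def by blast
qed

lemma does_True: "holds x \<sigma> b \<Longrightarrow> does x c \<sigma> u t \<sigma>' u' \<Longrightarrow> t + 1 \<le> k \<Longrightarrow> does x (Branch b c d) \<sigma> u k \<sigma>' u'"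
  unfolding does_def using big_True by (meson add_le_mono1 order_trans)

lemma does_False: "\<not> holds x \<sigma> b \<Longrightarrow> does x d \<sigma> u t \<sigma>' u' \<Longrightarrow> t + 1 \<le> k \<Longrightarrow> does x (Branch b c d) \<sigma> u k \<sigma>' u'"
  unfolding does_def using big_False by (meson add_le_mono1 order_trans)

lemma does_Exit: "holds x \<sigma> b \<Longrightarrow> 1 \<le> t \<Longrightarrow> does x (Until b c) \<sigma> u t \<sigma> u"
  unfolding does_def using big_Exit by blast

lemma does_Loop:
  assumes "\<not> holds x \<sigma> b" "does x c \<sigma> u t \<sigma>' u'" "does x (Until b c) \<sigma>' u' t' \<sigma>'' u''" "t + t' + 1 \<le> k"
  shows "does x (Until b c) \<sigma> u k \<sigma>'' u''"
proof -
  obtain s s' where s: "s \<le> t" "big x c \<sigma> u s \<sigma>' u'" "s' \<le> t'" "big x (Until b c) \<sigma>' u' s' \<sigma>'' u''"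
    using assms(2,3) unfolding does_def by blast
  then have "s + s' + 1 \<le> k" using assms(4) by linarith
  moreover have "big x (Until b c) \<sigma> u (s + s' + 1) \<sigma>'' u''"
    using big_Loop[OF assms(1) s(2) s(4)] .
  ultimately show ?thesis unfolding does_def by blast
qed

definition countdown :: "nat \<Rightarrow> com \<Rightarrow> com" where
  "countdown r c = Until (Is_Zero r) (Seq (Dec r) c)"

text \<open>\<open>f i\<close> and \<open>v i\<close> are store and output after \<open>i\<close>
  rounds. A round takes one test, one \<open>Dec\<close> and the body, hence \<open>t + 2\<close>;
  the last test accounts for the \<open>+ 1\<close>. The body runs with \<open>r\<close> already
  decremented.\<close>

lemma does_countdown:
  assumes "\<And>i. i < n \<Longrightarrow> does x c ((f i)(r := n - Suc i)) (v i) t (f (Suc i)) (v (Suc i))"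
    and "\<And>i. i \<le> n \<Longrightarrow> f i r = n - i"
  shows "does x (countdown r c) (f 0) (v 0) (n * (t + 2) + 1) (f n) (v n)"
proof -
  have "does x (countdown r c) (f (n - k)) (v (n - k)) (k * (t + 2) + 1) (f n) (v n)" if "k \<le> n" for k
    using that
  proof (induction k)
    case 0
    then show ?case using assms(2)[of n] by (simp add: countdown_def does_Exit)
  next
    case (Suc k)
    then have i: "n - Suc k < n" "Suc (n - Suc k) = n - k" by auto
    have fr: "f (n - Suc k) r = Suc k" using assms(2)[of "n - Suc k"] Suc.prems by simp
    have "does x (Seq (Dec r) c) (f (n - Suc k)) (v (n - Suc k)) (t + 1) (f (n - k)) (v (n - k))"
    proof (rule does_Seq[OF does_Dec[OF refl order_refl]])
      have "(f (n - Suc k))(r := f (n - Suc k) r - 1) = (f (n - Suc k))(r := n - Suc (n - Suc k))"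
        using fr Suc.prems i(2) by auto
      then show "does x c ((f (n - Suc k))(r := f (n - Suc k) r - 1)) (v (n - Suc k)) t (f (n - k)) (v (n - k))"
        using assms(1)[OF i(1)] i(2) by simp
    qed simp
    then show ?case
      unfolding countdown_def
      by (rule does_Loop[rotated, OF _ Suc.IH[unfolded countdown_def]]) (use fr Suc.prems in auto)
  qed
  from this[of n] show ?thesis by simp
qed

lemma does_countdown':
  assumes "\<And>i. i < n \<Longrightarrow> does x c ((f i)(r := n - Suc i)) (v i) t (f (Suc i)) (v (Suc i))"
    and "\<And>i. i \<le> n \<Longrightarrow> f i r = n - i" and "f 0 = \<sigma>" "f n = \<sigma>'" "v 0 = u" "v n = u'" "n * (t + 2) + 1 \<le> k"
  shows "does x (countdown r c) \<sigma> u k \<sigma>' u'"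
  using does_mono[OF does_countdown[of n x c f r v t]] assms by auto

definition "clear r = countdown r Skip"
definition "transfer r d = countdown r (Inc d)"
definition "duplicate r d e = Seq (countdown r (Seq (Inc d) (Inc e))) (transfer e r)"
definition "halve r d e = countdown r (Branch (Is_Zero r) (Inc e) (Seq (Dec r) (Inc d)))"

lemma does_clear:
  assumes "\<sigma>' = \<sigma>(r := 0)" "2 * \<sigma> r + 1 \<le> t"
  shows "does x (clear r) \<sigma> u t \<sigma>' u"
  unfolding clear_def
  by (rule does_countdown'[where f = "\<lambda>i. \<sigma>(r := \<sigma> r - i)" and v = "\<lambda>_. u" and n = "\<sigma> r" and t = 0])
     (use assms in \<open>auto intro: does_Skip\<close>)

lemma does_transfer:
  assumes "\<sigma>' = \<sigma>(r := 0, d := \<sigma> d + \<sigma> r)" "r \<noteq> d" "3 * \<sigma> r + 1 \<le> t"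
  shows "does x (transfer r d) \<sigma> u t \<sigma>' u"
  unfolding transfer_def
  by (rule does_countdown'[where f = "\<lambda>i. \<sigma>(r := \<sigma> r - i, d := \<sigma> d + i)" and v = "\<lambda>_. u" and n = "\<sigma> r" and t = 1])
     (use assms in \<open>auto intro!: does_Inc simp: fun_eq_iff\<close>)

lemma does_duplicate:
  assumes "\<sigma>' = \<sigma>(d := \<sigma> d + \<sigma> r)" "distinct [r, d, e]" "\<sigma> e = 0" "7 * \<sigma> r + 2 \<le> t"
  shows "does x (duplicate r d e) \<sigma> u t \<sigma>' u"
  unfolding duplicate_def
proof (rule does_Seq)
  show "does x (countdown r (Seq (Inc d) (Inc e))) \<sigma> u (4 * \<sigma> r + 1) (\<sigma>(r := 0, d := \<sigma> d + \<sigma> r, e := \<sigma> r)) u"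
    by (rule does_countdown'[where f = "\<lambda>i. \<sigma>(r := \<sigma> r - i, d := \<sigma> d + i, e := i)" and v = "\<lambda>_. u" and n = "\<sigma> r" and t = 2])
       (use assms in \<open>auto intro!: does_Seq[OF does_Inc[OF refl order_refl] does_Inc] simp: fun_eq_iff\<close>)
  show "does x (transfer e r) (\<sigma>(r := 0, d := \<sigma> d + \<sigma> r, e := \<sigma> r)) u (3 * \<sigma> r + 1) \<sigma>' u"
    by (rule does_transfer) (use assms in \<open>auto simp: fun_eq_iff\<close>)
qed (use assms(4) in simp)

text \<open>A round removes two units from \<open>r\<close>, one by the countdown and one by the
  body, and credits \<open>d\<close>; a single leftover unit goes to \<open>e\<close>. Since the
  body changes the counter, the rule for countdowns does not fit, and the induction is on the value
  of \<open>r\<close>.\<close>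

lemma does_halve:
  assumes "\<sigma>' = \<sigma>(r := 0, d := \<sigma> d + \<sigma> r div 2, e := \<sigma> e + \<sigma> r mod 2)" "distinct [r, d, e]" "5 * \<sigma> r + 1 \<le> t"
  shows "does x (halve r d e) \<sigma> u t \<sigma>' u"
  using assms
proof (induction "\<sigma> r" arbitrary: \<sigma> t rule: less_induct)
  case less
  let ?c = "Seq (Dec r) (Branch (Is_Zero r) (Inc e) (Seq (Dec r) (Inc d)))"
  have unf: "halve r d e = Until (Is_Zero r) ?c" by (simp add: halve_def countdown_def)
  consider "\<sigma> r = 0" | "\<sigma> r = 1" | "\<sigma> r \<ge> 2" by linarith
  then show ?case
  proof cases
    case 1
    then have "\<sigma>' = \<sigma>" using less.prems(1) by auto
    then show ?thesis unfolding unf using 1 less.prems by (auto intro: does_Exit)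
  next
    case 2
    have *: "does x ?c \<sigma> u 3 \<sigma>' u"
      by (rule does_Seq[OF does_Dec[OF refl order_refl] does_True[OF _ does_Inc[OF _ order_refl]]])
         (use 2 less.prems(1,2) in \<open>auto simp: fun_eq_iff\<close>)
    have **: "does x (Until (Is_Zero r) ?c) \<sigma>' u 1 \<sigma>' u"
      by (rule does_Exit) (use less.prems(1,2) in auto)
    show ?thesis unfolding unf
      by (rule does_Loop[OF _ * **]) (use 2 less.prems in auto)
  next
    case 3
    let ?s = "\<sigma>(r := \<sigma> r - 2, d := \<sigma> d + 1)"
    have a: "does x (Dec r) \<sigma> u 1 (\<sigma>(r := \<sigma> r - 1)) u" by (rule does_Dec) auto
    have b: "does x (Dec r) (\<sigma>(r := \<sigma> r - 1)) u 1 (\<sigma>(r := \<sigma> r - 2)) u" by (rule does_Dec) (auto simp: numeral_2_eq_2)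
    have c: "does x (Inc d) (\<sigma>(r := \<sigma> r - 2)) u 1 ?s u"
      by (rule does_Inc) (use less.prems(2) in auto)
    have f: "does x (Branch (Is_Zero r) (Inc e) (Seq (Dec r) (Inc d))) (\<sigma>(r := \<sigma> r - 1)) u 3 ?s u"
      by (rule does_False[OF _ does_Seq[OF b c order_refl]]) (use 3 in auto)
    have *: "does x ?c \<sigma> u 4 ?s u"
      by (rule does_Seq[OF a f]) simp
    \<comment> \<open>\<open>5 * \<sigma> r - 9\<close> is the bound \<open>5 * n + 1\<close> for
      \<open>n = \<sigma> r - 2\<close>.\<close>
    have **: "does x (halve r d e) ?s u (5 * \<sigma> r - 9) \<sigma>' u"
    proof (rule less.hyps)
      have "\<sigma> r div 2 = Suc ((\<sigma> r - 2) div 2)" "\<sigma> r mod 2 = (\<sigma> r - 2) mod 2"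
        using 3 by (auto simp: le_div_geq le_mod_geq)
      then show "\<sigma>' = ?s(r := 0, d := ?s d + ?s r div 2, e := ?s e + ?s r mod 2)"
        using less.prems(1,2) by (auto simp: fun_eq_iff)
    qed (use 3 less.prems(2) in auto)
    show ?thesis unfolding unf
      by (rule does_Loop[OF _ * **[unfolded unf]]) (use 3 less.prems in auto)
  qed
qed

section \<open>Arithmetic expressions\<close>

datatype aexp = V nat | C nat | Add aexp aexp | Mul aexp aexp | Sub aexp aexp
  | Cond aexp aexp aexp | Half aexp | Inp aexp | Len

primrec aval :: "bool list \<Rightarrow> (nat \<Rightarrow> nat) \<Rightarrow> aexp \<Rightarrow> nat" where
  "aval x \<sigma> (V i) = \<sigma> i"
| "aval x \<sigma> (C n) = n"
| "aval x \<sigma> (Add a b) = aval x \<sigma> a + aval x \<sigma> b"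
| "aval x \<sigma> (Mul a b) = aval x \<sigma> a * aval x \<sigma> b"
| "aval x \<sigma> (Sub a b) = aval x \<sigma> a - aval x \<sigma> b"
| "aval x \<sigma> (Cond a b c) = (if aval x \<sigma> a = 0 then aval x \<sigma> c else aval x \<sigma> b)"
| "aval x \<sigma> (Half a) = aval x \<sigma> a div 2"
| "aval x \<sigma> (Inp a) = tape_of x (int (aval x \<sigma> a))"
| "aval x \<sigma> Len = length x"

primrec vars :: "aexp \<Rightarrow> nat set" where
  "vars (V i) = {i}"
| "vars (C n) = {}"
| "vars (Add a b) = vars a \<union> vars b"
| "vars (Mul a b) = vars a \<union> vars b"
| "vars (Sub a b) = vars a \<union> vars b"
| "vars (Cond a b c) = vars a \<union> vars b \<union> vars c"
| "vars (Half a) = vars a"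
| "vars (Inp a) = vars a"
| "vars Len = {}"

lemma aval_cong: "(\<And>i. i \<in> vars e \<Longrightarrow> \<sigma> i = \<tau> i) \<Longrightarrow> aval x \<sigma> e = aval x \<tau> e"
  by (induction e) simp_all

primrec abound :: "aexp \<Rightarrow> nat \<Rightarrow> nat" where
  "abound (V i) = (\<lambda>m. m)"
| "abound (C n) = (\<lambda>m. n)"
| "abound (Add a b) = (\<lambda>m. abound a m + abound b m)"
| "abound (Mul a b) = (\<lambda>m. abound a m * abound b m)"
| "abound (Sub a b) = (\<lambda>m. abound a m)"
| "abound (Cond a b c) = (\<lambda>m. abound b m + abound c m)"
| "abound (Half a) = (\<lambda>m. abound a m)"
| "abound (Inp a) = (\<lambda>m. 2)"
| "abound Len = (\<lambda>m. m)"

lemma aval_le: "(\<And>i. i \<in> vars e \<Longrightarrow> \<sigma> i \<le> m) \<Longrightarrow> length x \<le> m \<Longrightarrow> aval x \<sigma> e \<le> abound e m"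
proof (induction e)
  case (Sub a b)
  then have "aval x \<sigma> a \<le> abound a m" by simp
  then show ?case by simp
next
  case (Half a)
  then have "aval x \<sigma> a \<le> abound a m" by simp
  then show ?case by simp
next
  case (Cond a b c)
  then show ?case by (auto intro: trans_le_add1 trans_le_add2)
qed (auto intro: add_mono mult_le_mono simp: tape_of_def)

text \<open>A stack discipline: variables are registers below \<open>b\<close>, all registers from
  \<open>b\<close> on are 0 before, and afterwards only \<open>b\<close> differs, holding the value.
  Subexpressions are evaluated at higher bases, and scratch registers are cleared.\<close>

primrec acomp :: "nat \<Rightarrow> aexp \<Rightarrow> com" where
  "acomp b (V i) = duplicate i b (b + 1)"
| "acomp b (C n) = (Seq (Inc b) ^^ n) Skip"
| "acomp b (Add e f) = Seq (acomp b e) (Seq (acomp (b + 1) f) (transfer (b + 1) b))"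
| "acomp b (Mul e f) = Seq (acomp (b + 1) e) (Seq (acomp (b + 2) f)
     (Seq (countdown (b + 1) (duplicate (b + 2) b (b + 3))) (clear (b + 2))))"
| "acomp b (Sub e f) = Seq (acomp b e) (Seq (acomp (b + 1) f) (countdown (b + 1) (Dec b)))"
| "acomp b (Cond e f g) = Seq (acomp b e) (Branch (Is_Zero b) (acomp b g) (Seq (clear b) (acomp b f)))"
| "acomp b (Half e) = Seq (acomp (b + 1) e) (Seq (halve (b + 1) b (b + 2)) (clear (b + 2)))"
| "acomp b (Inp e) = Seq (acomp (b + 1) e) (Seq
     (Branch (Is_Input (b + 1) 0) Skip (Branch (Is_Input (b + 1) 1) (Inc b) (Seq (Inc b) (Inc b))))
     (clear (b + 1)))"
| "acomp b Len = Until (Is_Input b 0) (Inc b)"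

primrec atime :: "aexp \<Rightarrow> nat \<Rightarrow> nat" where
  "atime (V i) = (\<lambda>m. 7 * m + 2)"
| "atime (C n) = (\<lambda>m. n)"
| "atime (Add a b) = (\<lambda>m. atime a m + (atime b m + (3 * abound b m + 1)))"
| "atime (Mul a b) = (\<lambda>m. atime a m + (atime b m + (abound a m * (7 * abound b m + 2 + 2) + 1 + (2 * abound b m + 1))))"
| "atime (Sub a b) = (\<lambda>m. atime a m + (atime b m + (abound b m * (1 + 2) + 1)))"
| "atime (Cond a b c) = (\<lambda>m. atime a m + ((2 * abound a m + 1) + atime b m + atime c m + 1))"
| "atime (Half a) = (\<lambda>m. atime a m + (5 * abound a m + 1 + 3))"
| "atime (Inp a) = (\<lambda>m. atime a m + (4 + (2 * abound a m + 1)))"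
| "atime Len = (\<lambda>m. 2 * m + 1)"

lemma does_acomp:
  assumes "vars e \<subseteq> {..<b}" "\<And>r. r \<ge> b \<Longrightarrow> \<sigma> r = 0" "\<And>i. i \<in> vars e \<Longrightarrow> \<sigma> i \<le> m" "length x \<le> m"
  shows "does x (acomp b e) \<sigma> u (atime e m) (\<sigma>(b := aval x \<sigma> e)) u"
  using assms
proof (induction e arbitrary: b \<sigma>)
  case (V i)
  then show ?case by (auto intro!: does_duplicate)
next
  case (C n)
  have "does x ((Seq (Inc b) ^^ n) Skip) \<sigma> u n (\<sigma>(b := \<sigma> b + n)) u" for \<sigma>
  proof (induction n arbitrary: \<sigma>)
    case 0
    then show ?case by (auto intro: does_Skip)
  next
    case (Suc n)
    have 1: "does x (Inc b) \<sigma> u 1 (\<sigma>(b := \<sigma> b + 1)) u" by (rule does_Inc) auto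
    have e: "(\<sigma>(b := \<sigma> b + 1))(b := (\<sigma>(b := \<sigma> b + 1)) b + n) = \<sigma>(b := \<sigma> b + Suc n)"
      by (rule ext) simp
    show ?case unfolding funpow.simps o_apply
      by (rule does_Seq[OF 1 Suc[of "\<sigma>(b := \<sigma> b + 1)", unfolded e]]) simp
  qed
  from this[of \<sigma>] show ?case
    unfolding acomp.simps atime.simps aval.simps C.prems(2)[of b, OF order_refl] add_0 .
next
  case (Add e f)
  let ?s1 = "\<sigma>(b := aval x \<sigma> e)"
  have 1: "does x (acomp b e) \<sigma> u (atime e m) ?s1 u"
    by (rule Add.IH(1)) (use Add.prems in auto)
  have "does x (acomp (b + 1) f) ?s1 u (atime f m) (?s1(b + 1 := aval x ?s1 f)) u"
    by (rule Add.IH(2)) (use Add.prems in auto)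
  moreover have "aval x ?s1 f = aval x \<sigma> f" by (rule aval_cong) (use Add.prems(1) in auto)
  ultimately have 2: "does x (acomp (b + 1) f) ?s1 u (atime f m) (?s1(b + 1 := aval x \<sigma> f)) u" by simp
  have "aval x \<sigma> f \<le> abound f m" by (rule aval_le) (use Add.prems in auto)
  then have 3: "does x (transfer (b + 1) b) (?s1(b + 1 := aval x \<sigma> f)) u (3 * abound f m + 1) (\<sigma>(b := aval x \<sigma> (Add e f))) u"
    by (intro does_transfer) (use Add.prems(2)[of "b + 1"] in \<open>auto simp: fun_eq_iff\<close>)
  show ?case using does_Seq[OF 1 does_Seq[OF 2 3 order_refl] order_refl] unfolding acomp.simps atime.simps .
next
  case (Sub e f)
  let ?s1 = "\<sigma>(b := aval x \<sigma> e)"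
  have 1: "does x (acomp b e) \<sigma> u (atime e m) ?s1 u"
    by (rule Sub.IH(1)) (use Sub.prems in auto)
  have "does x (acomp (b + 1) f) ?s1 u (atime f m) (?s1(b + 1 := aval x ?s1 f)) u"
    by (rule Sub.IH(2)) (use Sub.prems in auto)
  moreover have "aval x ?s1 f = aval x \<sigma> f" by (rule aval_cong) (use Sub.prems(1) in auto)
  ultimately have 2: "does x (acomp (b + 1) f) ?s1 u (atime f m) (?s1(b + 1 := aval x \<sigma> f)) u" by simp
  have "aval x \<sigma> f \<le> abound f m" by (rule aval_le) (use Sub.prems in auto)
  then have 3: "does x (countdown (b + 1) (Dec b)) (?s1(b + 1 := aval x \<sigma> f)) u (abound f m * (1 + 2) + 1) (\<sigma>(b := aval x \<sigma> (Sub e f))) u"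
    by (intro does_countdown'[where f = "\<lambda>i. ?s1(b + 1 := aval x \<sigma> f - i, b := aval x \<sigma> e - i)"
          and v = "\<lambda>_. u" and n = "aval x \<sigma> f" and t = 1])
       (use Sub.prems(2)[of "b + 1"] in \<open>auto simp: fun_eq_iff intro!: does_Dec\<close>)
  show ?case using does_Seq[OF 1 does_Seq[OF 2 3 order_refl] order_refl] unfolding acomp.simps atime.simps .
next
  case (Mul e f)
  let ?p = "aval x \<sigma> e" and ?q = "aval x \<sigma> f"
  let ?s1 = "\<sigma>(b + 1 := ?p)"
  have 1: "does x (acomp (b + 1) e) \<sigma> u (atime e m) ?s1 u"
    by (rule Mul.IH(1)) (use Mul.prems in auto)
  have "does x (acomp (b + 2) f) ?s1 u (atime f m) (?s1(b + 2 := aval x ?s1 f)) u"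
    by (rule Mul.IH(2)) (use Mul.prems in auto)
  moreover have "aval x ?s1 f = ?q" by (rule aval_cong) (use Mul.prems(1) in auto)
  ultimately have 2: "does x (acomp (b + 2) f) ?s1 u (atime f m) (?s1(b + 2 := ?q)) u" by simp
  have le: "?p \<le> abound e m" "?q \<le> abound f m" by (rule aval_le; use Mul.prems in auto)+
  have z: "\<sigma> b = 0" "\<sigma> (Suc b) = 0" "\<sigma> (Suc (Suc b)) = 0" "\<sigma> (b + 3) = 0" using Mul.prems(2) by auto
  have 3: "does x (countdown (b + 1) (duplicate (b + 2) b (b + 3))) (?s1(b + 2 := ?q)) u
      (abound e m * (7 * abound f m + 2 + 2) + 1) (\<sigma>(b := ?p * ?q, b + 2 := ?q)) u"
    by (rule does_countdown'[where f = "\<lambda>i. \<sigma>(b := i * ?q, b + 1 := ?p - i, b + 2 := ?q)"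
          and v = "\<lambda>_. u" and n = "?p" and t = "7 * ?q + 2"])
       (use z le in \<open>auto simp: fun_eq_iff intro!: does_duplicate add_mono mult_le_mono\<close>)
  have 4: "does x (clear (b + 2)) (\<sigma>(b := ?p * ?q, b + 2 := ?q)) u (2 * abound f m + 1) (\<sigma>(b := aval x \<sigma> (Mul e f))) u"
    by (rule does_clear) (use z le in \<open>auto simp: fun_eq_iff\<close>)
  show ?case using does_Seq[OF 1 does_Seq[OF 2 does_Seq[OF 3 4 order_refl] order_refl] order_refl] unfolding acomp.simps atime.simps .
next
  case (Cond e f g)
  let ?p = "aval x \<sigma> e"
  let ?s1 = "\<sigma>(b := ?p)"
  have 1: "does x (acomp b e) \<sigma> u (atime e m) ?s1 u"
    by (rule Cond.IH(1)) (use Cond.prems in auto)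
  have le: "?p \<le> abound e m" by (rule aval_le; use Cond.prems in auto)
  have z: "\<sigma> b = 0" using Cond.prems(2) by auto
  then have zz: "\<sigma> = \<sigma>(b := 0)" by auto
  have 2: "does x (acomp b f) \<sigma> u (atime f m) (\<sigma>(b := aval x \<sigma> f)) u"
    by (rule Cond.IH(2)) (use Cond.prems in auto)
  have 3: "does x (acomp b g) \<sigma> u (atime g m) (\<sigma>(b := aval x \<sigma> g)) u"
    by (rule Cond.IH(3)) (use Cond.prems in auto)
  have 4: "does x (clear b) ?s1 u (2 * abound e m + 1) \<sigma> u"
    by (rule does_clear) (use z le in \<open>auto simp: fun_eq_iff\<close>)
  have 5: "does x (Branch (Is_Zero b) (acomp b g) (Seq (clear b) (acomp b f))) ?s1 u
      ((2 * abound e m + 1) + atime f m + atime g m + 1) (\<sigma>(b := aval x \<sigma> (Cond e f g))) u"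
  proof (cases "?p = 0")
    case True
    then have "?s1 = \<sigma>" using zz by simp
    then show ?thesis using does_True[OF _ 3, where b = "Is_Zero b"] z True by auto
  next
    case False
    then show ?thesis
      using does_False[OF _ does_Seq[OF 4 2 order_refl], where b = "Is_Zero b" and k = "(2 * abound e m + 1) + atime f m + atime g m + 1"] by auto
  qed
  show ?case using does_Seq[OF 1 5 order_refl] unfolding acomp.simps atime.simps .
next
  case (Half e)
  let ?p = "aval x \<sigma> e"
  have 1: "does x (acomp (b + 1) e) \<sigma> u (atime e m) (\<sigma>(b + 1 := ?p)) u"
    by (rule Half.IH) (use Half.prems in auto)
  have le: "?p \<le> abound e m" by (rule aval_le; use Half.prems in auto)
  have z: "\<sigma> b = 0" "\<sigma> (Suc b) = 0" "\<sigma> (Suc (Suc b)) = 0" using Half.prems(2) by auto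
  have 2: "does x (halve (b + 1) b (b + 2)) (\<sigma>(b + 1 := ?p)) u (5 * abound e m + 1) (\<sigma>(b := ?p div 2, b + 2 := ?p mod 2)) u"
    by (rule does_halve) (use z le in \<open>auto simp: fun_eq_iff\<close>)
  have 3: "does x (clear (b + 2)) (\<sigma>(b := ?p div 2, b + 2 := ?p mod 2)) u 3 (\<sigma>(b := aval x \<sigma> (Half e))) u"
    by (rule does_clear) (use z in \<open>auto simp: fun_eq_iff\<close>)
  show ?case using does_Seq[OF 1 does_Seq[OF 2 3 order_refl] order_refl] unfolding acomp.simps atime.simps .
next
  case (Inp e)
  let ?p = "aval x \<sigma> e" and ?t = "aval x \<sigma> (Inp e)"
  let ?s1 = "\<sigma>(b + 1 := ?p)"
  have 1: "does x (acomp (b + 1) e) \<sigma> u (atime e m) ?s1 u"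
    by (rule Inp.IH) (use Inp.prems in auto)
  have le: "?p \<le> abound e m" by (rule aval_le; use Inp.prems in auto)
  have z: "\<sigma> b = 0" "\<sigma> (Suc b) = 0" using Inp.prems(2) by auto
  consider "?t = 0" | "?t = 1" | "?t = 2" using tape_of_less[of x "int ?p"] by fastforce
  then have 2: "does x (Branch (Is_Input (b + 1) 0) Skip (Branch (Is_Input (b + 1) 1) (Inc b) (Seq (Inc b) (Inc b))))
      ?s1 u 4 (?s1(b := ?t)) u"
  proof cases
    case 1
    then show ?thesis by (intro does_True[OF _ does_Skip[where t = 0]]) (use z in \<open>auto simp: fun_eq_iff\<close>)
  next
    case 2
    then show ?thesis by (intro does_False[OF _ does_True[OF _ does_Inc[where t = 1] order_refl]]) (use z in \<open>auto simp: fun_eq_iff\<close>)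
  next
    case 3
    then show ?thesis
      by (intro does_False[OF _ does_False[OF _ does_Seq[OF does_Inc[OF refl order_refl] does_Inc[OF _ order_refl] order_refl] order_refl]])
         (use z in \<open>auto simp: fun_eq_iff\<close>)
  qed
  have 3: "does x (clear (b + 1)) (?s1(b := ?t)) u (2 * abound e m + 1) (\<sigma>(b := ?t)) u"
    by (rule does_clear) (use z le in \<open>auto simp: fun_eq_iff\<close>)
  show ?case using does_Seq[OF 1 does_Seq[OF 2 3 order_refl] order_refl] unfolding acomp.simps atime.simps .
next
  case Len
  have "does x (Until (Is_Input b 0) (Inc b)) (\<sigma>(b := length x - k)) u (2 * k + 1) (\<sigma>(b := length x)) u"
    if "k \<le> length x" for k
    using that
  proof (induction k)
    case 0
    then show ?case by (auto intro!: does_Exit simp: tape_of_def)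
  next
    case (Suc k)
    have "does x (Inc b) (\<sigma>(b := length x - Suc k)) u 1 (\<sigma>(b := length x - k)) u"
      by (rule does_Inc) (use Suc.prems in \<open>auto simp: Suc_diff_Suc\<close>)
    then show ?case
      by (rule does_Loop[rotated, OF _ Suc.IH]) (use Suc.prems in \<open>auto simp: tape_of_def\<close>)
  qed
  from this[of "length x"] have "does x (Until (Is_Input b 0) (Inc b)) (\<sigma>(b := 0)) u (2 * length x + 1) (\<sigma>(b := length x)) u"
    by simp
  moreover have "\<sigma>(b := 0) = \<sigma>" using Len.prems(2)[of b] by auto
  ultimately have "does x (Until (Is_Input b 0) (Inc b)) \<sigma> u (2 * length x + 1) (\<sigma>(b := length x)) u" by simp
  then show ?case unfolding acomp.simps atime.simps aval.simps
    by (rule does_mono) (use Len.prems(4) in simp)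
qed

lemma poly_bounded_abound: "poly_bounded (abound e)"
  by (induction e)
     (simp_all only: abound.simps, (intro poly_bounded_const poly_bounded_id poly_bounded_add poly_bounded_mult | assumption)+)

lemma poly_bounded_atime: "poly_bounded (atime e)"
  by (induction e)
     (simp_all only: atime.simps,
      (intro poly_bounded_const poly_bounded_id poly_bounded_add poly_bounded_mult poly_bounded_abound | assumption)+)

section \<open>Output by bounded loops\<close>

datatype emission = Emit "bool list" | Emit_Nat aexp | Then emission emission | For aexp emission

text \<open>Inside the \<open>For\<close> loop with base \<open>b\<close> the loop index is the variable \<open>b + 1\<close>; variable \<open>b\<close> holds the
  number of remaining rounds.\<close>

primrec emits :: "bool list \<Rightarrow> (nat \<Rightarrow> nat) \<Rightarrow> nat \<Rightarrow> emission \<Rightarrow> bool list" where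
  "emits x \<sigma> b (Emit w) = w"
| "emits x \<sigma> b (Emit_Nat e) = encode_nat (aval x \<sigma> e)"
| "emits x \<sigma> b (Then c d) = emits x \<sigma> b c @ emits x \<sigma> b d"
| "emits x \<sigma> b (For e c) = concat (map (\<lambda>i.
     emits x (\<sigma>(b := aval x \<sigma> e - Suc i, b + 1 := i)) (b + 2) c) [0..<aval x \<sigma> e])"

primrec scoped :: "nat \<Rightarrow> emission \<Rightarrow> bool" where
  "scoped b (Emit w) \<longleftrightarrow> True"
| "scoped b (Emit_Nat e) \<longleftrightarrow> vars e \<subseteq> {..<b}"
| "scoped b (Then c d) \<longleftrightarrow> scoped b c \<and> scoped b d"
| "scoped b (For e c) \<longleftrightarrow> vars e \<subseteq> {..<b} \<and> scoped (b + 2) c"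

text \<open>Repeated halving yields the bits from the lowest one up, the order of
  \<open>bits\<close>; each is preceded by \<open>True\<close>, and a final \<open>False\<close>
  ends the code.\<close>

definition out_nat :: "nat \<Rightarrow> com" where
  "out_nat b = Seq (Until (Is_Zero b)
     (Seq (Out True) (Seq (halve b (b + 1) (b + 2))
       (Seq (Branch (Is_Zero (b + 2)) (Out False) (Seq (Dec (b + 2)) (Out True))) (transfer (b + 1) b)))))
     (Out False)"

lemma delimit_bits: "n \<noteq> 0 \<Longrightarrow> encode_nat n = [True, odd n] @ encode_nat (n div 2)"
  by (simp add: encode_nat_def delimit_def bits_pos)

lemma does_out_nat:
  assumes "\<sigma> (b + 1) = 0" "\<sigma> (b + 2) = 0"
  shows "does x (out_nat b) \<sigma> u (\<sigma> b * (8 * \<sigma> b + 10) + 2) (\<sigma>(b := 0)) (u @ encode_nat (\<sigma> b))"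
proof -
  let ?c = "Seq (Out True) (Seq (halve b (b + 1) (b + 2))
       (Seq (Branch (Is_Zero (b + 2)) (Out False) (Seq (Dec (b + 2)) (Out True))) (transfer (b + 1) b)))"
  \<comment> \<open>\<open>butlast\<close> removes the terminating \<open>False\<close>, which is
    written once after the loop.\<close>
  have "does x (Until (Is_Zero b) ?c) (\<sigma>(b := n)) u (n * (8 * n + 10) + 1) (\<sigma>(b := 0)) (u @ butlast (encode_nat n))"
    for n u
  proof (induction n arbitrary: u rule: less_induct)
    case (less n)
    show ?case
    proof (cases "n = 0")
      case True
      then show ?thesis by (auto intro!: does_Exit simp: encode_nat_def delimit_def bits_0)
    next
      case False
      let ?h = "n div 2"
      have 1: "does x (Out True) (\<sigma>(b := n)) u 1 (\<sigma>(b := n)) (u @ [True])" by (rule does_Out) auto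
      have 2: "does x (halve b (b + 1) (b + 2)) (\<sigma>(b := n)) (u @ [True]) (5 * n + 1)
        (\<sigma>(b := 0, b + 1 := ?h, b + 2 := n mod 2)) (u @ [True])"
        by (rule does_halve) (use assms in \<open>auto simp: fun_eq_iff\<close>)
      have 3: "does x (Branch (Is_Zero (b + 2)) (Out False) (Seq (Dec (b + 2)) (Out True)))
         (\<sigma>(b := 0, b + 1 := ?h, b + 2 := n mod 2)) (u @ [True]) 3 (\<sigma>(b := 0, b + 1 := ?h)) (u @ [True, odd n])"
      proof (cases "odd n")
        case True
        then have "n mod 2 = 1" by presburger
        then show ?thesis using True assms
          by (intro does_False[OF _ does_Seq[OF does_Dec[OF refl order_refl]]]) (auto simp: fun_eq_iff intro!: does_Out[where t = 1, THEN back_subst[where P = "\<lambda>s. does _ _ s _ _ _ _"]])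
      next
        case False
        then have "n mod 2 = 0" by presburger
        then have "\<sigma>(b := 0, b + 1 := ?h, b + 2 := n mod 2) = \<sigma>(b := 0, b + 1 := ?h)" using assms by auto
        then show ?thesis using False assms by (intro does_True[where t = 1]) (auto intro: does_Out)
      qed
      have 4: "does x (transfer (b + 1) b) (\<sigma>(b := 0, b + 1 := ?h)) (u @ [True, odd n]) (3 * n + 1) (\<sigma>(b := ?h)) (u @ [True, odd n])"
        by (rule does_transfer) (use assms in \<open>auto simp: fun_eq_iff\<close>)
      have 5: "does x ?c (\<sigma>(b := n)) u (1 + (5 * n + 1 + (3 + (3 * n + 1)))) (\<sigma>(b := ?h)) (u @ [True, odd n])"
        by (rule does_Seq[OF 1 does_Seq[OF 2 does_Seq[OF 3 4 order_refl] order_refl] order_refl])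
      have 6: "does x (Until (Is_Zero b) ?c) (\<sigma>(b := ?h)) (u @ [True, odd n]) (?h * (8 * ?h + 10) + 1) (\<sigma>(b := 0))
         ((u @ [True, odd n]) @ butlast (encode_nat ?h))"
        by (rule less.IH) (use False in auto)
      have 7: "(u @ [True, odd n]) @ butlast (encode_nat ?h) = u @ butlast (encode_nat n)"
        using delimit_bits[OF False] by (simp add: butlast_append) (simp add: encode_nat_def delimit_def)
      have "?h * (8 * ?h + 10) \<le> (n - 1) * (8 * (n - 1) + 10)"
        using False by (intro mult_le_mono add_mono) auto
      also have "\<dots> + (8 * n + 10) \<le> n * (8 * n + 10)"
        using False by (cases n) (auto simp: algebra_simps)
      finally have "?h * (8 * ?h + 10) + (8 * n + 10) \<le> n * (8 * n + 10)" by simp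
      then show ?thesis
        by (intro does_Loop[OF _ 5 6[unfolded 7]]) (use False in auto)
    qed
  qed
  from this[of "\<sigma> b"] have 1: "does x (Until (Is_Zero b) ?c) \<sigma> u (\<sigma> b * (8 * \<sigma> b + 10) + 1) (\<sigma>(b := 0)) (u @ butlast (encode_nat (\<sigma> b)))"
    by simp
  have "butlast (encode_nat (\<sigma> b)) @ [False] = encode_nat (\<sigma> b)"
    by (simp add: encode_nat_def delimit_def)
  then have 2: "does x (Out False) (\<sigma>(b := 0)) (u @ butlast (encode_nat (\<sigma> b))) 1 (\<sigma>(b := 0)) (u @ encode_nat (\<sigma> b))"
    by (intro does_Out) auto
  show ?thesis unfolding out_nat_def by (rule does_Seq[OF 1 2]) simp
qed

primrec ecomp :: "nat \<Rightarrow> emission \<Rightarrow> com" where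
  "ecomp b (Emit w) = foldr (\<lambda>a. Seq (Out a)) w Skip"
| "ecomp b (Emit_Nat e) = Seq (acomp b e) (out_nat b)"
| "ecomp b (Then c d) = Seq (ecomp b c) (ecomp b d)"
| "ecomp b (For e c) =
     Seq (acomp b e) (Seq (countdown b (Seq (ecomp (b + 2) c) (Inc (b + 1)))) (clear (b + 1)))"

text \<open>In a loop the index and the count of remaining rounds become variables with values up to
  \<open>abound e m\<close>, so the body is measured at \<open>m + abound e m\<close>. Polynomial
  bounds survive because the nesting is fixed and they are closed under composition.\<close>

primrec etime :: "emission \<Rightarrow> nat \<Rightarrow> nat" where
  "etime (Emit w) = (\<lambda>m. length w)"
| "etime (Emit_Nat e) = (\<lambda>m. atime e m + (abound e m * (8 * abound e m + 10) + 2))"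
| "etime (Then c d) = (\<lambda>m. etime c m + etime d m)"
| "etime (For e c) = (\<lambda>m. atime e m + (abound e m * (etime c (m + abound e m) + 1 + 2) + 1 + (2 * abound e m + 1)))"

lemma does_ecomp:
  assumes "scoped b c" "\<And>r. r \<ge> b \<Longrightarrow> \<sigma> r = 0" "\<And>i. i < b \<Longrightarrow> \<sigma> i \<le> m" "length x \<le> m"
  shows "does x (ecomp b c) \<sigma> u (etime c m) \<sigma> (u @ emits x \<sigma> b c)"
  using assms
proof (induction c arbitrary: b \<sigma> m u)
  case (Emit w)
  show ?case
  proof (induction w arbitrary: u)
    case Nil
    then show ?case by (simp add: does_Skip)
  next
    case (Cons a w)
    show ?case using does_Seq[OF does_Out[OF refl order_refl] Cons, where k = "Suc (length w)"] by simp
  qed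
next
  case (Emit_Nat e)
  let ?p = "aval x \<sigma> e"
  have le: "?p \<le> abound e m" by (rule aval_le) (use Emit_Nat.prems in auto)
  have 1: "does x (acomp b e) \<sigma> u (atime e m) (\<sigma>(b := ?p)) u"
    by (rule does_acomp) (use Emit_Nat.prems in auto)
  have "does x (out_nat b) (\<sigma>(b := ?p)) u ((\<sigma>(b := ?p)) b * (8 * (\<sigma>(b := ?p)) b + 10) + 2)
      (\<sigma>(b := ?p, b := 0)) (u @ encode_nat ((\<sigma>(b := ?p)) b))"
    by (rule does_out_nat) (use Emit_Nat.prems(2) in auto)
  moreover have "\<sigma>(b := ?p, b := 0) = \<sigma>" using Emit_Nat.prems(2)[of b] by auto
  ultimately have "does x (out_nat b) (\<sigma>(b := ?p)) u (?p * (8 * ?p + 10) + 2) \<sigma> (u @ encode_nat ?p)"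
    by simp
  then have 2: "does x (out_nat b) (\<sigma>(b := ?p)) u (abound e m * (8 * abound e m + 10) + 2) \<sigma> (u @ encode_nat ?p)"
    by (rule does_mono) (intro add_mono mult_le_mono le order_refl)
  show ?case using does_Seq[OF 1 2 order_refl] by simp
next
  case (Then c d)
  have 1: "does x (ecomp b c) \<sigma> u (etime c m) \<sigma> (u @ emits x \<sigma> b c)"
    by (rule Then.IH(1)) (use Then.prems in auto)
  have 2: "does x (ecomp b d) \<sigma> (u @ emits x \<sigma> b c) (etime d m) \<sigma> ((u @ emits x \<sigma> b c) @ emits x \<sigma> b d)"
    by (rule Then.IH(2)) (use Then.prems in auto)
  show ?case using does_Seq[OF 1 2 order_refl] by simp
next
  case (For e c)
  let ?p = "aval x \<sigma> e"
  let ?f = "\<lambda>i. \<sigma>(b := ?p - i, b + 1 := i)"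
  let ?w = "\<lambda>i. emits x (\<sigma>(b := ?p - Suc i, b + 1 := i)) (b + 2) c"
  let ?v = "\<lambda>i. u @ concat (map ?w [0..<i])"
  have le: "?p \<le> abound e m" by (rule aval_le) (use For.prems in auto)
  have 1: "does x (acomp b e) \<sigma> u (atime e m) (\<sigma>(b := ?p)) u"
    by (rule does_acomp) (use For.prems in auto)
  have z: "\<sigma> b = 0" "\<sigma> (Suc b) = 0" using For.prems(2) by auto
  have body: "does x (Seq (ecomp (b + 2) c) (Inc (b + 1))) ((?f i)(b := ?p - Suc i)) (?v i)
      (etime c (m + abound e m) + 1) (?f (Suc i)) (?v (Suc i))" if "i < ?p" for i
  proof (rule does_Seq)
    let ?s = "\<sigma>(b := ?p - Suc i, b + 1 := i)"
    have "(?f i)(b := ?p - Suc i) = ?s" by auto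
    moreover have "does x (ecomp (b + 2) c) ?s (?v i) (etime c (m + abound e m)) ?s (?v i @ ?w i)"
    proof (rule For.IH)
      show "?s j' = 0" if "b + 2 \<le> j'" for j'
        using that For.prems(2)[of j'] by simp
      show "?s j \<le> m + abound e m" if "j < b + 2" for j
        using that \<open>i < ?p\<close> le For.prems(3)[of j] by (auto simp: less_Suc_eq)
    qed (use For.prems(1,4) in auto)
    ultimately show "does x (ecomp (b + 2) c) ((?f i)(b := ?p - Suc i)) (?v i) (etime c (m + abound e m)) ?s (?v (Suc i))"
      by simp
    show "does x (Inc (b + 1)) ?s (?v (Suc i)) 1 (?f (Suc i)) (?v (Suc i))"
      by (rule does_Inc) auto
  qed simp
  have "does x (countdown b (Seq (ecomp (b + 2) c) (Inc (b + 1)))) (\<sigma>(b := ?p)) u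
      (?p * (etime c (m + abound e m) + 1 + 2) + 1) (\<sigma>(b + 1 := ?p)) (?v ?p)"
    by (rule does_countdown'[where f = ?f and v = ?v, OF body]) (use z in \<open>auto simp: fun_eq_iff\<close>)
  then have 2: "does x (countdown b (Seq (ecomp (b + 2) c) (Inc (b + 1)))) (\<sigma>(b := ?p)) u
      (abound e m * (etime c (m + abound e m) + 1 + 2) + 1) (\<sigma>(b + 1 := ?p)) (?v ?p)"
    by (rule does_mono) (intro add_mono mult_le_mono le order_refl)
  have 3: "does x (clear (b + 1)) (\<sigma>(b + 1 := ?p)) (?v ?p) (2 * abound e m + 1) \<sigma> (?v ?p)"
    by (rule does_clear) (use z le in \<open>auto simp: fun_eq_iff\<close>)
  show ?case using does_Seq[OF 1 does_Seq[OF 2 3 order_refl] order_refl] by simp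
qed

lemma poly_bounded_etime: "poly_bounded (etime c)"
proof (induction c)
  case (For e c)
  have "poly_bounded (\<lambda>m. etime c (m + abound e m))"
    by (intro poly_bounded_comp[OF For] poly_bounded_add poly_bounded_id poly_bounded_abound)
  then show ?case
    unfolding etime.simps
    by (intro poly_bounded_const poly_bounded_add poly_bounded_mult poly_bounded_abound poly_bounded_atime)
next
  case (Then c d)
  then show ?case unfolding etime.simps by (rule poly_bounded_add)
next
  case (Emit_Nat e)
  show ?case unfolding etime.simps
    by (intro poly_bounded_const poly_bounded_add poly_bounded_mult poly_bounded_abound poly_bounded_atime)
next
  case (Emit w)
  show ?case unfolding etime.simps by (rule poly_bounded_const)
qed

theorem polytime_emission:
  assumes "scoped 0 c"
  shows "polytime (\<lambda>x. emits x (\<lambda>_. 0) 0 c)"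
proof (rule polytime_program[OF _ poly_bounded_etime])
  fix x
  show "\<exists>t\<le>etime c (length x). big x (ecomp 0 c) (\<lambda>_. 0) [] t (\<lambda>_. 0) (emits x (\<lambda>_. 0) 0 c)"
    using does_ecomp[OF assms, of "\<lambda>_. 0" "length x" x "[]"] unfolding does_def by simp
qed

section \<open>The reduction\<close>

subsection \<open>Derived expressions and emissions\<close>

primrec power_e :: "aexp \<Rightarrow> nat \<Rightarrow> aexp" where
  "power_e e 0 = C 1"
| "power_e e (Suc n) = Mul e (power_e e n)"

lemma aval_power_e [simp]: "aval x \<sigma> (power_e e n) = aval x \<sigma> e ^ n"
  by (induction n) auto

lemma vars_power_e: "vars (power_e e n) \<subseteq> vars e"
  by (induction n) auto

definition sum_e :: "aexp list \<Rightarrow> aexp" where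
  "sum_e es = foldr Add es (C 0)"

lemma aval_sum_e [simp]: "aval x \<sigma> (sum_e es) = sum_list (map (aval x \<sigma>) es)"
  by (induction es) (simp_all add: sum_e_def)

lemma vars_sum_e [simp]: "vars (sum_e es) = (\<Union>e\<in>set es. vars e)"
  by (induction es) (simp_all add: sum_e_def)

definition number_e :: "aexp \<Rightarrow> (nat \<Rightarrow> aexp) \<Rightarrow> aexp" where
  "number_e b d = sum_e (map (\<lambda>i. Mul (d i) (power_e b i)) [0..<16])"

lemma aval_number_e: "aval x \<sigma> (number_e b d) = (\<Sum>i<16. aval x \<sigma> (d i) * aval x \<sigma> b ^ i)"
  by (simp add: number_e_def o_def interv_sum_list_conv_sum_set_nat atLeast0LessThan)

lemma vars_number_e: "vars b \<subseteq> A \<Longrightarrow> (\<And>i. i < 16 \<Longrightarrow> vars (d i) \<subseteq> A) \<Longrightarrow> vars (number_e b d) \<subseteq> A"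
  using vars_power_e unfolding number_e_def by fastforce

definition differ_e :: "aexp \<Rightarrow> aexp \<Rightarrow> aexp" where
  "differ_e a b = Add (Sub a b) (Sub b a)"

lemma aval_differ_e [simp]: "aval x \<sigma> (differ_e a b) = 0 \<longleftrightarrow> aval x \<sigma> a = aval x \<sigma> b"
  by (auto simp: differ_e_def)

lemma vars_differ_e [simp]: "vars (differ_e a b) = vars a \<union> vars b"
  by (auto simp: differ_e_def)

definition then_all :: "emission list \<Rightarrow> emission" where
  "then_all es = foldr Then es (Emit [])"

lemma emits_then_all [simp]: "emits x \<sigma> b (then_all es) = concat (map (emits x \<sigma> b) es)"
  by (induction es) (simp_all add: then_all_def)

lemma scoped_then_all [simp]: "scoped b (then_all es) \<longleftrightarrow> (\<forall>e\<in>set es. scoped b e)"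
  by (induction es) (simp_all add: then_all_def)

text \<open>Merges the nested loops over rows, columns and kinds into one enumeration of the
  items.\<close>

lemma concat_map_mult:
  "concat (map h [0..<a * b]) = concat (map (\<lambda>i. concat (map (\<lambda>j. h (i * b + j)) [0..<b])) [0..<a])"
proof (induction a)
  case (Suc a)
  have "[0..<Suc a * b] = [0..<a * b] @ map (\<lambda>j. a * b + j) [0..<b]"
    using upt_add_eq_append[of 0 "a * b" b] map_add_upt[of "a * b" b] by (simp add: add.commute)
  then show ?case using Suc by (simp add: o_def)
qed simp

lemma concat_map_concat: "concat (map f (concat xss)) = concat (map (\<lambda>xs. concat (map f xs)) xss)"
  by (induction xss) auto

lemma encode_int_nat: "encode_int (int n) = [False] @ encode_nat n"
  by (simp add: encode_int_def)

text \<open>\<open>j * k + 1\<close> is coprime to \<open>k\<close> and thus to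
  \<open>k * k\<close>, so numerator and denominator are encoded as they stand.\<close>

lemma encode_group_angle:
  assumes "0 < k"
  shows "encode_rat (group_angle k j) = [False] @ encode_nat (j * k + 1) @ [False] @ encode_nat (k * k)"
proof -
  have "coprime (int (j * k + 1)) (int k)"
  proof (rule coprimeI)
    fix d assume "d dvd int (j * k + 1)" "d dvd int k"
    then have "d dvd int (j * k + 1) - int j * int k" by (intro dvd_diff dvd_mult)
    then show "is_unit d" by simp
  qed
  then have "coprime (int (j * k + 1)) (int (k * k))" by (simp only: of_nat_mult coprime_mult_right_iff)
  moreover have "group_angle k j = Fract (int (j * k + 1)) (int (k * k))"
    unfolding group_angle_def Fract_of_int_quotient by simp
  ultimately have "quotient_of (group_angle k j) = (int (j * k + 1), int (k * k))"
    using assms by (simp only: quotient_of_Fract) (intro normalize_stable, simp_all)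
  then show ?thesis unfolding encode_rat_def encode_prod_def by (simp only: fst_conv snd_conv encode_int_nat append_assoc)
qed

lemma nth_delimit:
  "j < 2 * length x + 1 \<Longrightarrow>
     delimit x ! j = (if j < 2 * length x then if even j then True else x ! (j div 2) else False)"
proof (induction x arbitrary: j)
  case (Cons a x)
  have d: "delimit (a # x) = True # a # delimit x" by (simp add: delimit_def)
  consider "j = 0" | "j = 1" | i where "j = Suc (Suc i)" by (metis One_nat_def not0_implies_Suc)
  then show ?case
  proof cases
    case 3
    then show ?thesis using Cons.IH[of i] Cons.prems by (auto simp: d)
  qed (simp_all add: d)
qed (simp add: delimit_def)

subsection \<open>The instance for a word\<close>

text \<open>Certificates for \<open>x\<close> have length at most \<open>lc * length x ^ lk + lc\<close>, and \<open>M\<close> verifies a word of length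
  \<open>n\<close> in time \<open>tc * n ^ tk + tc\<close>.\<close>

locale reduction = finite_machine +
  fixes lc lk tc tk P :: nat
begin

definition "Lx x = lc * length x ^ lk + lc" for x :: "bool list"
definition "Sx x = 2 * length x + 1 + Lx x" for x :: "bool list"
text \<open>Besides the running time on words up to length \<open>Sx x\<close>, the summand
  \<open>Sx x\<close> ensures that the window of the tape contains the whole word.\<close>

definition "Tx x = tc * Sx x ^ tk + tc + Sx x" for x :: "bool list"
definition "Wx x = 2 * Tx x + 3" for x :: "bool list"
definition "Nx x = (Tx x + 1) * Wx x" for x :: "bool list"
definition "class_at x v = cell_class x (Tx x) (Lx x) (v div Wx x) (v mod Wx x)" for x :: "bool list"
definition "\<rho> x v = representative (class_at x v)" for x :: "bool list"
definition "kds = tile_system.kinds G \<Gamma>"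
definition "groups x = Nx x * length kds" for x :: "bool list"
text \<open>A common factor of all sizes and of the capacity. Once
  \<open>1 \<le> P * (1 - \<alpha>)\<close>, its power with exponent \<open>1 - \<alpha>\<close>
  exceeds the number of groups.\<close>

definition "scaling x = (groups x + 1) ^ P" for x :: "bool list"
definition "size_at x y = tile_system.item_size \<Gamma> (Nx x) (Wx x) cl col (\<rho> x) y" for x :: "bool list"
definition "group_size x g = scaling x * size_at x (tile_system.item G \<Gamma> g)" for x :: "bool list"
definition "capacity x = scaling x * tile_system.bin_size \<Gamma> (Nx x)" for x :: "bool list"
definition "bins x = Nx x * (G + 2 * \<Gamma>)" for x :: "bool list"
definition query :: "bool list \<Rightarrow> description \<times> bound" where
  "query x = (packing_description (groups x) (group_size x) (bins x) (capacity x), packing_bound (groups x) (group_size x))"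

lemma Nx_pos: "0 < Nx x" and Wx_pos: "0 < Wx x"
  by (simp_all add: Nx_def Wx_def)

lemma tiles_x: "tile_system G \<Gamma> (Nx x) cl col"
  using tile_system[OF Nx_pos] .

lemma Tx_ge: "2 * length x + 1 + Lx x \<le> Tx x"
  by (simp add: Tx_def Sx_def)

lemma \<rho>_less: "\<rho> x v < G"
  unfolding \<rho>_def class_at_def by (rule representative(1)[OF cell_class_in])

lemma scaling_pos: "0 < scaling x"
  by (simp add: scaling_def)

lemma groups_pos: "0 < groups x"
  unfolding groups_def kds_def using Nx_pos tile_system.kinds_nonempty[OF tiles_x] by simp

lemma query_iff_certificate:
  assumes \<alpha>: "0 \<le> \<alpha>" "\<alpha> < 1" and P: "1 \<le> real P * (1 - \<alpha>)"
  shows "packing_instance (groups x) (capacity x) (group_size x) \<alpha>"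
    and "query x \<in> FLaMECaST \<alpha> \<longleftrightarrow>
      (\<exists>y. length y \<le> Lx x \<and> fst (lab (config_at M (delimit x @ y) (Tx x)) 0) = 2)"
proof -
  interpret ts: tile_system G \<Gamma> "Nx x" "Wx x" cl col by (rule tiles_x)
  have base: "1 \<le> ts.base" by (simp add: ts.base_def)
  have size: "1 \<le> size_at x y" for y
  proof -
    \<comment> \<open>The digit for the slots alone makes every size positive.\<close>
    have "1 \<le> ts.digit (\<rho> x) 15 y" using ts.slots_pos by (simp add: ts.digit_def case_prod_unfold)
    then have "1 * 1 \<le> ts.digit (\<rho> x) 15 y * ts.base ^ 15" using base by (intro mult_le_mono one_le_power)
    also have "\<dots> \<le> size_at x y" unfolding size_at_def ts.item_size_def
      by (rule member_le_sum[of 15 "{..<16}" "\<lambda>i. ts.digit (\<rho> x) i y * ts.base ^ i"]) auto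
    finally show ?thesis by simp
  qed
  have a_ge: "scaling x \<le> group_size x g" for g
    using size by (simp add: group_size_def)
  have cap: "0 < capacity x"
  proof -
    have "1 * 1 \<le> ts.target 15 * ts.base ^ 15" using base by (intro mult_le_mono one_le_power) (simp add: ts.target_def)
    also have "\<dots> \<le> ts.bin_size" unfolding ts.bin_size_def
      by (rule member_le_sum[of 15 "{..<16}" "\<lambda>i. ts.target i * ts.base ^ i"]) auto
    finally show ?thesis using scaling_pos by (simp add: capacity_def)
  qed
  show inst: "packing_instance (groups x) (capacity x) (group_size x) \<alpha>"
  proof
    fix g
    show "0 < group_size x g" using a_ge[of g] scaling_pos[of x] by linarith
    have k: "0 < real (groups x)" using groups_pos by simp
    \<comment> \<open>The \<open>+ 1\<close> in \<open>scaling\<close> makes the comparison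
      strict.\<close>
    have "real (groups x) < (real (groups x) + 1) powr 1" by simp
    also have "\<dots> \<le> (real (groups x) + 1) powr (real P * (1 - \<alpha>))" using P by (intro powr_mono) auto
    also have "\<dots> = real (scaling x) powr (1 - \<alpha>)"
      using k by (simp add: scaling_def powr_powr[symmetric] powr_realpow add.commute)
    also have "\<dots> \<le> real (group_size x g) powr (1 - \<alpha>)" using a_ge[of g] \<alpha> by (intro powr_mono2) auto
    finally have "real (groups x) < real (group_size x g) powr (1 - \<alpha>)" .
    then have "1 / real (group_size x g) powr (1 - \<alpha>) < 1 / real (groups x)" using k
      by (intro divide_strict_left_mono mult_pos_pos) linarith+
    then show "real (group_size x g) powr (\<alpha> - 1) < 1 / real (groups x)"
      using powr_minus_divide[of "real (group_size x g)" "1 - \<alpha>"] by simp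
  qed (use \<alpha> cap groups_pos in auto)
  have "query x \<in> FLaMECaST \<alpha> \<longleftrightarrow> packable (groups x) (group_size x) (bins x) (capacity x)"
    unfolding query_def by (rule packing_instance.FLaMECaST_packing[OF inst])
  also have "\<dots> \<longleftrightarrow> (\<exists>z. ts.solves (\<rho> x) z)"
    using ts.packable_iff_solvable[of "\<rho> x" "scaling x", OF \<rho>_less scaling_pos]
    unfolding groups_def kds_def bins_def capacity_def group_size_def[abs_def] size_at_def .
  also have "\<dots> \<longleftrightarrow> (\<exists>B. labelling (Nx x) (Wx x) (class_at x) B)"
    unfolding \<rho>_def[abs_def] by (rule solves_iff_labelling[OF Nx_pos]) (simp add: class_at_def cell_class_in)
  also have "\<dots> \<longleftrightarrow> (\<exists>y. length y \<le> Lx x \<and> fst (lab (config_at M (delimit x @ y) (Tx x)) 0) = 2)"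
    using labelling_accepting[OF Tx_ge, of x] accepting_labelling[OF Tx_ge, of _ x]
    unfolding class_at_def[abs_def] Nx_def Wx_def by blast
  finally show "query x \<in> FLaMECaST \<alpha> \<longleftrightarrow>
      (\<exists>y. length y \<le> Lx x \<and> fst (lab (config_at M (delimit x @ y) (Tx x)) 0) = 2)" .
qed


subsection \<open>The program\<close>

definition "L_e = Add (Mul (C lc) (power_e Len lk)) (C lc)"
definition "S_e = Add (Add (Mul (C 2) Len) (C 1)) L_e"
definition "T_e = Add (Add (Mul (C tc) (power_e S_e tk)) (C tc)) S_e"
definition "W_e = Add (Mul (C 2) T_e) (C 3)"
definition "N_e = Mul (Add T_e (C 1)) W_e"
definition "Mx_e = Add (Mul N_e (C \<Gamma>)) (C 1)"
definition "base_e = Add (Mul (C 6) Mx_e) (C 7)"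
definition "groups_e = Mul N_e (C (length kds))"
definition "scaling_e = power_e (Add groups_e (C 1)) P"
definition "bins_e = Mul N_e (C (G + 2 * \<Gamma>))"

lemma vars_closed [simp]:
  "vars L_e = {}" "vars S_e = {}" "vars T_e = {}" "vars W_e = {}" "vars N_e = {}" "vars Mx_e = {}"
  "vars base_e = {}" "vars groups_e = {}" "vars scaling_e = {}" "vars bins_e = {}"
proof -
  show L: "vars L_e = {}" using vars_power_e[of Len lk] by (simp add: L_e_def)
  show S: "vars S_e = {}" by (simp add: S_e_def L)
  show T: "vars T_e = {}" using vars_power_e[of S_e tk] by (simp add: T_e_def S)
  show W: "vars W_e = {}" by (simp add: W_e_def T)
  show N: "vars N_e = {}" by (simp add: N_e_def T W)
  show M: "vars Mx_e = {}" by (simp add: Mx_e_def N)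
  show "vars base_e = {}" by (simp add: base_e_def M)
  show g: "vars groups_e = {}" by (simp add: groups_e_def N)
  show "vars scaling_e = {}" using vars_power_e[of "Add groups_e (C 1)" P] by (simp add: scaling_e_def g)
  show "vars bins_e = {}" by (simp add: bins_e_def N)
qed

lemma aval_closed [simp]:
  "aval x \<sigma> L_e = Lx x" "aval x \<sigma> S_e = Sx x" "aval x \<sigma> T_e = Tx x" "aval x \<sigma> W_e = Wx x" "aval x \<sigma> N_e = Nx x"
  "aval x \<sigma> Mx_e = tile_system.Mx \<Gamma> (Nx x)" "aval x \<sigma> base_e = tile_system.base \<Gamma> (Nx x)"
  "aval x \<sigma> groups_e = groups x" "aval x \<sigma> scaling_e = scaling x" "aval x \<sigma> bins_e = bins x"
proof -
  show L: "aval x \<sigma> L_e = Lx x" by (simp add: L_e_def Lx_def)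
  show S: "aval x \<sigma> S_e = Sx x" by (simp add: S_e_def Sx_def L)
  show T: "aval x \<sigma> T_e = Tx x" by (simp add: T_e_def Tx_def S)
  show W: "aval x \<sigma> W_e = Wx x" by (simp add: W_e_def Wx_def T)
  show N: "aval x \<sigma> N_e = Nx x" by (simp add: N_e_def Nx_def T W)
  show M: "aval x \<sigma> Mx_e = tile_system.Mx \<Gamma> (Nx x)" by (simp add: Mx_e_def tile_system.Mx_def[OF tiles_x] N)
  show "aval x \<sigma> base_e = tile_system.base \<Gamma> (Nx x)" by (simp add: base_e_def tile_system.base_def[OF tiles_x] M)
  show g: "aval x \<sigma> groups_e = groups x" by (simp add: groups_e_def groups_def N)
  show "aval x \<sigma> scaling_e = scaling x" by (simp add: scaling_e_def scaling_def g)
  show "aval x \<sigma> bins_e = bins x" by (simp add: bins_e_def bins_def N)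
qed

text \<open>Below, variable 1 is the row and variable 3 the column of the current cell.\<close>

definition "v_e = Add (Mul (V 1) W_e) (V 3)"
definition "idx_e v c = Add (Add (Mul v (C \<Gamma>)) (C c)) (C 1)"
text \<open>The shifted cell is below \<open>2 * N\<close>, so one conditional subtraction replaces
  the remainder. \<open>Sub N_e u\<close> is nonzero iff \<open>u\<close> is below
  \<open>N\<close>.\<close>

definition "next_e d = (let u = Add v_e (if d = 0 then C 1 else W_e) in Cond (Sub N_e u) u (Sub u N_e))" for d :: nat
text \<open>The verifier is fixed, so the numbers of the representatives are constants of the
  program; only the choice among them happens at run time.\<close>

definition "row_e d = Cond (V 1)
   (Cond (differ_e (V 1) T_e) (C (representative (False, False, d))) (C (representative (False, True, d))))
   (C (representative (True, False, d)))"
definition "j_e = Sub (V 3) (Add T_e (C 1))"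
text \<open>The symbol of \<open>delimit x\<close> at position \<open>j\<close>: a continuation bit
  at even \<open>j\<close>, the input symbol at half of \<open>j\<close> for odd \<open>j\<close>,
  and the terminator at \<open>2 * length x\<close>. The inner condition is the parity of
  \<open>j\<close>.\<close>

definition "sym_e = Cond (Sub (Mul (C 2) Len) j_e)
   (Cond (Sub j_e (Mul (C 2) (Half j_e))) (Inp (Half j_e)) (C 2)) (C 1)"
definition "fixed_e h = Cond (Sub sym_e (C 1))
   (C (representative (True, False, Fixed (2, h)))) (C (representative (True, False, Fixed (1, h))))"
definition "first_row_e = Cond (Sub (Add T_e (C 1)) (V 3)) (C (representative (True, False, Fixed (0, None))))
   (Cond (Sub (Add (Mul (C 2) Len) (C 1)) j_e) (Cond j_e (fixed_e None) (fixed_e (Some 0)))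
     (Cond (Sub S_e j_e) (C (representative (True, False, Certificate)))
       (C (representative (True, False, Fixed (0, None))))))"
definition "inner_e = Cond (V 1)
   (Cond (differ_e (V 1) T_e) (C (representative (False, False, Any)))
     (Cond (differ_e (V 3) (Add T_e (C 1))) (C (representative (False, True, Any)))
       (C (representative (False, True, Accepting)))))
   first_row_e"
definition "rho_e = Cond (V 3)
   (Cond (differ_e (V 3) (Add (Mul (C 2) T_e) (C 2))) inner_e (row_e (Fixed (0, None))))
   (row_e (Fixed (0, None)))"

lemma vars_cell [simp]:
  "vars v_e = {Suc 0, 3}" "vars (idx_e v c) = vars v" "vars (next_e d) = {Suc 0, 3}" "vars rho_e \<subseteq> {Suc 0, 3}"
  by (auto simp: v_e_def idx_e_def next_e_def rho_e_def inner_e_def first_row_e_def fixed_e_def sym_e_def j_e_def row_e_def Let_def)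

context
  fixes x :: "bool list" and \<sigma> :: "nat \<Rightarrow> nat" and t i :: nat
  assumes t: "\<sigma> 1 = t" "t \<le> Tx x" and i: "\<sigma> 3 = i" "i < Wx x"
begin

lemma Tx_pos: "0 < Tx x"
  using Tx_ge[of x] by simp

lemma cell_less: "t * Wx x + i < Nx x"
proof -
  have "t * Wx x + i < (t + 1) * Wx x" using i by simp
  also have "\<dots> \<le> Nx x" unfolding Nx_def using t by (intro mult_right_mono) auto
  finally show ?thesis .
qed

lemma aval_v_e: "aval x \<sigma> v_e = t * Wx x + i"
  using t(1) i(1) by (simp add: v_e_def)

lemma aval_next_e: "aval x \<sigma> (next_e d) = tile_system.next_cell (Nx x) (Wx x) d (t * Wx x + i)"
proof -
  let ?s = "if d = 0 then 1 else Wx x"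
  have "1 \<le> Nx x" using Nx_pos[of x] by simp
  moreover have "Wx x \<le> Nx x" by (simp add: Nx_def)
  ultimately have "?s \<le> Nx x" by simp
  then have "(t * Wx x + i + ?s) mod Nx x = (if t * Wx x + i + ?s < Nx x then t * Wx x + i + ?s else t * Wx x + i + ?s - Nx x)"
    using cell_less by (simp add: mod_if)
  moreover have "aval x \<sigma> (next_e d) = (if t * Wx x + i + ?s < Nx x then t * Wx x + i + ?s else t * Wx x + i + ?s - Nx x)"
    by (auto simp: next_e_def Let_def aval_v_e)
  ultimately show ?thesis by (simp add: tile_system.next_cell_def[OF tiles_x])
qed

lemma aval_sym_e:
  assumes "i - (Tx x + 1) < 2 * length x + 1"
  shows "aval x \<sigma> sym_e = tape_of (delimit x) (int (i - (Tx x + 1)))"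
proof -
  define j where "j = i - (Tx x + 1)"
  have j: "aval x \<sigma> j_e = j" by (simp add: j_e_def j_def i(1))
  have par: "j - 2 * (j div 2) = j mod 2" by presburger
  have "tape_of (delimit x) (int j) = (if delimit x ! j then 2 else 1)"
    unfolding tape_of_int using assms by (simp add: length_delimit j_def)
  also have "\<dots> = aval x \<sigma> sym_e"
    unfolding nth_delimit[OF assms, folded j_def]
    by (auto simp: sym_e_def j par tape_of_int odd_iff_mod_2_eq_one)
  finally show ?thesis by (simp add: j_def)
qed

lemma aval_first_row_e:
  assumes "t = 0" "i \<noteq> 0" "i \<noteq> 2 * Tx x + 2"
  shows "aval x \<sigma> first_row_e = representative (cell_class x (Tx x) (Lx x) t i)"
proof -
  define j where "j = i - (Tx x + 1)"
  have j: "aval x \<sigma> j_e = j" by (simp add: j_e_def j_def i(1))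
  show ?thesis
  proof (cases "i < Tx x + 1")
    case True
    then show ?thesis using assms Tx_pos i(1) by (simp add: first_row_e_def cell_class_def)
  next
    case False
    then have ij: "i = Tx x + 1 + j" by (simp add: j_def)
    consider "j < 2 * length x + 1" | "2 * length x + 1 \<le> j" "j < 2 * length x + 1 + Lx x" | "2 * length x + 1 + Lx x \<le> j"
      by linarith
    then show ?thesis
    proof cases
      case 1
      have s: "aval x \<sigma> sym_e = tape_of (delimit x) (int j)" using aval_sym_e 1 by (simp add: j_def)
      have "tape_of (delimit x) (int j) \<in> {1, 2}" unfolding tape_of_int using 1 by (simp add: length_delimit)
      then have "aval x \<sigma> (fixed_e h) = representative (True, False, Fixed (tape_of (delimit x) (int j), h))" for h
        by (auto simp: fixed_e_def s)
      then have "aval x \<sigma> first_row_e = representative (True, False, Fixed (tape_of (delimit x) (int j), if j = 0 then Some 0 else None))"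
        using 1 ij i(1) by (simp add: first_row_e_def j)
      then show ?thesis using 1 ij assms Tx_pos by (simp add: cell_class_def)
    next
      case 2
      then show ?thesis using ij i(1) assms Tx_pos by (simp add: first_row_e_def j Sx_def cell_class_def)
    next
      case 3
      then show ?thesis using ij i(1) assms Tx_pos by (simp add: first_row_e_def j Sx_def cell_class_def)
    qed
  qed
qed

lemma aval_rho_e: "aval x \<sigma> rho_e = \<rho> x (t * Wx x + i)"
proof -
  have "\<rho> x (t * Wx x + i) = representative (cell_class x (Tx x) (Lx x) t i)"
    using i(2) Wx_pos[of x] by (simp add: \<rho>_def class_at_def)
  also have "\<dots> = aval x \<sigma> rho_e"
  proof (cases "i = 0 \<or> i = 2 * Tx x + 2")
    case True
    then show ?thesis using t(1) i(1) Tx_pos by (auto simp: rho_e_def row_e_def cell_class_def)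
  next
    case False
    then have "aval x \<sigma> rho_e = aval x \<sigma> inner_e" using i(1) by (simp add: rho_e_def)
    also have "\<dots> = representative (cell_class x (Tx x) (Lx x) t i)"
    proof (cases "t = 0")
      case True
      then show ?thesis using aval_first_row_e False t(1) by (simp add: inner_e_def)
    next
      case t0: False
      then show ?thesis using False t(1) i(1) by (simp add: inner_e_def cell_class_def)
    qed
    finally show ?thesis by simp
  qed
  finally show ?thesis by simp
qed

end

text \<open>The kind is known when the program is built, because \<open>kds\<close> is a fixed list.
  What is left to run time is the cell and the class demanded there.\<close>

primrec ic_e :: "kind \<Rightarrow> aexp" where
  "ic_e (Tile \<tau>) = Sub Mx_e (idx_e v_e (cl \<tau>))"
| "ic_e (Choice \<tau>) = idx_e v_e (cl \<tau>)"
| "ic_e (Live p c) = C 0"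
| "ic_e (Dead p \<tau>) = C 0"
| "ic_e (Link d c) = Mx_e"
| "ic_e (Switch d c) = C 0"

primrec ip_e :: "nat \<Rightarrow> kind \<Rightarrow> aexp" where
  "ip_e p (Tile \<tau>) = Sub Mx_e (idx_e v_e (col p \<tau>))"
| "ip_e p (Choice \<tau>) = C 0"
| "ip_e p (Live q c) = (if q = p then idx_e v_e c else C 0)"
| "ip_e p (Dead q \<tau>) = (if q = p then idx_e v_e (col p \<tau>) else C 0)"
| "ip_e p (Link d c) =
     (if p div 2 \<noteq> d then Mx_e
      else if even p then Sub Mx_e (idx_e v_e c) else Sub Mx_e (idx_e (next_e d) c))"
| "ip_e p (Switch d c) = C 0"

primrec fl_e :: "nat \<Rightarrow> kind \<Rightarrow> aexp" where
  "fl_e p (Tile \<tau>) = C 0"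
| "fl_e p (Choice \<tau>) = Cond (differ_e (C \<tau>) rho_e) (C 1) (C 0)"
| "fl_e p (Live q c) = C (if q = p then 1 else 0)"
| "fl_e p (Dead q \<tau>) = C 0"
| "fl_e p (Link d c) = C (if p div 2 = d then 0 else 1)"
| "fl_e p (Switch d c) = C (if p div 2 = d \<and> c = 0 then 1 else 0)"

definition digit_e :: "kind \<Rightarrow> nat \<Rightarrow> aexp" where
  "digit_e \<kappa> n =
     (if n = 0 then ic_e \<kappa> else if n < 5 then ip_e (n - 1) \<kappa> else if n < 9 then fl_e (n - 5) \<kappa>
      else C (if n = 9 then tile_system.r_head \<kappa> else if n = 10 then tile_system.r_choice \<kappa>
        else if n < 15 then tile_system.r_port (n - 11) \<kappa> else tile_system.slots \<kappa>))"

definition "size_e \<kappa> = Mul scaling_e (number_e base_e (digit_e \<kappa>))"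
definition "capacity_e = Mul scaling_e
  (number_e base_e (\<lambda>n. if n < 5 then Mx_e else if n < 15 then C 1 else C 6))"

lemma vars_size_e: "vars (size_e \<kappa>) \<subseteq> {1, 3}"
proof -
  have "vars (ic_e \<kappa>) \<subseteq> {1, 3}" by (cases \<kappa>) simp_all
  moreover have "vars (ip_e p \<kappa>) \<subseteq> {1, 3}" for p by (cases \<kappa>) simp_all
  moreover have "vars (fl_e p \<kappa>) \<subseteq> {1, 3}" for p by (cases \<kappa>) simp_all
  ultimately have "vars (number_e base_e (digit_e \<kappa>)) \<subseteq> {1, 3}"
    by (intro vars_number_e) (auto simp: digit_e_def)
  then show ?thesis by (simp add: size_e_def)
qed

lemma vars_capacity_e: "vars capacity_e = {}"
  using vars_number_e[of base_e "{}" "\<lambda>n. if n < 5 then Mx_e else if n < 15 then C 1 else C 6"]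
  by (simp add: capacity_e_def)

lemma aval_capacity_e: "aval x \<sigma> capacity_e = capacity x"
proof -
  interpret ts: tile_system G \<Gamma> "Nx x" "Wx x" cl col by (rule tiles_x)
  have "aval x \<sigma> (if n < 5 then Mx_e else if n < 15 then C 1 else C 6) = ts.target n" for n
    by (simp add: ts.target_def)
  then show ?thesis by (simp add: capacity_e_def capacity_def aval_number_e ts.bin_size_def)
qed

lemma aval_size_e:
  assumes "\<sigma> 1 = t" "t \<le> Tx x" "\<sigma> 3 = i" "i < Wx x" "j < length kds"
  shows "aval x \<sigma> (size_e (kds ! j)) = group_size x ((t * Wx x + i) * length kds + j)"
proof -
  interpret ts: tile_system G \<Gamma> "Nx x" "Wx x" cl col by (rule tiles_x)
  note cell = aval_v_e[OF assms(1-4)] aval_next_e[OF assms(1-4)] aval_rho_e[OF assms(1-4)]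
  let ?v = "t * Wx x + i"
  have "aval x \<sigma> (ic_e \<kappa>) = ts.i_choice ?v \<kappa>" for \<kappa>
    by (cases \<kappa>) (simp_all add: cell idx_e_def ts.idx_def)
  moreover have "aval x \<sigma> (ip_e p \<kappa>) = ts.i_port p ?v \<kappa>" for p \<kappa>
    by (cases \<kappa>) (simp_all add: cell idx_e_def ts.idx_def)
  moreover have "aval x \<sigma> (fl_e p \<kappa>) = ts.flag (\<rho> x) p ?v \<kappa>" for p \<kappa>
    by (cases \<kappa>) (simp_all add: cell)
  ultimately have "aval x \<sigma> (digit_e \<kappa> n) = ts.digit (\<rho> x) n (?v, \<kappa>)" for \<kappa> n
    by (simp add: digit_e_def ts.digit_def)
  then have "aval x \<sigma> (size_e \<kappa>) = scaling x * size_at x (?v, \<kappa>)" for \<kappa>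
    by (simp add: size_e_def size_at_def aval_number_e ts.item_size_def)
  moreover have "ts.item (?v * length kds + j) = (?v, kds ! j)"
    using assms(5) ts.kinds_nonempty unfolding ts.item_def kds_def by simp
  ultimately show ?thesis by (simp add: group_size_def)
qed

text \<open>The two loops start at bases 0 and 2, so row and column are the variables 1 and 3 and
  the body has base 4. The kinds, constant in number, are unrolled.\<close>

definition per_item :: "(nat \<Rightarrow> emission) \<Rightarrow> emission" where
  "per_item f = For (Add T_e (C 1)) (For W_e (then_all (map f [0..<length kds])))"

lemma emits_per_item:
  assumes "\<And>\<sigma> t i j. \<sigma> 1 = t \<Longrightarrow> t \<le> Tx x \<Longrightarrow> \<sigma> 3 = i \<Longrightarrow> i < Wx x \<Longrightarrow> j < length kds \<Longrightarrow>
    emits x \<sigma> 4 (f j) = h ((t * Wx x + i) * length kds + j)"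
  shows "emits x (\<lambda>_. 0) 0 (per_item f) = concat (map h [0..<groups x])"
proof -
  let ?K = "length kds"
  have body: "concat (map (emits x \<sigma> 4) (map f [0..<?K])) = concat (map (\<lambda>j. h ((t * Wx x + i) * ?K + j)) [0..<?K])"
    if "\<sigma> 1 = t" "t \<le> Tx x" "\<sigma> 3 = i" "i < Wx x" for \<sigma> t i
    using assms[OF that] by (intro arg_cong[where f = concat]) simp
  let ?row = "\<lambda>t. concat (map (\<lambda>i. concat (map (\<lambda>j. h ((t * Wx x + i) * ?K + j)) [0..<?K])) [0..<Wx x])"
  have row: "emits x \<sigma> 2 (For W_e (then_all (map f [0..<?K]))) = ?row t" if \<sigma>: "\<sigma> 1 = t" "t \<le> Tx x" for \<sigma> t
    unfolding emits.simps emits_then_all aval_closed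
  proof (rule arg_cong[where f = concat], rule map_cong[OF refl])
    fix i assume "i \<in> set [0..<Wx x]"
    moreover have "2 + 2 = (4::nat)" "2 + 1 = (3::nat)" by simp_all
    ultimately show "concat (map (emits x (\<sigma>(2 := Wx x - Suc i, 2 + 1 := i)) (2 + 2)) (map f [0..<?K])) =
        concat (map (\<lambda>j. h ((t * Wx x + i) * ?K + j)) [0..<?K])"
      using body[of "\<sigma>(2 := Wx x - Suc i, 3 := i)" t i] \<sigma> by (simp only:) simp
  qed
  have "emits x (\<lambda>_. 0) 0 (per_item f) = concat (map ?row [0..<Tx x + 1])"
    unfolding per_item_def emits.simps(4)[where b = 0] aval.simps aval_closed add_0
  proof (rule arg_cong[where f = concat], rule map_cong[OF refl])
    fix t assume "t \<in> set [0..<Tx x + 1]"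
    then have "t \<le> Tx x" by auto
    then show "emits x ((\<lambda>_. 0)(0 := Tx x + 1 - Suc t, 1 := t)) 2 (For W_e (then_all (map f [0..<?K]))) = ?row t"
      by (intro row) auto
  qed
  also have "\<dots> = concat (map (\<lambda>v. concat (map (\<lambda>j. h (v * ?K + j)) [0..<?K])) [0..<(Tx x + 1) * Wx x])"
    by (rule concat_map_mult[symmetric])
  also have "\<dots> = concat (map h [0..<groups x])"
    unfolding groups_def Nx_def by (rule concat_map_mult[symmetric])
  finally show ?thesis .
qed

lemma scoped_per_item:
  assumes "\<And>j. j < length kds \<Longrightarrow> scoped 4 (f j)"
  shows "scoped 0 (per_item f)"
proof -
  have "scoped (0 + 2 + 2) (f j)" if "j < length kds" for j using assms[OF that] by (simp add: numeral_eq_Suc)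
  then show ?thesis unfolding per_item_def scoped.simps by auto
qed

definition "index_e j = Add (Mul v_e (C (length kds))) (C j)"

text \<open>The sources of a group are written one after the other, as often as the size says. The
  single \<open>False\<close> bits are the signs of numerator and denominator of the angle.\<close>

definition source_em :: "nat \<Rightarrow> emission" where
  "source_em j = For (size_e (kds ! j)) (then_all
     [Emit (encode_rat 1 @ [False]), Emit_Nat (Add (Mul (index_e j) groups_e) (C 1)),
      Emit [False], Emit_Nat (Mul groups_e groups_e)])"

definition bound_em :: "nat \<Rightarrow> emission" where
  "bound_em j = Then (Emit (encode_rat 1)) (Emit_Nat (size_e (kds ! j)))"

definition program :: emission where
  "program = then_all
     [Emit (encode_prod encode_rat encode_rat (0, 0)),
      Emit_Nat (Mul bins_e capacity_e), per_item source_em,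
      Emit_Nat bins_e, For bins_e (Emit (encode_prod encode_rat encode_rat (0, 0))),
      Emit (encode_nat 3), Emit_Nat capacity_e, Emit_Nat capacity_e, Emit (encode_nat 1),
      Emit_Nat groups_e, per_item bound_em]"

lemma scoped_program: "scoped 0 program"
proof -
  have "vars (size_e \<kappa>) \<subseteq> {..<4}" for \<kappa> using vars_size_e[of \<kappa>] by auto
  then have "scoped 0 (per_item source_em)" "scoped 0 (per_item bound_em)"
    by (auto intro!: scoped_per_item simp: source_em_def bound_em_def index_e_def)
  then show ?thesis by (simp add: program_def vars_capacity_e)
qed

text \<open>The list of sources is preceded by its length. As packings are exact, this is the total
  capacity, and the program does not have to add up sizes.\<close>

lemma sum_group_size: "(\<Sum>g<groups x. group_size x g) = bins x * capacity x"
proof -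
  interpret ts: tile_system G \<Gamma> "Nx x" "Wx x" cl col by (rule tiles_x)
  have "(\<Sum>g<groups x. group_size x g) = scaling x * (\<Sum>g<groups x. size_at x (ts.item g))"
    by (simp add: group_size_def sum_distrib_left)
  also have "(\<Sum>g<groups x. size_at x (ts.item g)) = Nx x * (G + 2 * \<Gamma>) * ts.bin_size"
    unfolding groups_def kds_def size_at_def by (rule ts.sum_items) (rule \<rho>_less)
  finally show ?thesis by (simp add: bins_def capacity_def algebra_simps)
qed

lemma emits_program: "emits x (\<lambda>_. 0) 0 program = encode_query (query x)"
proof -
  let ?e = "encode_prod encode_rat encode_rat"
  have sources: "emits x (\<lambda>_. 0) 0 (per_item source_em) =
      concat (map (\<lambda>g. concat (replicate (group_size x g) (?e (1, group_angle (groups x) g)))) [0..<groups x])"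
  proof (rule emits_per_item)
    fix \<sigma> :: "nat \<Rightarrow> nat" and t i j assume a: "\<sigma> 1 = t" "t \<le> Tx x" "\<sigma> 3 = i" "i < Wx x" "j < length kds"
    let ?g = "(t * Wx x + i) * length kds + j"
    have idx: "aval x (\<sigma>(4 := n, 5 := m)) (index_e j) = ?g" for n m
      using aval_v_e[of "\<sigma>(4 := n, 5 := m)" t x i] a by (simp add: index_e_def)
    have "emits x \<sigma> 4 (source_em j) = concat (map (\<lambda>_. ?e (1, group_angle (groups x) ?g)) [0..<group_size x ?g])"
      unfolding source_em_def emits.simps aval_size_e[OF a]
      by (intro arg_cong[where f = concat] map_cong refl)
         (simp add: idx encode_prod_def encode_group_angle[OF groups_pos] del: fun_upd_apply)
    also have "\<dots> = concat (replicate (group_size x ?g) (?e (1, group_angle (groups x) ?g)))"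
      by (simp add: map_replicate_const)
    finally show "emits x \<sigma> 4 (source_em j) = concat (replicate (group_size x ?g) (?e (1, group_angle (groups x) ?g)))" .
  qed
  have bounds: "emits x (\<lambda>_. 0) 0 (per_item bound_em) =
      concat (map (\<lambda>g. encode_rat 1 @ encode_nat (group_size x g)) [0..<groups x])"
    by (rule emits_per_item) (simp add: bound_em_def aval_size_e)
  have sinks: "emits x (\<lambda>_. 0) 0 (For bins_e (Emit (?e (0, 0)))) = concat (replicate (bins x) (?e (0, 0)))"
    by (simp add: map_replicate_const)
  have 1: "encode_list ?e (source_coords (fst (query x))) =
     encode_nat (bins x * capacity x) @ emits x (\<lambda>_. 0) 0 (per_item source_em)"
  proof -
    let ?xs = "map (\<lambda>j. (1 :: rat, group_angle (groups x) j)) (group_list (groups x) (group_size x))"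
    have "length ?xs = bins x * capacity x" by (simp add: length_group_list sum_group_size)
    moreover have "concat (map ?e ?xs) = emits x (\<lambda>_. 0) 0 (per_item source_em)"
      unfolding sources group_list_def by (simp add: concat_map_concat o_def)
    ultimately show ?thesis by (simp only: encode_list_def query_def packing_description_def fst_conv description.simps)
  qed
  have 2: "encode_list ?e (sink_coords (fst (query x))) =
     encode_nat (bins x) @ emits x (\<lambda>_. 0) 0 (For bins_e (Emit (?e (0, 0))))"
    unfolding sinks encode_list_def query_def packing_description_def by simp
  have 3: "encode_list encode_nat (capacity_list (fst (query x))) =
     encode_nat 3 @ encode_nat (capacity x) @ encode_nat (capacity x) @ encode_nat 1"
    unfolding encode_list_def query_def packing_description_def by (simp add: numeral_3_eq_3)
  have 4: "encode_list (encode_prod encode_rat encode_nat) (snd (query x)) =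
     encode_nat (groups x) @ emits x (\<lambda>_. 0) 0 (per_item bound_em)"
    unfolding bounds encode_list_def query_def packing_bound_def by (simp add: o_def encode_prod_def)
  have 5: "reference (fst (query x)) = (0, 0)" by (simp add: query_def packing_description_def)
  show ?thesis
    unfolding encode_query_def encode_prod_def[of encode_description] encode_description_def 1 2 3 4 5
    by (simp add: program_def aval_capacity_e del: emits.simps(4))
qed

lemma polytime_query: "polytime (\<lambda>x. encode_query (query x))"
  using polytime_emission[OF scoped_program] by (simp add: emits_program)

end

theorem theorem23:
  fixes \<alpha> :: real
  assumes "0 \<le> \<alpha>" and "\<alpha> < 1"
  shows "NP_hard_on encode_query
           {(d, B). wf_flamecast (instance_of \<alpha> d) \<and>
                    group_equally_spaced_circular (instance_of \<alpha> d) \<and>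
                    intermediate_layers (instance_of \<alpha> d) = 1}
           (FLaMECaST \<alpha>)"
  unfolding NP_hard_on_def
proof (intro allI impI)
  fix L assume "in_NP L"
  then obtain R lc lk where R: "in_P R"
    and L: "\<And>x. x \<in> L \<longleftrightarrow> (\<exists>y. length y \<le> lc * length x ^ lk + lc \<and> delimit x @ y \<in> R)"
    unfolding in_NP_def by blast
  obtain M tc tk where M: "finite (dom M)"
    and time: "\<And>u. computes_within M (tc * length u ^ tk + tc) u [u \<in> R]"
    using R unfolding in_P_def polytime_def by blast
  \<comment> \<open>\<open>P\<close> depends on \<open>\<alpha>\<close> alone and is a constant of
    the reduction.\<close>
  obtain P where "1 / (1 - \<alpha>) \<le> real P" using real_arch_simple by blast
  then have P: "1 \<le> real P * (1 - \<alpha>)" using assms by (simp add: field_simps)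
  interpret reduction M lc lk tc tk P using M by unfold_locales
  have accept: "delimit x @ y \<in> R \<longleftrightarrow> fst (lab (config_at M (delimit x @ y) (Tx x)) 0) = 2" if "length y \<le> Lx x" for x y
  proof -
    let ?u = "delimit x @ y"
    obtain n q h where n: "n \<le> tc * length ?u ^ tk + tc" and runs: "runs M (0, 0, tape_of ?u) n (q, h, tape_of [?u \<in> R])"
      using time[of ?u] unfolding computes_within_def by blast
    have "length ?u \<le> Sx x" using that by (simp add: length_delimit Sx_def)
    then have "tc * length ?u ^ tk + tc \<le> Tx x"
      unfolding Tx_def by (intro trans_le_add1 add_mono mult_left_mono power_mono) auto
    \<comment> \<open>The verifier has halted by then, so the last row shows its output, with symbol
      2 at the origin iff the answer is \<open>True\<close>.\<close>
    then have "config_at M ?u (Tx x) = (q, h, tape_of [?u \<in> R])" using runs_config_at[OF runs] n by simp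
    then show ?thesis by (simp add: tape_of_def)
  qed
  have "x \<in> L \<longleftrightarrow> query x \<in> FLaMECaST \<alpha>" for x
    unfolding L query_iff_certificate(2)[OF assms P] using accept by (auto simp: Lx_def)
  moreover have "query x \<in> {(d, B). wf_flamecast (instance_of \<alpha> d) \<and>
      group_equally_spaced_circular (instance_of \<alpha> d) \<and> intermediate_layers (instance_of \<alpha> d) = 1}" for x
    using packing_instance.wf_I packing_instance.equally_spaced_I packing_instance.layers_I
      query_iff_certificate(1)[OF assms P, of x]
    by (auto simp: query_def)
  ultimately show "\<exists>f. polytime (\<lambda>x. encode_query (f x)) \<and>
      (\<forall>x. f x \<in> {(d, B). wf_flamecast (instance_of \<alpha> d) \<and>
        group_equally_spaced_circular (instance_of \<alpha> d) \<and> intermediate_layers (instance_of \<alpha> d) = 1}) \<and>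
      (\<forall>x. x \<in> L \<longleftrightarrow> f x \<in> FLaMECaST \<alpha>)"
    using polytime_query by blast
qed

end
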